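(* Let $n\ge2$. The Green's function $G$ of the Laplacian on $\mathcal{VS}_n$ with Dirichlet boundary conditions (i.e. the function for which, for every continuous $f$, $u(x)=\int_{\mathcal{VS}_n}G(x,y)f(y)\,d\mu(y)$ solves $-\Delta u=f$, $u|_{\{q_1,\dots,q_4\}}=0$) is given as follows. For $x,y\in\mathcal{VS}_n$: (1) if $x$ and $y$ lie on different arms, $$G(x,y)=\frac{(1-d'(x,q_0))(1-d'(y,q_0))}{4};$$ (2) if $x$ and $y$ lie on the same arm and $d'(x,q_0)<d'(y,q_0)$, $$G(x,y)=\frac{(1-d'(y,q_0))(3d'(x,q_0)+1)}{4};$$ (3) if $x$ and $y$ lie on the same arm and $d'(y,q_0)<d'(x,q_0)$, $$G(x,y)=\frac{(1-d'(x,q_0))(3d'(y,q_0)+1)}{4};$$ (4) if $x$ and $y$ lie on the same arm and $d'(x,q_0)=d'(y,q_0)$, $$G(x,y)=\frac{(1-d'(y,q_0))(3d'(y,q_0)+1)}{4}+d(z,w(x,y)),$$ where $z$ is the point of the diagonals at which $y$ (and $x$) attaches and $w(x,y)$ is the last point on the intersection of the paths from $z$ to $y$ and from $z$ to $x$.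
   Context: Vicsek set. For $n\ge2$, $\mathcal{VS}_n$ is the self-similar set in a square generated by the $4n-3$ orientation-preserving homotheties $F_i$ of ratio $1/(2n-1)$ that map the square onto the $4n-3$ subsquares lying along the two diagonals of the $(2n-1)\times(2n-1)$ grid of subsquares. The square is scaled so that the distance from its center $q_0$ to each corner is $1$. The boundary consists of the four corners $q_1,\dots,q_4$. $\mathcal{VS}_n$ is a dendrite: any two points are joined by a unique simple path in $\mathcal{VS}_n$, and $d(x,y)$ denotes the length of this path. $\mathcal{VS}_n$ contains both diagonals of the square; the four connected components of $\mathcal{VS}_n\setminus\{q_0\}$, each together with $q_0$, are the arms, the $i$-th arm containing the half diagonal $[q_0,q_i]$. For $x\in\mathcal{VS}_n$, the point at which $x$ attaches to the diagonals (its projection) is the point $z$ of the union of the two diagonals closest to $x$ in the metric $d$ (so $z=x$ if $x$ is on a diagonal), and $d'(x,q_0)=d(z,q_0)$. Energy and Laplacian. $V_0=\{q_1,\dots,q_4\}$, $V_m=\bigcup_iF_i(V_{m-1})$, and $x\sim y$ in $V_m$ iff $x\ne y$ are corners of a common $m$-cell. The energy, normalized so that it is the one-dimensional energy $\int|u'|^2$ with respect to arc length summed over the line segments forming $\mathcal{VS}_n$, is $\mathcal E(u)=\frac14\lim_{m\to\infty}(2n-1)^m\sum_{x\sim y\text{ in }V_m}|u(x)-u(y)|^2$ (sum over edges); $\operatorname{dom}\mathcal E$ is the set of continuous $u$ with $\mathcal E(u)<\infty$, and $\mathcal E(u,v)$ is the associated bilinear form by polarization. $\mu$ is the self-similar probability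 measure giving mass $(4n-3)^{-m}$ to each $m$-cell. For continuous $f$ and $u\in\operatorname{dom}\mathcal E$, $-\Delta u=f$ means $\mathcal E(u,v)=\int fv\,d\mu$ for all $v\in\operatorname{dom}\mathcal E$ with $v(q_1)=\dots=v(q_4)=0$. *)

theory Defs
  imports "HOL-Analysis.Analysis"
begin

text \<open>
  Coordinates in the plane: the center is the origin and the corners are the fourth roots of
  unity, so that the center is at distance 1 from each corner and the two diagonals of the square
  lie on the coordinate axes. Corners are indexed by 1, 2, 3, 4.
\<close>

definition q0 :: complex where
  "q0 = 0"

definition corner :: "nat \<Rightarrow> complex" where
  "corner j = \<i> ^ j"

definition corners :: "complex set" where
  "corners = corner ` {1..4}"

definition diagonals :: "complex set" where
  "diagonals = closed_segment (corner 1) (corner 3) \<union> closed_segment (corner 2) (corner 4)"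

text \<open>
  In the $(2n-1) \times (2n-1)$ grid, the centers of two consecutive subsquares on a diagonal are at
  distance $2/(2n-1)$; the central subsquare is \<open>k = 0\<close> (the same map for all \<open>j\<close>), so this
  is a set of $4(n-1)+1 = 4n-3$ maps.
\<close>

definition vicsek_map :: "nat \<Rightarrow> nat \<Rightarrow> nat \<Rightarrow> complex \<Rightarrow> complex" where
  "vicsek_map n k j z =
     of_real (1 / (2 * real n - 1)) * z + of_real (2 * real k / (2 * real n - 1)) * corner j"

definition vicsek_maps :: "nat \<Rightarrow> (complex \<Rightarrow> complex) set" where
  "vicsek_maps n = {vicsek_map n k j | k j. k < n \<and> j \<in> {1..4}}"

definition vicsek :: "nat \<Rightarrow> complex set" where
  "vicsek n = (THE K. compact K \<and> K \<noteq> {} \<and> K = (\<Union>F\<in>vicsek_maps n. F ` K))"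

text \<open>The $m$-fold compositions of the maps; the $m$-cells are the images of the Vicsek set.\<close>

fun cell_maps :: "nat \<Rightarrow> nat \<Rightarrow> (complex \<Rightarrow> complex) set" where
  "cell_maps n 0 = {id}"
| "cell_maps n (Suc m) = {F \<circ> g | F g. F \<in> vicsek_maps n \<and> g \<in> cell_maps n m}"

text \<open>
  The masses of the cells determine a Borel probability measure; the case \<open>m = 0\<close> says that it is
  carried by the Vicsek set.
\<close>

definition vicsek_measure :: "nat \<Rightarrow> complex measure \<Rightarrow> bool" where
  "vicsek_measure n \<mu> \<longleftrightarrow>
     sets \<mu> = sets borel \<and> emeasure \<mu> (space \<mu>) = 1 \<and>
     (\<forall>m. \<forall>g\<in>cell_maps n m. measure \<mu> (g ` vicsek n) = 1 / real (4 * n - 3) ^ m)"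

text \<open>
  An \<open>arc\<close> has distinct end points, hence the separate clause for the trivial path.
\<close>

definition simple_path_in ::
    "complex set \<Rightarrow> complex \<Rightarrow> complex \<Rightarrow> (real \<Rightarrow> complex) \<Rightarrow> bool" where
  "simple_path_in K x y g \<longleftrightarrow>
     pathstart g = x \<and> pathfinish g = y \<and> path_image g \<subseteq> K \<and>
     (if x = y then g = (\<lambda>_. x) else arc g)"

text \<open>
  In a dendrite the simple path is unique up to reparametrization; the choice of the
  parametrization affects none of the notions below.
\<close>

definition geodesic :: "nat \<Rightarrow> complex \<Rightarrow> complex \<Rightarrow> real \<Rightarrow> complex" where
  "geodesic n x y = (SOME g. simple_path_in (vicsek n) x y g)"

text \<open>The length is the total variation; it is finite for the geodesics of the Vicsek set.\<close>

definition path_length :: "(real \<Rightarrow> 'a::metric_space) \<Rightarrow> real" where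
  "path_length g =
     Sup {\<Sum>i<k. dist (g (t i)) (g (t (Suc i))) | k t. mono t \<and> range t \<subseteq> {0..1}}"

definition vdist :: "nat \<Rightarrow> complex \<Rightarrow> complex \<Rightarrow> real" where
  "vdist n x y = path_length (geodesic n x y)"

definition arm :: "nat \<Rightarrow> nat \<Rightarrow> complex set" where
  "arm n i = insert q0 (connected_component_set (vicsek n - {q0}) (corner i))"

definition diag_proj :: "nat \<Rightarrow> complex \<Rightarrow> complex" where
  "diag_proj n x = arg_min_on (vdist n x) diagonals"

definition diag_dist :: "nat \<Rightarrow> complex \<Rightarrow> real" where
  "diag_dist n x = vdist n (diag_proj n x) q0"

text \<open>The last point of the path from \<open>z\<close> to \<open>y\<close> that lies on the path from \<open>z\<close> to \<open>x\<close>.\<close>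

definition last_common :: "nat \<Rightarrow> complex \<Rightarrow> complex \<Rightarrow> complex \<Rightarrow> complex" where
  "last_common n z x y =
     geodesic n z y (Sup {t \<in> {0..1}. geodesic n z y t \<in> path_image (geodesic n z x)})"

fun vertices :: "nat \<Rightarrow> nat \<Rightarrow> complex set" where
  "vertices n 0 = corners"
| "vertices n (Suc m) = (\<Union>F\<in>vicsek_maps n. F ` vertices n m)"

definition adjacent :: "nat \<Rightarrow> nat \<Rightarrow> complex \<Rightarrow> complex \<Rightarrow> bool" where
  "adjacent n m x y \<longleftrightarrow> x \<noteq> y \<and> (\<exists>g\<in>cell_maps n m. x \<in> g ` corners \<and> y \<in> g ` corners)"

text \<open>The sum runs over ordered pairs and counts every edge twice, hence the factor 1/2.\<close>

definition edge_sum :: "nat \<Rightarrow> nat \<Rightarrow> (complex \<Rightarrow> real) \<Rightarrow> real" where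
  "edge_sum n m u =
     (1 / 2) * (\<Sum>(x, y) \<in> {(x, y). x \<in> vertices n m \<and> y \<in> vertices n m \<and> adjacent n m x y}.
                  \<bar>u x - u y\<bar>\<^sup>2)"

definition energy :: "nat \<Rightarrow> (complex \<Rightarrow> real) \<Rightarrow> ennreal" where
  "energy n u = lim (\<lambda>m. ennreal ((1 / 4) * (2 * real n - 1) ^ m * edge_sum n m u))"

definition dom_energy :: "nat \<Rightarrow> (complex \<Rightarrow> real) set" where
  "dom_energy n = {u. continuous_on (vicsek n) u \<and> energy n u < \<infinity>}"

definition energy_form :: "nat \<Rightarrow> (complex \<Rightarrow> real) \<Rightarrow> (complex \<Rightarrow> real) \<Rightarrow> real" where
  "energy_form n u v =
     (enn2real (energy n (\<lambda>x. u x + v x)) - enn2real (energy n (\<lambda>x. u x - v x))) / 4"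

text \<open>\<open>neg_laplacian n \<mu> u f\<close> expresses $-\Delta u = f$.\<close>

definition neg_laplacian ::
    "nat \<Rightarrow> complex measure \<Rightarrow> (complex \<Rightarrow> real) \<Rightarrow> (complex \<Rightarrow> real) \<Rightarrow> bool" where
  "neg_laplacian n \<mu> u f \<longleftrightarrow>
     u \<in> dom_energy n \<and> continuous_on (vicsek n) f \<and>
     (\<forall>v\<in>dom_energy n. (\<forall>i\<in>{1..4}. v (corner i) = 0) \<longrightarrow>
        energy_form n u v = (LINT x:vicsek n|\<mu>. f x * v x))"

text \<open>
  This property determines a Green's function \<open>G x\<close> only up to a null set of second arguments, for
  each \<open>x\<close>; no regularity of the kernel is presupposed.
\<close>

definition green_function ::
    "nat \<Rightarrow> complex measure \<Rightarrow> (complex \<Rightarrow> complex \<Rightarrow> real) \<Rightarrow> bool" where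
  "green_function n \<mu> G \<longleftrightarrow>
     (\<forall>f. continuous_on (vicsek n) f \<longrightarrow>
        (\<forall>x\<in>vicsek n. set_integrable \<mu> (vicsek n) (\<lambda>y. G x y * f y)) \<and>
        (let u = (\<lambda>x. LINT y:vicsek n|\<mu>. G x y * f y)
         in neg_laplacian n \<mu> u f \<and> (\<forall>i\<in>{1..4}. u (corner i) = 0)))"

end

theory Submission
  imports Defs
begin

text \<open>
  In a tree with root \<open>0\<close>, the length \<open>common b x\<close> of the common part of the paths from \<open>0\<close> to \<open>b\<close> and to
  \<open>x\<close> has, as a function of \<open>x\<close>, slope 1 along \<open>[0, b]\<close> and slope 0 elsewhere; hence its energy form with
  \<open>v\<close> is \<open>v b - v 0\<close>. Adding a combination of \<open>common q\<^sub>i\<close> with the corners \<open>q\<^sub>i\<close> and a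
  constant gives a kernel that vanishes at the corners and has energy form \<open>v b\<close> with every \<open>v\<close> that
  vanishes there; this combination is the claimed formula.

  The tree structure comes from self-similarity: the cells are glued at single points, so if any
  two arcs with the same ends are within \<open>e\<close> of each other, then they are within \<open>r e\<close> of each other,
  where \<open>r\<close> is the contraction ratio; iterating, they have the same image. The energy identity holds
  at every level up to an error which, under subdivision, is carried by the single cell
  that contains \<open>b\<close>, and so is bounded by the oscillation of \<open>v\<close> on that cell.
\<close>

section \<open>Variation of paths\<close>

text \<open>The center is not a vertex at any level, being always the center of the central cell.
  The discrete identities therefore contain, in place of \<open>v 0\<close>, the mean of
  \<open>v\<close> over the corners of the central cell (\<open>center_avg\<close>). This fits the
  normalization 1/4: four corners joined pairwise with conductance 1/4 are equivalent to a star of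
  four unit conductances, whose center carries the mean of the corner values. The means cancel from
  combinations of potentials whose coefficients sum to 0: the kernel subtracts from the potential of
  \<open>y\<close> the corner potentials, weighted with the harmonic measure of \<open>y\<close>,
  which has total mass 1. The 3 in the formula counts the other arms: from the point at distance t
  on one half diagonal, the resistance to the corners is 1 - t in parallel with t + 1/3, that is (1
  - t)(3 t + 1)/4. A Green's function is fixed only almost everywhere for each first argument, so
  its uniqueness comes from that of the boundary value problem, followed by testing with continuous
  functions.\<close>

definition variation :: "(real \<Rightarrow> 'a::metric_space) \<Rightarrow> real set \<Rightarrow> ennreal" where
  "variation g S = (SUP (k, t) \<in> {(k, t :: nat \<Rightarrow> real). mono t \<and> range t \<subseteq> S}.
     ennreal (\<Sum>i<k. dist (g (t i)) (g (t (Suc i)))))"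

lemma variation_upper:
  assumes "mono t" "range t \<subseteq> S"
  shows "ennreal (\<Sum>i<k. dist (g (t i)) (g (t (Suc i)))) \<le> variation g S"
  unfolding variation_def by (rule SUP_upper2[of "(k, t)"]) (use assms in auto)

lemma variation_least:
  assumes "\<And>k t. mono t \<Longrightarrow> range t \<subseteq> S \<Longrightarrow>
    ennreal (\<Sum>i<k. dist (g (t i)) (g (t (Suc i)))) \<le> c"
  shows "variation g S \<le> c"
  unfolding variation_def by (rule SUP_least) (use assms in auto)

text \<open>\<open>path_length\<close> is a real \<open>Sup\<close>, which says nothing about
  unbounded sums. The extended nonnegative \<open>variation\<close> is always meaningful, and the
  real length is read off once finiteness is known.\<close>

lemma path_length_eq:
  assumes "variation g {0..1} = ennreal c" "c \<ge> 0"
  shows "path_length g = c"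
  unfolding path_length_def
proof (rule cSup_eq)
  fix x assume "x \<in> {\<Sum>i<k. dist (g (t i)) (g (t (Suc i))) |k t. mono t \<and> range t \<subseteq> {0..1}}"
  then obtain k and t :: "nat \<Rightarrow> real"
    where t: "mono t" "range t \<subseteq> {0..1}" and x: "x = (\<Sum>i<k. dist (g (t i)) (g (t (Suc i))))"
    by blast
  show "x \<le> c"
    using variation_upper[OF t, of g k] assms x by (simp add: ennreal_le_iff)
next
  fix y
  assume y: "\<And>x. x \<in> {\<Sum>i<k. dist (g (t i)) (g (t (Suc i))) |k t. mono t \<and> range t \<subseteq> {0..1}} \<Longrightarrow> x \<le> y"
  have y0: "0 \<le> y"
  proof (rule y)
    show "0 \<in> {\<Sum>i<k. dist (g (t i)) (g (t (Suc i))) |k t. mono t \<and> range t \<subseteq> {0..1}}"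
      by (rule CollectI, rule exI[of _ 0], rule exI[of _ "\<lambda>_. 0"]) (auto simp: mono_def)
  qed
  have "variation g {0..1} \<le> ennreal y"
  proof (rule variation_least)
    fix k and t :: "nat \<Rightarrow> real" assume "mono t" "range t \<subseteq> {0..1}"
    then show "ennreal (\<Sum>i<k. dist (g (t i)) (g (t (Suc i)))) \<le> ennreal y"
      by (intro ennreal_leI y) blast
  qed
  then show "c \<le> y" using assms y0 by (simp add: ennreal_le_iff)
qed

lemma variation_cong:
  assumes "\<And>x. x \<in> S \<Longrightarrow> g x = h x"
  shows "variation g S = variation h S"
proof -
  have "dist (g (t i)) (g (t (Suc i))) = dist (h (t i)) (h (t (Suc i)))"
    if "range t \<subseteq> S" for t :: "nat \<Rightarrow> real" and i
    using assms[OF subsetD[OF that rangeI]] by simp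
  then show ?thesis
    unfolding variation_def by (intro SUP_cong refl) (auto simp: split_beta)
qed

lemma variation_compose_mono:
  assumes "mono_on S \<phi>" "\<phi> ` S \<subseteq> T"
  shows "variation (g \<circ> \<phi>) S \<le> variation g T"
proof (rule variation_least)
  fix k and t :: "nat \<Rightarrow> real" assume t: "mono t" "range t \<subseteq> S"
  have "mono (\<phi> \<circ> t)"
    using t assms(1) by (intro monoI) (simp add: monotone_onD monoD image_subset_iff)
  moreover have "range (\<phi> \<circ> t) \<subseteq> T"
    using t assms(2) by auto
  ultimately show "ennreal (\<Sum>i<k. dist ((g \<circ> \<phi>) (t i)) ((g \<circ> \<phi>) (t (Suc i)))) \<le> variation g T"
    using variation_upper[of "\<phi> \<circ> t" T g k] by (simp add: o_def)
qed

lemma variation_compose_antimono: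
  assumes "antimono_on S \<phi>" "\<phi> ` S \<subseteq> T"
  shows "variation (g \<circ> \<phi>) S \<le> variation g T"
proof (rule variation_least)
  fix k and t :: "nat \<Rightarrow> real" assume t: "mono t" "range t \<subseteq> S"
  \<comment> \<open>Beyond \<open>k\<close> the truncated subtraction repeats \<open>t 0\<close>, so
    that \<open>t'\<close> is monotone on all indices.\<close>
  define t' where "t' i = \<phi> (t (k - i))" for i
  have "mono t'"
    unfolding t'_def using t assms(1)
    by (intro monoI monotone_onD[OF assms(1), simplified]) (auto simp: image_subset_iff monoD)
  moreover have "range t' \<subseteq> T"
    unfolding t'_def using t assms(2) by auto
  moreover have "(\<Sum>i<k. dist ((g \<circ> \<phi>) (t i)) ((g \<circ> \<phi>) (t (Suc i))))
      = (\<Sum>i<k. dist (g (t' i)) (g (t' (Suc i))))"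
  proof -
    have "(\<Sum>i<k. dist (g (t' i)) (g (t' (Suc i)))) = (\<Sum>i<k. dist (g (t' (k - Suc i))) (g (t' (Suc (k - Suc i)))))"
      by (rule sum.nat_diff_reindex[symmetric])
    also have "\<dots> = (\<Sum>i<k. dist ((g \<circ> \<phi>) (t i)) ((g \<circ> \<phi>) (t (Suc i))))"
      by (rule sum.cong[OF refl]) (simp add: t'_def Suc_diff_Suc dist_commute)
    finally show ?thesis by simp
  qed
  ultimately show "ennreal (\<Sum>i<k. dist ((g \<circ> \<phi>) (t i)) ((g \<circ> \<phi>) (t (Suc i)))) \<le> variation g T"
    using variation_upper[of t' T g k] by simp
qed

text \<open>One direction clamps a sequence at \<open>b\<close> from both sides and inserts
  \<open>g b\<close> by the triangle inequality; the other concatenates a sequence from each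
  half.\<close>

lemma variation_split:
  assumes "a \<le> b" "b \<le> c"
  shows "variation g {a..c} = variation g {a..b} + variation g {b..c}"
proof (rule antisym)
  show "variation g {a..c} \<le> variation g {a..b} + variation g {b..c}"
  proof (rule variation_least)
    fix k and t :: "nat \<Rightarrow> real" assume t: "mono t" "range t \<subseteq> {a..c}"
    define t1 where "t1 i = min (t i) b" for i
    define t2 where "t2 i = max (t i) b" for i
    have m: "mono t1" "mono t2"
      using t(1) unfolding t1_def t2_def mono_def by (auto simp: min_def max_def) (meson order_trans linear)+
    have ti: "a \<le> t i \<and> t i \<le> c" for i using subsetD[OF t(2) rangeI[of t i]] by auto
    have rg: "range t1 \<subseteq> {a..b}" "range t2 \<subseteq> {b..c}"
      using ti assms unfolding t1_def t2_def by auto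
    have "dist (g (t i)) (g (t (Suc i))) \<le>
        dist (g (t1 i)) (g (t1 (Suc i))) + dist (g (t2 i)) (g (t2 (Suc i)))" for i
      using monoD[OF t(1), of i "Suc i"] dist_triangle[of "g (t i)" "g (t (Suc i))" "g b"]
      unfolding t1_def t2_def by (auto simp: min_def max_def)
    then have "(\<Sum>i<k. dist (g (t i)) (g (t (Suc i)))) \<le>
        (\<Sum>i<k. dist (g (t1 i)) (g (t1 (Suc i)))) + (\<Sum>i<k. dist (g (t2 i)) (g (t2 (Suc i))))"
      unfolding sum.distrib[symmetric] by (intro sum_mono)
    then have "ennreal (\<Sum>i<k. dist (g (t i)) (g (t (Suc i)))) \<le>
        ennreal (\<Sum>i<k. dist (g (t1 i)) (g (t1 (Suc i)))) + ennreal (\<Sum>i<k. dist (g (t2 i)) (g (t2 (Suc i))))"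
      by (subst ennreal_plus[symmetric]) (auto simp: sum_nonneg simp del: ennreal_plus intro: ennreal_leI)
    also have "\<dots> \<le> variation g {a..b} + variation g {b..c}"
      by (intro add_mono variation_upper m rg)
    finally show "ennreal (\<Sum>i<k. dist (g (t i)) (g (t (Suc i)))) \<le> variation g {a..b} + variation g {b..c}" .
  qed
  have *: "ennreal (\<Sum>i<k. dist (g (t i)) (g (t (Suc i)))) + ennreal (\<Sum>i<k'. dist (g (t' i)) (g (t' (Suc i))))
      \<le> variation g {a..c}"
    if t: "mono t" "range t \<subseteq> {a..b}" and t': "mono t'" "range t' \<subseteq> {b..c}" for k k' and t t' :: "nat \<Rightarrow> real"
  proof -
    \<comment> \<open>The step from index \<open>k\<close> to \<open>Suc k\<close> bridges
      \<open>t k\<close> and \<open>t' 0\<close>; it adds one nonnegative summand, hence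
      \<open>Suc k + k'\<close> terms.\<close>
    define u where "u i = (if i \<le> k then t i else t' (i - Suc k))" for i
    have ti: "a \<le> t i \<and> t i \<le> b" "b \<le> t' i \<and> t' i \<le> c" for i
      using subsetD[OF t(2) rangeI[of t i]] subsetD[OF t'(2) rangeI[of t' i]] by auto
    have "u i \<le> u j" if "i \<le> j" for i j
      unfolding u_def using that monoD[OF t(1), of i j] monoD[OF t'(1), of "i - Suc k" "j - Suc k"] ti[of i] ti(2)[of "j - Suc k"]
      by auto
    then have "mono u" by (intro monoI)
    moreover have "range u \<subseteq> {a..c}"
      unfolding u_def using ti assms by (fastforce intro: order_trans)
    moreover have "(\<Sum>i<k. dist (g (t i)) (g (t (Suc i)))) + (\<Sum>i<k'. dist (g (t' i)) (g (t' (Suc i))))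
        \<le> (\<Sum>i<Suc k + k'. dist (g (u i)) (g (u (Suc i))))"
    proof -
      have "(\<Sum>i<Suc k + k'. dist (g (u i)) (g (u (Suc i)))) =
          (\<Sum>i<Suc k. dist (g (u i)) (g (u (Suc i)))) + (\<Sum>i<k'. dist (g (u (Suc k + i))) (g (u (Suc (Suc k + i)))))"
        by (induction k') (simp_all add: add.assoc)
      moreover have "(\<Sum>i<Suc k. dist (g (u i)) (g (u (Suc i)))) \<ge> (\<Sum>i<k. dist (g (t i)) (g (t (Suc i))))"
        by (simp add: u_def)
      moreover have "(\<Sum>i<k'. dist (g (u (Suc k + i))) (g (u (Suc (Suc k + i))))) = (\<Sum>i<k'. dist (g (t' i)) (g (t' (Suc i))))"
        by (simp add: u_def)
      ultimately show ?thesis by linarith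
    qed
    ultimately show ?thesis
      using variation_upper[of u "{a..c}" g "Suc k + k'"]
      by (subst ennreal_plus[symmetric]) (auto simp: sum_nonneg intro: ennreal_leI order_trans simp del: ennreal_plus)
  qed
  let ?S = "\<lambda>S. {(k::nat, t :: nat \<Rightarrow> real). mono t \<and> range t \<subseteq> S}"
  have ne: "?S {a..b} \<noteq> {}" "?S {b..c} \<noteq> {}"
    using assms by (auto intro!: exI[of _ "\<lambda>_. b"] simp: mono_def)
  show "variation g {a..b} + variation g {b..c} \<le> variation g {a..c}"
    unfolding variation_def[of g "{a..b}"] variation_def[of g "{b..c}"]
    by (subst ennreal_SUP_add_left[symmetric], rule ne, rule SUP_least,
        subst ennreal_SUP_add_right, rule ne, rule SUP_least) (use * in auto)
qed

lemma variation_const: "variation (\<lambda>_. x) S = 0"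
  by (rule antisym[OF variation_least]) auto

lemma variation_singleton: "variation g {a} = 0"
  using variation_cong[of "{a}" g "\<lambda>_. g a"] variation_const by simp

lemma dist_le_variation:
  assumes "a \<in> S" "b \<in> S" "a \<le> b"
  shows "ennreal (dist (g a) (g b)) \<le> variation g S"
proof -
  have "mono (\<lambda>i::nat. if i = 0 then a else b)" "range (\<lambda>i::nat. if i = 0 then a else b) \<subseteq> S"
    using assms by (auto simp: mono_def)
  from variation_upper[OF this, of g 1] show ?thesis by simp
qed

lemma variation_similarity:
  assumes "\<And>x y. dist (f x) (f y) = c * dist x y" "c \<ge> 0"
  shows "variation (f \<circ> g) S = ennreal c * variation g S"
  unfolding variation_def SUP_mult_left_ennreal
  by (intro SUP_cong refl) (auto simp: assms sum_distrib_left[symmetric] ennreal_mult' split_beta)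

lemma variation_linepath:
  fixes x :: "'a::real_normed_vector"
  shows "variation (linepath x y) {0..1} = ennreal (dist x y)"
proof (rule antisym)
  show "ennreal (dist x y) \<le> variation (linepath x y) {0..1}"
    using dist_le_variation[of 0 "{0..1}" 1 "linepath x y"] by (simp add: linepath_def)
  show "variation (linepath x y) {0..1} \<le> ennreal (dist x y)"
  proof (rule variation_least)
    fix k and t :: "nat \<Rightarrow> real" assume t: "mono t" "range t \<subseteq> {0..1}"
    have "dist (linepath x y a) (linepath x y b) = \<bar>b - a\<bar> * dist x y" for a b
    proof -
      have "linepath x y a - linepath x y b = (b - a) *\<^sub>R (x - y)"
        by (simp add: linepath_def algebra_simps)
      then show ?thesis by (simp add: dist_norm)
    qed
    then have "(\<Sum>i<k. dist (linepath x y (t i)) (linepath x y (t (Suc i)))) = (\<Sum>i<k. (t (Suc i) - t i) * dist x y)"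
      using t(1) by (intro sum.cong refl) (simp add: monoD abs_of_nonneg)
    also have "\<dots> = (t k - t 0) * dist x y"
      by (simp add: sum_distrib_right[symmetric] sum_lessThan_telescope)
    also have "\<dots> \<le> 1 * dist x y"
      using t(2) by (intro mult_right_mono) (auto simp: image_subset_iff, smt (verit))
    finally show "ennreal (\<Sum>i<k. dist (linepath x y (t i)) (linepath x y (t (Suc i)))) \<le> ennreal (dist x y)"
      by (simp add: ennreal_leI)
  qed
qed

text \<open>The inverse of \<open>h\<close> on the common image turns \<open>g\<close> into a
  reparametrization of \<open>h\<close> by an injective continuous map of the interval. Such a map
  is strictly monotone, and the common end points exclude a reversal.\<close>

lemma arc_reparam:
  fixes g h :: "real \<Rightarrow> 'a::metric_space"
  assumes "arc g" "arc h" "path_image g = path_image h" "pathstart g = pathstart h" "pathfinish g = pathfinish h"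
  obtains \<phi> where "strict_mono_on {0..1} \<phi>" "\<phi> ` {0..1} \<subseteq> {0..1}" "\<And>t. t \<in> {0..1} \<Longrightarrow> g t = h (\<phi> t)"
proof -
  obtain k where k: "homeomorphism {0..1} (path_image h) h k"
    using homeomorphism_arc[OF assms(2)] .
  define \<phi> where "\<phi> = k \<circ> g"
  have gi: "g ` {0..1} = path_image h" using assms(3) by (simp add: path_image_def)
  have c: "continuous_on {0..1} \<phi>"
    unfolding \<phi>_def using assms(1) k gi
    by (intro continuous_on_compose) (auto simp: arc_def path_def homeomorphism_def)
  have hk: "h (k y) = y" "k y \<in> {0..1}" if "y \<in> path_image h" for y
    using k that by (auto simp: homeomorphism_def)
  have kh: "k (h t) = t" if "t \<in> {0..1}" for t
    using k that by (auto simp: homeomorphism_def)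
  have gk: "g t = h (\<phi> t)" if "t \<in> {0..1}" for t
    using hk(1)[of "g t"] imageI[OF that, of g] gi unfolding \<phi>_def by auto
  have "inj_on \<phi> {0..1}"
    by (rule inj_onI) (metis gk assms(1) arc_def inj_onD)
  then have "strict_mono_on {0..1} \<phi> \<or> strict_antimono_on {0..1} \<phi>"
    using injective_eq_monotone_map[of "{0..1}" \<phi>] c by (simp add: is_interval_cc)
  moreover have "\<phi> 0 = 0" "\<phi> 1 = 1"
    using assms(4,5) kh unfolding \<phi>_def pathstart_def pathfinish_def by auto
  ultimately have "strict_mono_on {0..1} \<phi>"
    using monotone_onD[of "{0..1}" "(<)" "(>)" \<phi> 0 1] by auto
  moreover have "\<phi> ` {0..1} \<subseteq> {0..1}"
    using hk(2) gi unfolding \<phi>_def by (metis comp_apply image_eqI image_subsetI)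
  ultimately show ?thesis using that gk by blast
qed

text \<open>The length of an arc is determined by its image and its end points, so the choice made
  in \<open>geodesic\<close> does not affect it.\<close>

lemma variation_arc_cong:
  fixes g h :: "real \<Rightarrow> 'a::metric_space"
  assumes "arc g" "arc h" "path_image g = path_image h" "pathstart g = pathstart h" "pathfinish g = pathfinish h"
  shows "variation g {0..1} = variation h {0..1}"
proof -
  have "variation g {0..1} \<le> variation h {0..1}"
    if gh: "arc g" "arc h" "path_image g = path_image h" "pathstart g = pathstart h" "pathfinish g = pathfinish h"
    for g h :: "real \<Rightarrow> 'a"
  proof -
    obtain \<phi> where \<phi>: "strict_mono_on {0..1} \<phi>" "\<phi> ` {0..1} \<subseteq> {0..1}"
      "\<And>t. t \<in> {0..1} \<Longrightarrow> g t = h (\<phi> t)"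
      using arc_reparam[OF gh] by blast
    have "variation g {0..1} = variation (h \<circ> \<phi>) {0..1}"
      using \<phi>(3) by (intro variation_cong) simp
    also have "\<dots> \<le> variation h {0..1}"
      using \<phi> by (intro variation_compose_mono) (auto dest: strict_mono_on_imp_mono_on)
    finally show ?thesis .
  qed
  then show ?thesis using assms by (intro antisym) auto
qed

lemma variation_subpath:
  fixes g :: "real \<Rightarrow> 'a::{metric_space,real_normed_vector}"
  assumes "s \<le> t"
  shows "variation (subpath s t g) {0..1} = variation g {s..t}"
proof (cases "s = t")
  case True
  have "subpath s s g = (\<lambda>_. g s)" by (simp add: subpath_def)
  with True show ?thesis by (simp add: variation_const variation_singleton)
next
  case False
  with assms have st: "s < t" by simp
  show ?thesis
  proof (rule antisym)
    have eq: "subpath s t g = g \<circ> (\<lambda>x. (t - s) * x + s)"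
      by (simp add: subpath_def o_def)
    show "variation (subpath s t g) {0..1} \<le> variation g {s..t}"
      unfolding eq using st
      by (intro variation_compose_mono)
         (auto simp: monotone_on_def mult_left_le intro!: mult_left_mono, smt (verit) mult_left_le)
    have "variation g {s..t} = variation (subpath s t g \<circ> (\<lambda>x. (x - s) / (t - s))) {s..t}"
      using st by (intro variation_cong) (simp add: subpath_def)
    also have "\<dots> \<le> variation (subpath s t g) {0..1}"
      using st by (intro variation_compose_mono) (auto simp: monotone_on_def divide_right_mono)
    finally show "variation g {s..t} \<le> variation (subpath s t g) {0..1}" .
  qed
qed

lemma variation_reversepath: "variation (reversepath g) {0..1} = variation g {0..1}"
proof -
  have le: "variation (reversepath g) {0..1} \<le> variation g {0..1}" for g :: "real \<Rightarrow> 'a"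
  proof -
    have "reversepath g = g \<circ> (\<lambda>x. 1 - x)" by (simp add: reversepath_def o_def)
    then show ?thesis
      using variation_compose_antimono[of "{0..1}" "\<lambda>x. 1 - x" "{0..1}" g] by (auto simp: monotone_on_def)
  qed
  show ?thesis using le[of g] le[of "reversepath g"] by (simp add: antisym)
qed

section \<open>Uniquely arcwise connected sets and tree metrics\<close>

lemma simple_path_inD:
  assumes "simple_path_in K x y g"
  shows "g 0 = x" "g 1 = y" "path_image g \<subseteq> K" "continuous_on {0..1} g" "x \<in> path_image g" "y \<in> path_image g"
    "\<And>t. t \<in> {0..1} \<Longrightarrow> g t \<in> path_image g" "x \<in> K" "y \<in> K"
proof -
  show *: "g 0 = x" "g 1 = y" and sub: "path_image g \<subseteq> K"
    using assms by (auto simp: simple_path_in_def pathstart_def pathfinish_def)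
  show "continuous_on {0..1} g"
    using assms by (auto simp: simple_path_in_def arc_def path_def split: if_splits)
  show im: "g t \<in> path_image g" if "t \<in> {0..1}" for t
    using that by (auto simp: path_image_def)
  show xy: "x \<in> path_image g" "y \<in> path_image g" using im[of 0] im[of 1] * by auto
  show "x \<in> K" "y \<in> K" using xy sub by auto
qed

lemma simple_path_in_inj:
  assumes "simple_path_in K x y g" "x \<noteq> y"
  shows "inj_on g {0..1}" "arc g"
  using assms by (auto simp: simple_path_in_def arc_def)

lemma simple_path_in_same: "simple_path_in K x x g \<longleftrightarrow> x \<in> K \<and> g = (\<lambda>_. x)"
  by (auto simp: simple_path_in_def pathstart_def pathfinish_def path_image_def)

lemma simple_path_in_subset:
  "simple_path_in K x y g \<Longrightarrow> path_image g \<subseteq> L \<Longrightarrow> simple_path_in L x y g"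
  by (simp add: simple_path_in_def)

lemma simple_path_in_subpath:
  assumes g: "simple_path_in K x y g" and st: "0 \<le> s" "s \<le> t" "t \<le> 1"
  shows "simple_path_in K (g s) (g t) (subpath s t g)" "path_image (subpath s t g) = g ` {s..t}"
proof -
  show im: "path_image (subpath s t g) = g ` {s..t}"
    using st by (simp add: path_image_subpath)
  have sub: "g ` {s..t} \<subseteq> K"
    using simple_path_inD(3)[OF g] st by (auto simp: path_image_def)
  show "simple_path_in K (g s) (g t) (subpath s t g)"
  proof (cases "x = y \<or> s = t")
    case True
    then have "subpath s t g = (\<lambda>_. g s)" "g s = g t"
      using g by (auto simp: simple_path_in_same subpath_def)
    then show ?thesis using im sub st by (auto simp: simple_path_in_same)
  next
    case False
    then have a: "arc g" "inj_on g {0..1}" using simple_path_in_inj[OF g] by auto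
    then have "g s \<noteq> g t" using False st by (auto dest: inj_onD)
    moreover have "arc (subpath s t g)" using False st a by (intro arc_subpath_arc) auto
    ultimately show ?thesis using im sub by (simp add: simple_path_in_def)
  qed
qed

lemma simple_path_in_reversepath:
  assumes "simple_path_in K x y g"
  shows "simple_path_in K y x (reversepath g)"
proof (cases "x = y")
  case True
  with assms show ?thesis by (auto simp: simple_path_in_same reversepath_def)
next
  case False
  with assms show ?thesis by (simp add: simple_path_in_def arc_reversepath)
qed

lemma simple_path_in_join:
  assumes g: "simple_path_in K x p g" and h: "simple_path_in K p y h"
    and gh: "path_image g \<inter> path_image h \<subseteq> {p}"
  obtains f where "simple_path_in K x y f" "path_image f = path_image g \<union> path_image h"
    "variation f {0..1} = variation g {0..1} + variation h {0..1}"
proof -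
  note gD = simple_path_inD[OF g] and hD = simple_path_inD[OF h]
  consider "x = p" | "y = p" | "x \<noteq> p" "y \<noteq> p" by blast
  then show thesis
  proof cases
    case 1
    then have "g = (\<lambda>_. p)" using g by (simp add: simple_path_in_def)
    then show ?thesis using h 1 hD(5) that[of h] by (auto simp: path_image_def variation_const)
  next
    case 2
    then have "h = (\<lambda>_. p)" using h by (simp add: simple_path_in_def)
    then show ?thesis using g 2 gD(6) that[of g] by (auto simp: path_image_def variation_const)
  next
    case 3
    have "x \<noteq> y" using gh gD(5) hD(6) 3 by auto
    have ag: "arc g" "arc h" using simple_path_in_inj g h 3 by metis+
    have e: "pathfinish g = pathstart h" using gD(2) hD(1) by (simp add: pathfinish_def pathstart_def)
    have "arc (g +++ h)"
      using ag e gh hD(1) by (intro arc_join) (auto simp: pathstart_def)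
    moreover have im: "path_image (g +++ h) = path_image g \<union> path_image h"
      using e by (rule path_image_join)
    ultimately have s: "simple_path_in K x y (g +++ h)"
      using gD hD \<open>x \<noteq> y\<close> by (simp add: simple_path_in_def) (simp add: pathfinish_def pathstart_def)
    have "variation (g +++ h) {0..1} = variation (g +++ h) {0..1/2} + variation (g +++ h) {1/2..1}"
      by (rule variation_split) auto
    also have "variation (g +++ h) {0..1/2} = variation (subpath 0 (1/2) (g +++ h)) {0..1}"
      by (rule variation_subpath[symmetric]) simp
    also have "\<dots> = variation g {0..1}"
      by (rule variation_cong) (auto simp: subpath_def joinpaths_def)
    also have "variation (g +++ h) {1/2..1} = variation (subpath (1/2) 1 (g +++ h)) {0..1}"
      by (rule variation_subpath[symmetric]) simp
    also have "\<dots> = variation h {0..1}"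
    proof (rule variation_cong)
      fix t :: real assume "t \<in> {0..1}"
      then show "subpath (1/2) 1 (g +++ h) t = h t"
        using gD(2) hD(1) by (cases "t = 0") (auto simp: subpath_def joinpaths_def)
    qed
    finally show ?thesis using that[OF s im] by simp
  qed
qed

text \<open>A connected image cannot meet two closed sets that cover it without meeting their
  intersection.\<close>

lemma path_crosses_intersection:
  fixes g :: "real \<Rightarrow> 'a::topological_space"
  assumes g: "continuous_on {s..t} g" and st: "s \<le> t" and sub: "g ` {s..t} \<subseteq> A \<union> B"
    and cl: "closed A" "closed B" and AB: "A \<inter> B \<subseteq> {p}"
    and e: "g s \<in> A \<and> g t \<in> B \<or> g s \<in> B \<and> g t \<in> A"
  obtains u where "u \<in> {s..t}" "g u = p" "p \<in> A \<inter> B"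
proof -
  have "connected (g ` {s..t})" by (intro connected_continuous_image[OF g] connected_Icc)
  moreover have "g s \<in> g ` {s..t}" "g t \<in> g ` {s..t}" using st by auto
  moreover from this e have "A \<inter> g ` {s..t} \<noteq> {}" "B \<inter> g ` {s..t} \<noteq> {}" by blast+
  ultimately have "A \<inter> B \<inter> g ` {s..t} \<noteq> {}"
    using connected_closedD[of "g ` {s..t}" A B] sub cl by metis
  then show ?thesis using AB that by blast
qed

text \<open>An excursion from \<open>A\<close> into \<open>B\<close> enters and returns through the
  single point \<open>p\<close>, which an injective path can visit only once.\<close>

lemma simple_path_in_stays:
  assumes g: "simple_path_in (A \<union> B) x y g" and cl: "closed A" "closed B" and AB: "A \<inter> B \<subseteq> {p}"
    and xy: "x \<in> A" "y \<in> A"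
  shows "path_image g \<subseteq> A"
proof
  note gD = simple_path_inD[OF g]
  fix q assume q: "q \<in> path_image g"
  then obtain t where t: "t \<in> {0..1}" "q = g t" by (auto simp: path_image_def)
  show "q \<in> A"
  proof (rule ccontr)
    assume nA: "q \<notin> A"
    then have B: "q \<in> B" using q gD(3) by auto
    have "x \<noteq> y"
    proof
      assume "x = y"
      then have "path_image g = {x}" using g by (auto simp: simple_path_in_same path_image_def)
      then show False using q nA xy by simp
    qed
    have c: "continuous_on {0..t} g" "continuous_on {t..1} g"
      using gD(4) t(1) by (auto elim: continuous_on_subset)
    have im: "g ` {0..t} \<subseteq> A \<union> B" "g ` {t..1} \<subseteq> A \<union> B"
      using gD(3) t(1) by (auto simp: path_image_def image_subset_iff)
    obtain u where u: "u \<in> {0..t}" "g u = p" "p \<in> A \<inter> B"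
      using path_crosses_intersection[OF c(1) _ im(1) cl AB] xy B t gD(1) by auto
    obtain v where v: "v \<in> {t..1}" "g v = p"
      using path_crosses_intersection[OF c(2) _ im(2) cl AB] xy B t gD(2) by auto
    have "u = v"
      using inj_onD[OF simple_path_in_inj(1)[OF g \<open>x \<noteq> y\<close>], of u v] u v t(1) by auto
    then have "t = u" using u(1) v(1) by simp
    then show False using u(2,3) t(2) nA by simp
  qed
qed

lemma simple_path_in_crosses:
  assumes g: "simple_path_in (A \<union> B) x y g" and cl: "closed A" "closed B" and AB: "A \<inter> B = {p}"
    and xy: "x \<in> A" "y \<in> B"
  obtains t where "t \<in> {0..1}" "g t = p" "g ` {0..t} \<subseteq> A" "g ` {t..1} \<subseteq> B"
proof -
  note gD = simple_path_inD[OF g]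
  obtain t where t: "t \<in> {0..1}" "g t = p"
    using path_crosses_intersection[OF gD(4) _ _ cl, of p] AB gD xy by (auto simp: path_image_def)
  have s1: "simple_path_in (A \<union> B) x p (subpath 0 t g)" "path_image (subpath 0 t g) = g ` {0..t}"
    and s2: "simple_path_in (B \<union> A) p y (subpath t 1 g)" "path_image (subpath t 1 g) = g ` {t..1}"
    using simple_path_in_subpath[OF g, of 0 t] simple_path_in_subpath[OF g, of t 1] t gD(1,2)
    by (auto simp: Un_commute)
  have "g ` {0..t} \<subseteq> A"
    using simple_path_in_stays[OF s1(1) cl, of p] AB xy s1(2) by auto
  moreover have "g ` {t..1} \<subseteq> B"
    using simple_path_in_stays[OF s2(1) cl(2,1), of p] AB xy s2(2) by auto
  ultimately show ?thesis using that t by blast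
qed

section \<open>Segments and lengths in uniquely arcwise connected sets\<close>

locale uniquely_arcwise_connected =
  fixes K :: "complex set"
  assumes ex_simple_path: "x \<in> K \<Longrightarrow> y \<in> K \<Longrightarrow> \<exists>g. simple_path_in K x y g"
    and unique_path_image: "simple_path_in K x y g \<Longrightarrow> simple_path_in K x y h \<Longrightarrow> path_image g = path_image h"
begin

definition geod :: "complex \<Rightarrow> complex \<Rightarrow> real \<Rightarrow> complex" where
  "geod x y = (SOME g. simple_path_in K x y g)"

definition seg :: "complex \<Rightarrow> complex \<Rightarrow> complex set" where
  "seg x y = path_image (geod x y)"

definition len :: "complex \<Rightarrow> complex \<Rightarrow> ennreal" where
  "len x y = variation (geod x y) {0..1}"

lemma geod: "x \<in> K \<Longrightarrow> y \<in> K \<Longrightarrow> simple_path_in K x y (geod x y)"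
  unfolding geod_def using someI_ex[OF ex_simple_path] .

lemma simple_path_seg:
  assumes "simple_path_in K x y g"
  shows "path_image g = seg x y" "variation g {0..1} = len x y"
proof -
  have K: "x \<in> K" "y \<in> K" using simple_path_inD[OF assms] by auto
  note G = geod[OF K]
  show im: "path_image g = seg x y" unfolding seg_def using unique_path_image[OF assms G] .
  show "variation g {0..1} = len x y"
  proof (cases "x = y")
    case True
    then show ?thesis using assms G by (simp add: len_def simple_path_in_def)
  next
    case False
    then show ?thesis
      using assms G im unfolding len_def seg_def
      by (intro variation_arc_cong) (auto simp: simple_path_in_def)
  qed
qed

lemma seg_subset: "x \<in> K \<Longrightarrow> y \<in> K \<Longrightarrow> seg x y \<subseteq> K"
  unfolding seg_def by (rule simple_path_inD(3)[OF geod])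

lemma seg_ends: "x \<in> K \<Longrightarrow> y \<in> K \<Longrightarrow> x \<in> seg x y" "x \<in> K \<Longrightarrow> y \<in> K \<Longrightarrow> y \<in> seg x y"
  unfolding seg_def by (rule simple_path_inD(5)[OF geod], assumption+) (rule simple_path_inD(6)[OF geod])

lemma seg_commute: "x \<in> K \<Longrightarrow> y \<in> K \<Longrightarrow> seg x y = seg y x"
  using simple_path_seg(1)[OF simple_path_in_reversepath[OF geod, of y x]] by (simp add: seg_def)

lemma len_commute: "x \<in> K \<Longrightarrow> y \<in> K \<Longrightarrow> len x y = len y x"
  using simple_path_seg(2)[OF simple_path_in_reversepath[OF geod, of y x]]
  by (simp add: len_def variation_reversepath)

lemma len_refl: "x \<in> K \<Longrightarrow> len x x = 0" and seg_refl: "x \<in> K \<Longrightarrow> seg x x = {x}"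
  using geod[of x x] unfolding simple_path_in_same len_def seg_def
  by (simp_all add: variation_const path_image_def)

lemma dist_le_len: "x \<in> K \<Longrightarrow> y \<in> K \<Longrightarrow> ennreal (dist x y) \<le> len x y"
  unfolding len_def using dist_le_variation[of 0 "{0..1}" 1 "geod x y"] simple_path_inD(1,2)[OF geod, of x y] by simp

lemma simple_path_seg_sub:
  assumes g: "simple_path_in K x y g" and st: "0 \<le> s" "s \<le> t" "t \<le> 1"
  shows "seg (g s) (g t) = g ` {s..t}" "len (g s) (g t) = variation g {s..t}"
  using simple_path_seg[OF simple_path_in_subpath(1)[OF g st]] simple_path_in_subpath(2)[OF g st]
    variation_subpath[OF st(2), of g] by simp_all

lemma seg_split:
  assumes K: "x \<in> K" "y \<in> K" and p: "p \<in> seg x y"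
  shows "seg x y = seg x p \<union> seg p y" "seg x p \<inter> seg p y = {p}" "len x y = len x p + len p y"
proof -
  note g = geod[OF K]
  note gD = simple_path_inD[OF g]
  obtain t where t: "t \<in> {0..1}" "geod x y t = p" using p by (auto simp: seg_def path_image_def)
  have s: "seg x p = geod x y ` {0..t}" "seg p y = geod x y ` {t..1}"
    "len x p = variation (geod x y) {0..t}" "len p y = variation (geod x y) {t..1}"
    using simple_path_seg_sub[OF g, of 0 t] simple_path_seg_sub[OF g, of t 1] t gD(1,2) by auto
  have "{0..t} \<union> {t..1} = {0..1}" using t(1) by auto
  then show "seg x y = seg x p \<union> seg p y"
    unfolding s by (simp add: seg_def path_image_def image_Un[symmetric])
  show "len x y = len x p + len p y"
    unfolding s using variation_split[of 0 t 1] t(1) by (simp add: len_def)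
  show "seg x p \<inter> seg p y = {p}"
  proof (cases "x = y")
    case True
    then have "p = x" using p seg_refl K by auto
    then show ?thesis using True seg_refl K by auto
  next
    case False
    then have "inj_on (geod x y) {0..1}" using simple_path_in_inj[OF g] by auto
    then have "geod x y ` {0..t} \<inter> geod x y ` {t..1} = geod x y ` ({0..t} \<inter> {t..1})"
      using t(1) by (intro inj_on_image_Int[symmetric, of _ "{0..1}"]) auto
    also have "{0..t} \<inter> {t..1} = {t}" using t(1) by auto
    finally show ?thesis unfolding s using t(2) by simp
  qed
qed

text \<open>Two arcs that meet only at \<open>p\<close> concatenate to an arc, which by uniqueness
  is the segment.\<close>

lemma seg_join:
  assumes K: "x \<in> K" "y \<in> K" "p \<in> K" and "seg x p \<inter> seg p y \<subseteq> {p}"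
  shows "p \<in> seg x y"
proof -
  obtain f where f: "simple_path_in K x y f" "path_image f = seg x p \<union> seg p y"
    using simple_path_in_join[OF geod[of x p] geod[of p y]] assms unfolding seg_def by metis
  then show ?thesis using simple_path_seg(1)[OF f(1)] seg_ends K by blast
qed

lemma seg_glue:
  assumes "K = A \<union> B" "closed A" "closed B" "A \<inter> B = {p}" "x \<in> A" "y \<in> B"
  shows "p \<in> seg x y"
proof -
  have K: "x \<in> K" "y \<in> K" using assms by auto
  obtain t where "t \<in> {0..1}" "geod x y t = p"
    using simple_path_in_crosses[of A B x y "geod x y" p] geod[OF K] assms by auto
  then show ?thesis by (auto simp: seg_def path_image_def)
qed

text \<open>The point \<open>w\<close> is the branch point of the tripod spanned by \<open>x\<close>, \<open>y\<close> and \<open>z\<close>.\<close>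

lemma last_common_point:
  assumes K: "x \<in> K" "y \<in> K" "z \<in> K"
  defines "w \<equiv> geod z y (Sup {t \<in> {0..1}. geod z y t \<in> path_image (geod z x)})"
  shows "w \<in> seg z x" "w \<in> seg z y" "w \<in> seg x y"
proof -
  define T where "T = {t \<in> {0..1}. geod z y t \<in> path_image (geod z x)}"
  note g = simple_path_inD[OF geod[OF K(3,2)]]
  have w: "w = geod z y (Sup T)" by (simp add: w_def T_def)
  have "path (geod z x)"
    using simple_path_inD(4)[OF geod[OF K(3,1)]] by (simp add: path_def)
  then have "closed (path_image (geod z x))"
    by (intro compact_imp_closed compact_path_image)
  then have "closed T"
    unfolding T_def using continuous_closed_preimage[OF g(4), of "path_image (geod z x)"] by (simp add: vimage_def Int_def)
  moreover have T: "0 \<in> T" "T \<subseteq> {0..1}"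
    using g(1) seg_ends(1)[OF K(3,1)] by (auto simp: T_def seg_def)
  ultimately have S: "Sup T \<in> T"
    by (intro closed_contains_Sup) (auto intro!: bdd_above_mono[OF bdd_above_Icc])
  then have S01: "Sup T \<in> {0..1}" and zx: "w \<in> seg z x"
    by (auto simp: T_def w seg_def)
  show "w \<in> seg z x" by fact
  show "w \<in> seg z y" unfolding w seg_def using g(7) S01 by simp
  have wK: "w \<in> K" using zx seg_subset K by blast
  have wy: "seg w y = geod z y ` {Sup T..1}"
    using simple_path_seg_sub(1)[OF geod[OF K(3,2)], of "Sup T" 1] S01 g(2) by (simp add: w)
  \<comment> \<open>After its last common point with \<open>seg z x\<close> the path to
    \<open>y\<close> stays away from that segment, so the arcs from \<open>x\<close> to
    \<open>w\<close> and from \<open>w\<close> to \<open>y\<close> join to an arc.\<close>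
  have "seg w y \<inter> seg z x \<subseteq> {w}"
  proof
    fix q assume q: "q \<in> seg w y \<inter> seg z x"
    then obtain t where t: "t \<in> {Sup T..1}" "q = geod z y t" by (auto simp: wy)
    then have "t \<in> T" using q S01 by (auto simp: T_def seg_def)
    then have "t \<le> Sup T" using T(2) by (intro cSup_upper) (auto intro!: bdd_above_mono[OF bdd_above_Icc])
    then show "q \<in> {w}" using t by (simp add: w)
  qed
  moreover have "seg x w \<subseteq> seg z x"
    using seg_split(1)[OF K(3,1) zx] seg_commute wK K by auto
  ultimately show "w \<in> seg x y"
    using K wK by (intro seg_join) auto
qed

end

section \<open>Arc length as a tree metric\<close>

locale arc_metric = uniquely_arcwise_connected +
  assumes len_finite: "x \<in> K \<Longrightarrow> y \<in> K \<Longrightarrow> len x y \<noteq> \<infinity>"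
begin

definition d :: "complex \<Rightarrow> complex \<Rightarrow> real" where
  "d x y = enn2real (len x y)"

lemma len_eq: "x \<in> K \<Longrightarrow> y \<in> K \<Longrightarrow> len x y = ennreal (d x y)"
  using len_finite[of x y] unfolding d_def by (simp add: less_top)

lemma path_length_geod: "x \<in> K \<Longrightarrow> y \<in> K \<Longrightarrow> path_length (geod x y) = d x y"
  using len_eq[of x y] by (intro path_length_eq) (auto simp: len_def d_def)

lemma d_nonneg [simp]: "d x y \<ge> 0" and d_refl: "x \<in> K \<Longrightarrow> d x x = 0"
  and d_commute: "x \<in> K \<Longrightarrow> y \<in> K \<Longrightarrow> d x y = d y x"
  by (simp_all add: d_def len_refl len_commute)

lemma dist_le_d: "x \<in> K \<Longrightarrow> y \<in> K \<Longrightarrow> dist x y \<le> d x y"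
  using dist_le_len[of x y] len_eq[of x y] by (simp add: ennreal_le_iff)

lemma d_eq_0: "x \<in> K \<Longrightarrow> y \<in> K \<Longrightarrow> d x y = 0 \<Longrightarrow> x = y"
  using dist_le_d[of x y] by simp

lemma seg_d: "x \<in> K \<Longrightarrow> y \<in> K \<Longrightarrow> p \<in> seg x y \<Longrightarrow> d x y = d x p + d p y"
  using seg_split(3)[of x y p] seg_subset[of x y] len_eq[of x y] len_eq[of x p] len_eq[of p y]
  by (auto simp: subset_iff simp flip: ennreal_plus)

lemma tripod:
  assumes "x \<in> K" "y \<in> K" "z \<in> K"
  obtains w where "w \<in> K" "w \<in> seg z x" "w \<in> seg z y" "w \<in> seg x y"
  using last_common_point[OF assms] seg_subset[OF assms(3,1)] by blast

text \<open>With \<open>w\<close> the branch point of the tripod, \<open>d x p + d p y\<close>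
  exceeds \<open>d x y\<close> by \<open>2 * d p w\<close>. The excess vanishes only for
  \<open>p = w\<close>.\<close>

lemma seg_iff:
  assumes K: "x \<in> K" "y \<in> K" "p \<in> K"
  shows "p \<in> seg x y \<longleftrightarrow> d x y = d x p + d p y"
proof
  assume *: "d x y = d x p + d p y"
  obtain w where w: "w \<in> K" "w \<in> seg p x" "w \<in> seg p y" "w \<in> seg x y"
    using tripod[OF K] .
  then have "d p x = d p w + d w x" "d p y = d p w + d w y" "d x y = d x w + d w y"
    using seg_d K by metis+
  then have "d p w = 0" using * d_nonneg[of p w] d_commute[of x p] d_commute[of x w] K w(1) by linarith
  then show "p \<in> seg x y" using w d_eq_0 K by metis
next
  assume "p \<in> seg x y"
  then show "d x y = d x p + d p y" by (rule seg_d[OF K(1,2)])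
qed

lemma d_triangle:
  assumes K: "x \<in> K" "y \<in> K" "z \<in> K"
  shows "d x y \<le> d x z + d z y"
proof -
  obtain w where w: "w \<in> K" "w \<in> seg z x" "w \<in> seg z y" "w \<in> seg x y"
    using tripod[OF K] .
  then have "d z x = d z w + d w x" "d z y = d z w + d w y" "d x y = d x w + d w y"
    using seg_d K by metis+
  then show ?thesis using d_nonneg[of z w] d_commute[of x z] d_commute[of x w] K w(1) by linarith
qed

lemma seg_order:
  assumes K: "x \<in> K" "y \<in> K" and p: "p \<in> seg x y" "q \<in> seg x y" "d x p \<le> d x q"
  shows "p \<in> seg x q" "d x q = d x p + d p q"
proof -
  have pK: "p \<in> K" "q \<in> K" using p seg_subset K by auto
  have "p \<in> seg x q \<union> seg q y" using seg_split(1)[OF K p(2)] p(1) by simp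
  then show "p \<in> seg x q"
  proof
    assume "p \<in> seg q y"
    then have "d q y = d q p + d p y" using seg_d pK K by blast
    moreover have "d x y = d x p + d p y" "d x y = d x q + d q y" using seg_d p K by blast+
    ultimately have "d q p = 0" using p(3) d_nonneg[of q p] by linarith
    then have "q = p" using d_eq_0 pK by blast
    then show ?thesis using seg_ends K pK by blast
  qed
  then show "d x q = d x p + d p q" using seg_d pK K by blast
qed

lemma seg_inj:
  assumes "x \<in> K" "y \<in> K" "p \<in> seg x y" "q \<in> seg x y" "d x p = d x q"
  shows "p = q"
proof -
  have "p \<in> K" "q \<in> K" using assms seg_subset by blast+
  then show ?thesis using seg_order(2)[OF assms(1-4)] assms(5) by (intro d_eq_0) auto
qed

text \<open>The Gromov product, which in a tree is the length of the common part of the paths from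
  \<open>b\<close> to \<open>x\<close> and from \<open>b\<close> to \<open>y\<close>.\<close>

definition gp :: "complex \<Rightarrow> complex \<Rightarrow> complex \<Rightarrow> real" where
  "gp b x y = (d b x + d b y - d x y) / 2"

lemma gp_commute: "x \<in> K \<Longrightarrow> y \<in> K \<Longrightarrow> gp b x y = gp b y x"
  by (simp add: gp_def d_commute)

lemma gp_tripod:
  assumes "b \<in> K" "x \<in> K" "y \<in> K" "w \<in> seg b x" "w \<in> seg b y" "w \<in> seg x y"
  shows "gp b x y = d b w"
proof -
  have "w \<in> K" using assms seg_subset by blast
  then show ?thesis
    using seg_d[OF assms(1,2,4)] seg_d[OF assms(1,3,5)] seg_d[OF assms(2,3,6)] d_commute[of w x] assms
    by (simp add: gp_def)
qed

lemma gp_nonneg: "b \<in> K \<Longrightarrow> x \<in> K \<Longrightarrow> y \<in> K \<Longrightarrow> 0 \<le> gp b x y"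
  using d_triangle[of x y b] d_commute[of x b] by (simp add: gp_def)

lemma gp_le: "b \<in> K \<Longrightarrow> x \<in> K \<Longrightarrow> y \<in> K \<Longrightarrow> gp b x y \<le> d b x"
  using d_triangle[of b y x] by (simp add: gp_def)

lemma gp_ge:
  assumes K: "b \<in> K" "x \<in> K" "y \<in> K" and p: "p \<in> seg b x" "p \<in> seg b y"
  shows "d b p \<le> gp b x y"
proof -
  have "p \<in> K" using K p seg_subset by blast
  then show ?thesis
    using seg_d[OF K(1,2) p(1)] seg_d[OF K(1,3) p(2)] d_triangle[OF K(2,3), of p] d_commute[of x p] K
    by (simp add: gp_def)
qed

lemma seg_trans: "x \<in> K \<Longrightarrow> y \<in> K \<Longrightarrow> q \<in> seg x y \<Longrightarrow> p \<in> seg x q \<Longrightarrow> p \<in> seg x y"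
  using seg_split(1)[of x y q] by blast

text \<open>The branch points of \<open>x\<close> with \<open>z\<close> and of \<open>y\<close> with
  \<open>z\<close> both lie on the path from \<open>b\<close> to \<open>z\<close>. The one nearer to
  \<open>b\<close> precedes the other, and hence lies on the paths to both \<open>x\<close> and
  \<open>y\<close>.\<close>

lemma gp_ultrametric:
  assumes K: "b \<in> K" "x \<in> K" "y \<in> K" "z \<in> K"
  shows "min (gp b x z) (gp b z y) \<le> gp b x y"
proof -
  have *: "gp b x z \<le> gp b x y"
    if K: "x \<in> K" "y \<in> K" and le: "gp b x z \<le> gp b z y" for x y
  proof -
    obtain v where v: "v \<in> K" "v \<in> seg b x" "v \<in> seg b z" "v \<in> seg x z"
      using tripod[OF K(1) \<open>z \<in> K\<close> \<open>b \<in> K\<close>] .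
    obtain w where w: "w \<in> K" "w \<in> seg b z" "w \<in> seg b y" "w \<in> seg z y"
      using tripod[OF \<open>z \<in> K\<close> K(2) \<open>b \<in> K\<close>] .
    have vw: "gp b x z = d b v" "gp b z y = d b w"
      using gp_tripod[OF \<open>b \<in> K\<close> K(1) \<open>z \<in> K\<close> v(2-4)] gp_tripod[OF \<open>b \<in> K\<close> \<open>z \<in> K\<close> K(2) w(2-4)] .
    have "v \<in> seg b w"
      using le unfolding vw by (rule seg_order(1)[OF \<open>b \<in> K\<close> \<open>z \<in> K\<close> v(3) w(2)])
    then have "v \<in> seg b y" using w(3) K \<open>b \<in> K\<close> seg_trans by blast
    from gp_ge[OF \<open>b \<in> K\<close> K v(2) this] show ?thesis unfolding vw .
  qed
  show ?thesis
    using *[OF K(2,3)] *[OF K(3,2)] gp_commute[OF K(2,4), of b] gp_commute[OF K(3,4), of b]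
      gp_commute[OF K(3,2), of b]
    by (cases "gp b x z \<le> gp b z y") auto
qed

end

section \<open>The Vicsek set and its junction points\<close>

definition l1norm :: "complex \<Rightarrow> real" where
  "l1norm z = \<bar>Re z\<bar> + \<bar>Im z\<bar>"

lemma l1norm_triangle: "l1norm (z + w) \<le> l1norm z + l1norm w"
  by (simp add: l1norm_def)

lemma l1norm_scale: "l1norm (of_real c * z) = \<bar>c\<bar> * l1norm z"
  by (simp add: l1norm_def abs_mult algebra_simps)

lemma norm_le_l1norm: "norm z \<le> l1norm z"
  unfolding l1norm_def by (rule cmod_le)

lemma corner_values: "corner 1 = \<i>" "corner (Suc 0) = \<i>" "corner 2 = -1" "corner 3 = -\<i>" "corner 4 = 1"
  by (simp_all add: corner_def eval_nat_numeral)

lemma in_1_4: "j \<in> {1..4} \<longleftrightarrow> j = 1 \<or> j = 2 \<or> j = 3 \<or> j = (4::nat)"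
  by auto

lemma corner_neq_0 [simp]: "corner j \<noteq> 0" and norm_corner [simp]: "norm (corner j) = 1"
  by (simp_all add: corner_def norm_power)

lemma corner_cnj [simp]: "corner j * cnj (corner j) = 1"
  using complex_norm_square[of "corner j"] by simp

lemma l1norm_corner: "j \<in> {1..4} \<Longrightarrow> l1norm (corner j) = 1"
  unfolding in_1_4 by (elim disjE) (simp_all add: corner_values l1norm_def)

lemma l1norm_rotate: "j \<in> {1..4} \<Longrightarrow> l1norm (z * cnj (corner j)) = l1norm z"
  unfolding in_1_4 by (elim disjE) (simp_all add: corner_values l1norm_def)

definition opp :: "nat \<Rightarrow> nat" where
  "opp j = (if j \<le> 2 then j + 2 else j - 2)"

lemma opp: "j \<in> {1..4} \<Longrightarrow> opp j \<in> {1..4}" "j \<in> {1..4} \<Longrightarrow> corner (opp j) = - corner j"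
  unfolding in_1_4 by (elim disjE; simp add: opp_def corner_def eval_nat_numeral)+

lemma corner_inj: "i \<in> {1..4} \<Longrightarrow> j \<in> {1..4} \<Longrightarrow> corner i = corner j \<Longrightarrow> i = j"
  unfolding in_1_4 by (elim disjE) (simp_all add: corner_values complex_eq_iff)

lemma diagonals_eq: "diagonals = {of_real t * corner j | t j. 0 \<le> t \<and> t \<le> 1 \<and> j \<in> {1..4}}"
proof -
  have seg: "closed_segment (corner j) (corner (opp j)) =
      {of_real t * corner j | t. 0 \<le> t \<and> t \<le> 1} \<union> {of_real t * corner (opp j) | t. 0 \<le> t \<and> t \<le> 1}"
    (is "?L = ?A \<union> ?B") if j: "j \<in> {1..4}" for j
  proof
    show "?L \<subseteq> ?A \<union> ?B"
    proof
      fix z assume "z \<in> ?L"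
      then obtain u where u: "0 \<le> u" "u \<le> 1" "z = (1 - u) *\<^sub>R corner j + u *\<^sub>R corner (opp j)"
        by (auto simp: closed_segment_def)
      then have z: "z = of_real (1 - 2 * u) * corner j" "z = of_real (2 * u - 1) * corner (opp j)"
        using j by (simp_all add: opp scaleR_conv_of_real algebra_simps)
      show "z \<in> ?A \<union> ?B"
      proof (cases "2 * u \<le> 1")
        case True
        then have "z \<in> ?A" using u z(1) by (intro CollectI exI[of _ "1 - 2 * u"]) auto
        then show ?thesis by blast
      next
        case False
        then have "z \<in> ?B" using u z(2) by (intro CollectI exI[of _ "2 * u - 1"]) auto
        then show ?thesis by blast
      qed
    qed
    have "of_real t * corner j \<in> ?L" if "0 \<le> t" "t \<le> 1" for t
      unfolding closed_segment_def using that j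
      by (intro CollectI exI[of _ "(1 - t) / 2"]) (auto simp: opp scaleR_conv_of_real field_simps)
    moreover have "of_real t * corner (opp j) \<in> ?L" if "0 \<le> t" "t \<le> 1" for t
      unfolding closed_segment_def using that j
      by (intro CollectI exI[of _ "(1 + t) / 2"]) (auto simp: opp scaleR_conv_of_real field_simps)
    ultimately show "?A \<union> ?B \<subseteq> ?L" by blast
  qed
  have o: "opp 1 = 3" "opp 2 = 4" by (simp_all add: opp_def)
  show ?thesis
    unfolding diagonals_def using seg[of 1] seg[of 2] unfolding o in_1_4 by auto
qed

text \<open>The full square: its corners lie on the coordinate axes, so it is the unit ball of the
  l1 norm.\<close>

definition diamond :: "complex set" where
  "diamond = {z. l1norm z \<le> 1}"

lemma compact_diamond: "compact diamond"
proof -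
  have "closed diamond"
    unfolding diamond_def l1norm_def by (intro closed_Collect_le continuous_intros)
  moreover have "bounded diamond"
    using norm_le_l1norm by (intro boundedI[of _ 1]) (auto simp: diamond_def intro: order_trans)
  ultimately show ?thesis by (simp add: compact_eq_bounded_closed)
qed

locale vicsek_set =
  fixes n :: nat
  assumes n2: "n \<ge> 2"
begin

definition r :: real where
  "r = 1 / (2 * real n - 1)"

abbreviation K :: "complex set" where "K \<equiv> vicsek n"
abbreviation F :: "nat \<Rightarrow> nat \<Rightarrow> complex \<Rightarrow> complex" where "F \<equiv> vicsek_map n"

lemma r: "0 < r" "r \<le> 1 / 3" "(2 * real n - 1) * r = 1"
  using n2 by (auto simp: r_def field_simps)

lemma map_eq: "F k j z = of_real r * (z + of_real (2 * real k) * corner j)"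
  by (simp add: vicsek_map_def r_def algebra_simps)

lemma map_0: "F 0 j z = of_real r * z"
  by (simp add: map_eq)

lemma mapsE:
  assumes "f \<in> vicsek_maps n"
  obtains k j where "k < n" "j \<in> {1..4}" "f = F k j"
  using assms by (auto simp: vicsek_maps_def)

lemma mapsI: "k < n \<Longrightarrow> j \<in> {1..4} \<Longrightarrow> F k j \<in> vicsek_maps n"
  unfolding vicsek_maps_def by blast

lemma finite_maps: "finite (vicsek_maps n)"
proof -
  have "vicsek_maps n \<subseteq> (\<lambda>(k, j). F k j) ` ({..<n} \<times> {1..4})"
    by (auto simp: vicsek_maps_def image_iff)
  then show ?thesis by (rule finite_subset) simp
qed

lemma dist_map: "dist (F k j x) (F k j y) = r * dist x y"
proof -
  have "F k j x - F k j y = of_real r * (x - y)" by (simp add: map_eq algebra_simps)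
  then show ?thesis using r by (simp add: dist_norm norm_mult)
qed

lemma dist_maps: "f \<in> vicsek_maps n \<Longrightarrow> dist (f x) (f y) = r * dist x y"
  by (erule mapsE) (simp only: dist_map)

lemma inj_map: "inj (F k j)"
  using r by (auto simp: inj_on_def map_eq)

lemma continuous_map: "continuous_on S (F k j)"
proof -
  have "F k j = (\<lambda>z. of_real r * (z + of_real (2 * real k) * corner j))" by (rule ext) (rule map_eq)
  then show ?thesis by (simp only:) (intro continuous_intros)
qed

section \<open>The Vicsek set as an attractor\<close>

definition hutchinson :: "complex set \<Rightarrow> complex set" where
  "hutchinson A = (\<Union>f\<in>vicsek_maps n. f ` A)"

text \<open>A point of \<open>A\<close> has an address of any length \<open>m\<close>; applying the
  same \<open>m\<close> maps to a point of \<open>B\<close> gives a point of \<open>B\<close> within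
  \<open>C * r ^ m\<close>. The assumptions are one-sided so that the lemma yields the uniqueness of
  the attractor, its inclusion in the square and the inclusion of the diagonals alike.\<close>

lemma attractor_subset:
  assumes A: "bounded A" "A \<subseteq> hutchinson A" and B: "compact B" "B \<noteq> {}" "hutchinson B \<subseteq> B"
  shows "A \<subseteq> B"
proof
  fix a assume a: "a \<in> A"
  have "bounded (A \<union> B)" using A(1) B(1) compact_imp_bounded by simp
  then obtain C where C: "\<And>x y. x \<in> A \<union> B \<Longrightarrow> y \<in> A \<union> B \<Longrightarrow> dist x y \<le> C"
    by (meson bounded_two_points)
  have *: "\<exists>b\<in>B. dist a b \<le> C * r ^ m" if "a \<in> A" for a m
    using that
  proof (induction m arbitrary: a)
    case 0
    then show ?case using C B(2) by auto
  next
    case (Suc m)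
    then obtain f a' where f: "f \<in> vicsek_maps n" "a' \<in> A" "a = f a'"
      using A(2) by (auto simp: hutchinson_def)
    then obtain b where b: "b \<in> B" "dist a' b \<le> C * r ^ m" using Suc.IH by blast
    have "f b \<in> B" using b f B(3) by (auto simp: hutchinson_def)
    moreover have "dist a (f b) \<le> C * r ^ Suc m"
      using b(2) r dist_maps[OF f(1)] f(3) by (simp add: mult.left_commute)
    ultimately show ?case by blast
  qed
  have lim: "(\<lambda>m. C * r ^ m) \<longlonglongrightarrow> 0"
    using r by (intro tendsto_mult_right_zero LIMSEQ_realpow_zero) auto
  have "\<exists>b\<in>B. dist b a < e" if e: "e > 0" for e
  proof -
    obtain m where "C * r ^ m < e"
      using order_tendstoD(2)[OF lim e] by (auto simp: eventually_sequentially)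
    then show ?thesis using *[OF a, of m] by (auto simp: dist_commute intro: le_less_trans)
  qed
  then have "a \<in> closure B" by (simp add: closure_approachable)
  then show "a \<in> B" using B(1) by (simp add: compact_imp_closed)
qed

lemma zero_in_diamond: "0 \<in> diamond"
  by (simp add: diamond_def l1norm_def)

lemma hutchinson_diamond: "hutchinson diamond \<subseteq> diamond"
proof -
  have "F k j z \<in> diamond" if "k < n" "j \<in> {1..4}" "z \<in> diamond" for k j z
  proof -
    have "l1norm (z + of_real (2 * real k) * corner j) \<le> l1norm z + 2 * real k"
      using l1norm_triangle[of z "of_real (2 * real k) * corner j"] that(2)
      by (simp only: l1norm_scale l1norm_corner)
    also have "\<dots> \<le> 2 * real n - 1" using that by (simp add: diamond_def)
    finally have "l1norm (z + of_real (2 * real k) * corner j) \<le> 2 * real n - 1" .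
    then have "r * l1norm (z + of_real (2 * real k) * corner j) \<le> r * (2 * real n - 1)"
      using r by (intro mult_left_mono) auto
    also have "\<dots> = 1" using r(3) by (simp add: mult.commute)
    finally show ?thesis using r(1) by (simp only: diamond_def map_eq l1norm_scale mem_Collect_eq abs_of_pos)
  qed
  then show ?thesis by (auto simp: hutchinson_def elim!: mapsE)
qed

lemma hutchinson_mono: "A \<subseteq> B \<Longrightarrow> hutchinson A \<subseteq> hutchinson B"
  by (auto simp: hutchinson_def)

lemma compact_hutchinson: "compact A \<Longrightarrow> compact (hutchinson A)"
  unfolding hutchinson_def using finite_maps
  by (intro compact_UN compact_continuous_image) (auto elim!: mapsE intro: continuous_map)

text \<open>The attractor is the intersection of the decreasing iterates of the square. It contains
  0, the fixed point of the central map.\<close>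

lemma attractor_exists: "\<exists>A. compact A \<and> A \<noteq> {} \<and> A = hutchinson A"
proof -
  define D where "D m = (hutchinson ^^ m) diamond" for m
  have D: "D 0 = diamond" "D (Suc m) = hutchinson (D m)" for m by (simp_all add: D_def)
  have dec: "D (Suc m) \<subseteq> D m" for m
  proof (induction m)
    case (Suc m)
    from hutchinson_mono[OF this] show ?case unfolding D .
  qed (simp add: D hutchinson_diamond)
  then have dec': "D m' \<subseteq> D m" if "m \<le> m'" for m m'
    using that by (rule lift_Suc_antimono_le)
  have zero: "0 \<in> D m" for m
  proof (induction m)
    case (Suc m)
    have "F 0 1 0 \<in> hutchinson (D m)" unfolding hutchinson_def using Suc n2 by (intro UN_I[OF mapsI]) auto
    then show ?case by (simp add: D map_0)
  qed (simp add: D zero_in_diamond)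
  have cpt: "compact (D m)" for m
    by (induction m) (auto simp: D compact_diamond compact_hutchinson)
  let ?A = "\<Inter>m. D m"
  have "closed ?A" using cpt compact_imp_closed by (intro closed_INT) blast
  moreover have "?A = D 0 \<inter> ?A" by blast
  ultimately have "compact ?A" using cpt[of 0] compact_Int_closed by metis
  moreover have "?A \<noteq> {}" using zero by blast
  moreover have "?A = hutchinson ?A"
  proof
    show "hutchinson ?A \<subseteq> ?A"
    proof
      fix z assume "z \<in> hutchinson ?A"
      then obtain f w where f: "f \<in> vicsek_maps n" "z = f w" "\<And>m. w \<in> D m"
        by (auto simp: hutchinson_def)
      then have "z \<in> D (Suc m)" for m unfolding D(2) hutchinson_def by blast
      then show "z \<in> ?A" using dec by blast
    qed
    show "?A \<subseteq> hutchinson ?A"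
    proof
      fix z assume z: "z \<in> ?A"
      have "\<forall>m. \<exists>f\<in>vicsek_maps n. z \<in> f ` D m"
        using z D(2) unfolding hutchinson_def by blast
      then obtain f where f: "\<And>m. f m \<in> vicsek_maps n" "\<And>m. z \<in> f m ` D m" by metis
      have "finite (range f)" using f(1) finite_maps by (meson finite_subset image_subsetI)
      \<comment> \<open>One of the finitely many maps serves infinitely many iterates; as it is
        injective, the preimage of \<open>z\<close> is the same point for all of them.\<close>
      then obtain g where g: "infinite {m. f m = g}"
        using pigeonhole_infinite[of UNIV f] by auto
      then have "{m. f m = g} \<noteq> {}" by (intro notI) simp
      then obtain m0 where "f m0 = g" by blast
      then have gm: "g \<in> vicsek_maps n" using f(1) by blast
      then obtain k j where kj: "g = F k j" by (rule mapsE)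
      have ig: "inj g" unfolding kj by (rule inj_map)
      obtain w where w: "z = g w" using f(2)[of m0] \<open>f m0 = g\<close> by blast
      have "w \<in> D m" for m
      proof -
        obtain m' where m': "m' \<ge> m" "f m' = g"
          using g by (auto simp: infinite_nat_iff_unbounded_le)
        then have "g w \<in> g ` D m'" using f(2)[of m'] w by simp
        then have "w \<in> D m'" using ig by (simp add: inj_image_mem_iff)
        then show ?thesis using dec'[OF m'(1)] by blast
      qed
      then show "z \<in> hutchinson ?A" unfolding hutchinson_def using gm w by blast
    qed
  qed
  ultimately show ?thesis by blast
qed

lemma vicsek: "compact K" "K \<noteq> {}" "K = hutchinson K"
proof -
  have "\<exists>!A. compact A \<and> A \<noteq> {} \<and> A = hutchinson A"
  proof (rule ex_ex1I[OF attractor_exists])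
    fix A B
    assume A: "compact A \<and> A \<noteq> {} \<and> A = hutchinson A" and B: "compact B \<and> B \<noteq> {} \<and> B = hutchinson B"
    have "A' \<subseteq> B'"
      if "compact A' \<and> A' \<noteq> {} \<and> A' = hutchinson A'" "compact B' \<and> B' \<noteq> {} \<and> B' = hutchinson B'" for A' B'
    proof (rule attractor_subset)
      show "A' \<subseteq> hutchinson A'" "hutchinson B' \<subseteq> B'" using that by blast+
      show "bounded A'" "compact B'" "B' \<noteq> {}" using that compact_imp_bounded by blast+
    qed
    then show "A = B" using A B by blast
  qed
  from theI'[OF this] show "compact K" "K \<noteq> {}" "K = hutchinson K"
    unfolding vicsek_def hutchinson_def[symmetric] by auto
qed

lemma closed_vicsek: "closed K"
  using vicsek(1) by (rule compact_imp_closed)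

lemma vicsek_subset_diamond: "K \<subseteq> diamond"
  by (rule attractor_subset[OF compact_imp_bounded[OF vicsek(1)] equalityD1[OF vicsek(3)] compact_diamond])
    (use zero_in_diamond hutchinson_diamond in auto)

lemma subset_vicsek: "bounded A \<Longrightarrow> A \<subseteq> hutchinson A \<Longrightarrow> A \<subseteq> K"
  by (rule attractor_subset[OF _ _ vicsek(1,2) equalityD2[OF vicsek(3)]])

lemma map_in_vicsek: "k < n \<Longrightarrow> j \<in> {1..4} \<Longrightarrow> x \<in> K \<Longrightarrow> F k j x \<in> K"
  using mapsI by (intro subsetD[OF equalityD2[OF vicsek(3)]]) (auto simp: hutchinson_def)

lemma vicsekE:
  assumes "x \<in> K"
  obtains k j x' where "k < n" "j \<in> {1..4}" "x' \<in> K" "x = F k j x'"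
proof -
  from subsetD[OF equalityD1[OF vicsek(3)] assms] obtain f x' where "f \<in> vicsek_maps n" "x' \<in> K" "x = f x'"
    unfolding hutchinson_def by blast
  then show ?thesis using that by (metis mapsE)
qed

lemma dist_vicsek: "x \<in> K \<Longrightarrow> y \<in> K \<Longrightarrow> dist x y \<le> 2"
proof -
  have "norm z \<le> 1" if "z \<in> K" for z
    using subsetD[OF vicsek_subset_diamond that] norm_le_l1norm[of z] by (simp add: diamond_def)
  from this[of x] this[of y] show "x \<in> K \<Longrightarrow> y \<in> K \<Longrightarrow> dist x y \<le> 2"
    using norm_triangle_ineq4[of x y] by (simp add: dist_norm)
qed

lemma diagonals_subset: "diagonals \<subseteq> K"
proof (rule subset_vicsek)
  have "norm z \<le> 1" if "z \<in> diagonals" for z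
    using that by (auto simp: diagonals_eq norm_mult)
  then show "bounded diagonals" by (rule boundedI)
  show "diagonals \<subseteq> hutchinson diagonals"
  proof
    fix z assume "z \<in> diagonals"
    then obtain t j where t: "0 \<le> t" "t \<le> 1" "j \<in> {1..4}" "z = of_real t * corner j"
      by (auto simp: diagonals_eq)
    \<comment> \<open>The \<open>k\<close>-th subsquare covers the parameters \<open>t\<close> for
      which (2n - 1) t - 2k lies between -1 and 1. The smallest integer above or equal to
      \<open>x\<close> is such an index; at \<open>t = 0\<close> it is 0, although \<open>x\<close>
      is negative.\<close>
    define x where "x = ((2 * real n - 1) * t - 1) / 2"
    define k where "k = nat \<lceil>x\<rceil>"
    have nt: "0 \<le> (2 * real n - 1) * t" "(2 * real n - 1) * t \<le> (2 * real n - 1) * 1"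
      using t n2 by (auto intro!: mult_left_mono)
    then have x: "- 1 / 2 \<le> x" "x \<le> real n - 1" by (auto simp: x_def)
    then have "0 \<le> \<lceil>x\<rceil>" by linarith
    then have k: "x \<le> real k" "real k < x + 1" unfolding k_def by linarith+
    then have "k < n" using x by linarith
    define s where "s = (2 * real n - 1) * t - 2 * real k"
    have s: "-1 \<le> s" "s \<le> 1" using k unfolding s_def x_def by argo+
    have "of_real s * corner j \<in> diagonals"
    proof (cases "s \<ge> 0")
      case True
      then show ?thesis using s t(3) unfolding diagonals_eq by blast
    next
      case False
      then have "of_real s * corner j = of_real (- s) * corner (opp j)" using t(3) by (simp add: opp)
      then show ?thesis using s False opp(1)[OF t(3)] unfolding diagonals_eq
        by (intro CollectI exI[of _ "- s"] exI[of _ "opp j"]) auto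
    qed
    moreover have "z = F k j (of_real s * corner j)"
    proof -
      have "F k j (of_real s * corner j) = of_real (r * (s + 2 * real k)) * corner j"
        by (simp add: map_eq algebra_simps)
      also have "r * (s + 2 * real k) = t"
        using r(3) by (simp add: s_def) (metis mult.assoc mult.commute mult_1)
      finally show ?thesis using t(4) by simp
    qed
    ultimately show "z \<in> hutchinson diagonals"
      unfolding hutchinson_def using mapsI[OF \<open>k < n\<close> t(3)] by blast
  qed
qed

lemma ray_in_vicsek: "0 \<le> t \<Longrightarrow> t \<le> 1 \<Longrightarrow> j \<in> {1..4} \<Longrightarrow> of_real t * corner j \<in> K"
  using diagonals_subset unfolding diagonals_eq by blast

lemma corner_in_vicsek: "j \<in> {1..4} \<Longrightarrow> corner j \<in> K" and zero_in_vicsek: "0 \<in> K"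
  using ray_in_vicsek[of 1 j] ray_in_vicsek[of 0 1] by auto

text \<open>Removing the point \<open>junction k j\<close>, the common corner of the cells \<open>k - 1\<close> and \<open>k\<close> of the
  \<open>j\<close>-th half diagonal, separates the inner from the outer cells.\<close>

definition junction :: "nat \<Rightarrow> nat \<Rightarrow> complex" where
  "junction k j = of_real ((2 * real k - 1) * r) * corner j"

definition outer_cells :: "nat \<Rightarrow> nat \<Rightarrow> complex set" where
  "outer_cells k j = (\<Union>l\<in>{k..<n}. F l j ` K)"

definition inner_cells :: "nat \<Rightarrow> nat \<Rightarrow> complex set" where
  "inner_cells k j = (\<Union>(l, i) \<in> {(l, i). l < n \<and> i \<in> {1..4} \<and> (l = 0 \<or> i \<noteq> j \<or> l < k)}. F l i ` K)"

lemma outerI: "k \<le> l \<Longrightarrow> l < n \<Longrightarrow> x \<in> K \<Longrightarrow> F l j x \<in> outer_cells k j"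
  unfolding outer_cells_def by auto

lemma innerI: "l < n \<Longrightarrow> i \<in> {1..4} \<Longrightarrow> l = 0 \<or> i \<noteq> j \<or> l < k \<Longrightarrow> x \<in> K \<Longrightarrow> F l i x \<in> inner_cells k j"
  unfolding inner_cells_def by blast

lemma closed_cell: "closed (F k j ` K)"
  using vicsek(1) by (intro compact_imp_closed compact_continuous_image continuous_map)

lemma closed_outer: "closed (outer_cells k j)" and closed_inner: "closed (inner_cells k j)"
proof -
  show "closed (outer_cells k j)" unfolding outer_cells_def by (intro closed_UN) (auto simp: closed_cell)
  have "finite {(l, i). l < n \<and> i \<in> {1..4} \<and> (l = 0 \<or> i \<noteq> j \<or> l < k)}"
    by (rule finite_subset[of _ "{..<n} \<times> {1..4}"]) auto
  then show "closed (inner_cells k j)" unfolding inner_cells_def by (intro closed_UN) (auto simp: closed_cell)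
qed

lemma inner_Un_outer:
  assumes "j \<in> {1..4}" shows "K = inner_cells k j \<union> outer_cells k j"
proof
  show "K \<subseteq> inner_cells k j \<union> outer_cells k j"
  proof
    fix x assume "x \<in> K"
    then obtain l i x' where x: "l < n" "i \<in> {1..4}" "x' \<in> K" "x = F l i x'" by (rule vicsekE)
    then show "x \<in> inner_cells k j \<union> outer_cells k j"
      using innerI[of l i j k x'] outerI[of k l x' j] by (cases "i = j \<and> k \<le> l") auto
  qed
  show "inner_cells k j \<union> outer_cells k j \<subseteq> K"
    using assms by (auto simp: inner_cells_def outer_cells_def intro: map_in_vicsek)
qed

lemma map_corner:
  assumes j: "j \<in> {1..4}"
  shows "F k j (corner j) = junction (Suc k) j" "F k j (corner (opp j)) = junction k j"
  using opp(2)[OF j] by (simp_all add: map_eq junction_def algebra_simps)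

text \<open>After rotating the \<open>j\<close>-th direction to the positive real axis and scaling
  by 1/r, every cell lies in an l1 unit ball centered on one of the axes at an even distance from 0.
  The balls centered at 2l' with l' \<ge> k touch the remaining ones only at 2k - 1.\<close>

lemma inner_Int_outer:
  assumes k: "1 \<le> k" "k < n" and j: "j \<in> {1..4}"
  shows "inner_cells k j \<inter> outer_cells k j = {junction k j}"
proof
  have "junction k j \<in> outer_cells k j"
    unfolding map_corner(2)[OF j, symmetric] using k j opp(1) by (intro outerI corner_in_vicsek) auto
  moreover have "junction k j = F (k - 1) j (corner j)"
    using map_corner(1)[OF j, of "k - 1"] k(1) by simp
  then have "junction k j \<in> inner_cells k j"
    using k j by (auto intro!: innerI corner_in_vicsek)
  ultimately show "{junction k j} \<subseteq> inner_cells k j \<inter> outer_cells k j" by simp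
next
  show "inner_cells k j \<inter> outer_cells k j \<subseteq> {junction k j}"
  proof
    fix z assume z: "z \<in> inner_cells k j \<inter> outer_cells k j"
    from z have "z \<in> inner_cells k j" by blast
    then obtain l i z' where
      li: "l < n" "i \<in> {1..4}" "l = 0 \<or> i \<noteq> j \<or> l < k" "z' \<in> K" "z = F l i z'"
      unfolding inner_cells_def by blast
    from z have "z \<in> outer_cells k j" by blast
    then obtain l' z'' where
      l': "k \<le> l'" "l' < n" "z'' \<in> K" "z = F l' j z''"
      unfolding outer_cells_def by auto
    define w where "w = z / of_real r * cnj (corner j)"
    have zw: "z = of_real r * w * corner j"
      using r corner_cnj[of j] by (simp add: w_def mult.assoc mult.commute[of "cnj (corner j)"])
    have w1: "w = z' * cnj (corner j) + of_real (2 * real l) * (corner i * cnj (corner j))"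
      and w2: "w = z'' * cnj (corner j) + of_real (2 * real l')"
    proof -
      have "z / of_real r = z' + of_real (2 * real l) * corner i"
        "z / of_real r = z'' + of_real (2 * real l') * corner j"
        using r(1) li(5) l'(4) by (simp_all only: map_eq) simp_all
      then have "w = (z' + of_real (2 * real l) * corner i) * cnj (corner j)"
        "w = (z'' + of_real (2 * real l') * corner j) * cnj (corner j)"
        by (simp_all only: w_def)
      then show "w = z' * cnj (corner j) + of_real (2 * real l) * (corner i * cnj (corner j))"
        "w = z'' * cnj (corner j) + of_real (2 * real l')"
        by (simp_all only: ring_distribs mult.assoc corner_cnj mult_1_right)
    qed
    define u v where "u = z' * cnj (corner j)" and "v = z'' * cnj (corner j)"
    have uv: "\<bar>Re u\<bar> + \<bar>Im u\<bar> \<le> 1" "\<bar>Re v\<bar> + \<bar>Im v\<bar> \<le> 1"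
      using l1norm_rotate[OF j] li(4) l'(3) vicsek_subset_diamond
      unfolding u_def v_def diamond_def by (auto simp: l1norm_def)
    \<comment> \<open>The l1 bounds as linear inequalities, so that the position of a common point
      is settled by linear arithmetic.\<close>
    then have uv': "Re u + Im u \<le> 1" "Re u - Im u \<le> 1" "Im u - Re u \<le> 1" "- Re u - Im u \<le> 1"
        "Re v + Im v \<le> 1" "Re v - Im v \<le> 1" "Im v - Re v \<le> 1" "- Re v - Im v \<le> 1"
      by linarith+
    have rv: "Re w = Re v + 2 * real l'" "Im w = Im v" using w2 by (simp_all add: v_def)
    have l'1: "1 \<le> real k" "real k \<le> real l'" "real k + 1 \<le> real l' \<or> l' = k" using l'(1) k(1) by auto
    have "Re w = 2 * real k - 1 \<and> Im w = 0"
    proof (cases "l = 0 \<or> i = j")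
      case True
      then have "w = u + of_real (2 * real l)" using w1 by (auto simp: u_def)
      then have "Re w = Re u + 2 * real l" "Im w = Im u" by simp_all
      moreover have "real l + 1 \<le> real k" using True li(3) k(1) by auto
      ultimately show ?thesis using uv' rv l'1 by (elim disjE) (linarith, simp)
    next
      case False
      then have l: "1 \<le> real l" "i \<noteq> j" by auto
      then have "corner i * cnj (corner j) \<in> {\<i>, -1, -\<i>}"
        using li(2) j unfolding in_1_4 by (elim disjE) (simp_all add: corner_values)
      moreover define c where "c = corner i * cnj (corner j)"
      ultimately have "c \<in> {\<i>, -1, -\<i>}" "w = u + of_real (2 * real l) * c"
        using w1 by (simp_all only: u_def)
      then have "(Re w = Re u \<and> Im w = Im u + 2 * real l) \<or> (Re w = Re u - 2 * real l \<and> Im w = Im u)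
          \<or> (Re w = Re u \<and> Im w = Im u - 2 * real l)" by auto
      \<comment> \<open>Non-central cells on different half diagonals are disjoint, so the
        constraints contradict each other.\<close>
      then show ?thesis using uv' rv l'1 l(1) by (elim disjE conjE) linarith+
    qed
    then have "w = of_real (2 * real k - 1)" by (simp add: complex_eq_iff)
    then show "z \<in> {junction k j}" using zw by (simp add: junction_def mult.commute)
  qed
qed

text \<open>Two distinct cells lie on different sides of a junction: on one half diagonal, the inner
  end of the farther cell; otherwise, the first junction on the half diagonal of a non-central
  one.\<close>

lemma cells_Int:
  assumes f: "f \<in> vicsek_maps n" and g: "g \<in> vicsek_maps n" and fg: "f \<noteq> g"
  shows "\<exists>p. f ` K \<inter> g ` K \<subseteq> {p}"
proof -
  have *: "\<exists>p. F k i ` K \<inter> F l j ` K \<subseteq> {p}"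
    if "k < n" "l < n" "i \<in> {1..4}" "j \<in> {1..4}" "l \<noteq> 0" "i \<noteq> j \<or> k < l" for k i l j
  proof -
    let ?m = "if i = j then l else 1"
    have "F k i ` K \<subseteq> inner_cells ?m j" "F l j ` K \<subseteq> outer_cells ?m j"
      using that by (auto intro!: innerI outerI)
    moreover have "inner_cells ?m j \<inter> outer_cells ?m j = {junction ?m j}"
      using that n2 by (intro inner_Int_outer) auto
    ultimately show ?thesis by blast
  qed
  obtain k i where 1: "k < n" "i \<in> {1..4}" "f = F k i" using f by (rule mapsE)
  obtain l j where 2: "l < n" "j \<in> {1..4}" "g = F l j" using g by (rule mapsE)
  have z: "\<not> (k = 0 \<and> l = 0)" using fg 1(3) 2(3) by (metis map_0 ext)
  show ?thesis
  proof (cases "l \<noteq> 0 \<and> (i \<noteq> j \<or> k < l)")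
    case True
    then show ?thesis using *[of k l i j] 1 2 by auto
  next
    case False
    then have "k \<noteq> 0 \<and> (j \<noteq> i \<or> l < k)" using z fg 1 2 by (auto simp: not_less le_less)
    then show ?thesis using *[of l k j i] 1 2 by (auto simp: Int_commute)
  qed
qed

end

section \<open>The Vicsek set is a dendrite\<close>

lemma simple_path_in_image:
  assumes g: "simple_path_in K x y g" and f: "continuous_on K f" "inj_on f K"
  shows "simple_path_in (f ` K) (f x) (f y) (f \<circ> g)" "path_image (f \<circ> g) = f ` path_image g"
proof -
  note gD = simple_path_inD[OF g]
  show im: "path_image (f \<circ> g) = f ` path_image g" by (simp add: path_image_compose)
  show "simple_path_in (f ` K) (f x) (f y) (f \<circ> g)"
  proof (cases "x = y")
    case True
    then have "x \<in> K" "g = (\<lambda>_. x)" using g by (simp_all add: simple_path_in_same)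
    then show ?thesis using True by (auto simp: simple_path_in_same o_def)
  next
    case False
    then have a: "arc g" "inj_on g {0..1}" using simple_path_in_inj[OF g] by auto
    have fc: "continuous_on (path_image g) f" "inj_on f (path_image g)"
      using f gD(3) continuous_on_subset inj_on_subset by blast+
    have "arc (f \<circ> g)"
      using a fc unfolding arc_def by (auto intro: path_continuous_image comp_inj_on simp: path_image_def)
    moreover have "f x \<noteq> f y" using False f(2) gD(8,9) by (auto dest: inj_onD)
    ultimately show ?thesis
      using gD(1-3) im by (auto simp: simple_path_in_def pathstart_compose pathfinish_compose pathstart_def pathfinish_def)
  qed
qed

text \<open>Uniqueness in \<open>K\<close> reduces to uniqueness in its cells, which is the same
  problem again; only a quantity that shrinks lets the recursion reach a conclusion. The distance is
  one-sided because \<open>g\<close> and \<open>h\<close> can be exchanged.\<close>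

definition arcs_close :: "real \<Rightarrow> complex set \<Rightarrow> bool" where
  "arcs_close e X \<longleftrightarrow> (\<forall>x y g h. simple_path_in X x y g \<longrightarrow> simple_path_in X x y h \<longrightarrow>
     (\<forall>p\<in>path_image g. \<exists>q\<in>path_image h. dist p q \<le> e))"

lemma arcs_closeD:
  "arcs_close e X \<Longrightarrow> simple_path_in X x y g \<Longrightarrow> simple_path_in X x y h \<Longrightarrow> p \<in> path_image g \<Longrightarrow>
    \<exists>q\<in>path_image h. dist p q \<le> e"
  unfolding arcs_close_def by blast

text \<open>With both ends in one part, both arcs stay in it; otherwise both pass through
  \<open>c\<close>, and their pieces before and after \<open>c\<close> are compared
  separately.\<close>

lemma arcs_close_Un:
  assumes cl: "closed A" "closed B" and AB: "A \<inter> B = {c}" and close: "arcs_close e A" "arcs_close e B"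
  shows "arcs_close e (A \<union> B)"
proof -
  have same: "\<exists>q\<in>path_image h. dist p q \<le> e"
    if cl: "closed A" "closed B" "A \<inter> B = {c}" "arcs_close e A" "arcs_close e B"
      and gh: "simple_path_in (A \<union> B) x y g" "simple_path_in (A \<union> B) x y h" and p: "p \<in> path_image g"
      and x: "x \<in> A" for A B x y g h p
  proof (cases "y \<in> A")
    case True
    have "path_image g \<subseteq> A" "path_image h \<subseteq> A"
      using simple_path_in_stays[OF gh(1) cl(1,2)] simple_path_in_stays[OF gh(2) cl(1,2)] cl(3) x True by auto
    then show ?thesis
      using arcs_closeD[OF cl(4)] simple_path_in_subset[OF gh(1)] simple_path_in_subset[OF gh(2)] p by blast
  next
    case False
    then have y: "y \<in> B" using simple_path_inD(9)[OF gh(1)] by blast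
    obtain s where s: "s \<in> {0..1}" "g s = c" "g ` {0..s} \<subseteq> A" "g ` {s..1} \<subseteq> B"
      using simple_path_in_crosses[OF gh(1) cl(1-3) x y] .
    obtain t where t: "t \<in> {0..1}" "h t = c" "h ` {0..t} \<subseteq> A" "h ` {t..1} \<subseteq> B"
      using simple_path_in_crosses[OF gh(2) cl(1-3) x y] .
    note ends = simple_path_inD(1,2)[OF gh(1)] simple_path_inD(1,2)[OF gh(2)]
    have g1: "simple_path_in A x c (subpath 0 s g)" "path_image (subpath 0 s g) = g ` {0..s}"
      and g2: "simple_path_in B c y (subpath s 1 g)" "path_image (subpath s 1 g) = g ` {s..1}"
      using simple_path_in_subpath[OF gh(1), of 0 s] simple_path_in_subpath[OF gh(1), of s 1] s ends
        simple_path_in_subset by auto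
    have h1: "simple_path_in A x c (subpath 0 t h)" "path_image (subpath 0 t h) = h ` {0..t}"
      and h2: "simple_path_in B c y (subpath t 1 h)" "path_image (subpath t 1 h) = h ` {t..1}"
      using simple_path_in_subpath[OF gh(2), of 0 t] simple_path_in_subpath[OF gh(2), of t 1] t ends
        simple_path_in_subset by auto
    have "{0..1} = {0..s} \<union> {s..1}" using s(1) by auto
    then have "p \<in> g ` {0..s} \<or> p \<in> g ` {s..1}" using p by (auto simp: path_image_def)
    moreover have "h ` {0..t} \<subseteq> path_image h" "h ` {t..1} \<subseteq> path_image h"
      using t(1) by (auto simp: path_image_def)
    moreover have "\<exists>q\<in>h ` {0..t}. dist p q \<le> e" if "p \<in> g ` {0..s}"
      using arcs_closeD[OF cl(4) g1(1) h1(1), of p] that unfolding g1(2) h1(2) .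
    moreover have "\<exists>q\<in>h ` {t..1}. dist p q \<le> e" if "p \<in> g ` {s..1}"
      using arcs_closeD[OF cl(5) g2(1) h2(1), of p] that unfolding g2(2) h2(2) .
    ultimately show ?thesis by (meson subsetD)
  qed
  show ?thesis unfolding arcs_close_def
  proof (intro allI impI ballI)
    fix x y g h p
    assume gh: "simple_path_in (A \<union> B) x y g" "simple_path_in (A \<union> B) x y h" and p: "p \<in> path_image g"
    note gh = gh p
    have "x \<in> A \<or> x \<in> B" using simple_path_inD(8)[OF gh(1)] by blast
    then show "\<exists>q\<in>path_image h. dist p q \<le> e"
    proof
      assume "x \<in> A"
      with same[OF cl AB close gh] show ?thesis .
    next
      assume "x \<in> B"
      with same[OF cl(2,1) _ close(2,1) gh[unfolded Un_commute[of A]]] AB show ?thesis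
        by (simp add: Int_commute)
    qed
  qed
qed

context vicsek_set
begin

definition map_inv :: "nat \<Rightarrow> nat \<Rightarrow> complex \<Rightarrow> complex" where
  "map_inv k j z = z / of_real r - of_real (2 * real k) * corner j"

lemma map_inv: "map_inv k j (F k j z) = z"
  using r(1) by (simp add: map_inv_def map_eq)

lemma continuous_map_inv: "continuous_on S (map_inv k j)"
  unfolding map_inv_def using r(1) by (intro continuous_intros) auto

lemma arcs_close_cell:
  assumes "arcs_close e K"
  shows "arcs_close (r * e) (F k j ` K)"
  unfolding arcs_close_def
proof (intro allI impI ballI)
  fix x y g h p
  assume g: "simple_path_in (F k j ` K) x y g" and h: "simple_path_in (F k j ` K) x y h" and p: "p \<in> path_image g"
  have K: "map_inv k j ` F k j ` K = K" by (simp add: image_image map_inv)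
  have "inj_on (map_inv k j) (F k j ` K)" by (rule inj_onI) (auto simp: map_inv)
  note im = simple_path_in_image[OF _ continuous_map_inv this]
  have "map_inv k j p \<in> path_image (map_inv k j \<circ> g)" using p im(2)[OF g] by simp
  then obtain q where q: "q \<in> path_image h" "dist (map_inv k j p) (map_inv k j q) \<le> e"
    using arcs_closeD[OF assms im(1)[OF g, unfolded K] im(1)[OF h, unfolded K]] im(2)[OF h] by auto
  have "p \<in> F k j ` K" "q \<in> F k j ` K" using p q simple_path_inD(3) g h by blast+
  then have "dist p q = r * dist (map_inv k j p) (map_inv k j q)"
    by (auto simp: map_inv dist_map)
  then have "dist p q \<le> r * e" using q(2) r(1) by simp
  then show "\<exists>q\<in>path_image h. dist p q \<le> r * e" using q(1) by blast
qed

lemma map_0_image: "F 0 i ` K = F 0 j ` K"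
  by (simp add: map_0)

text \<open>The order of assembly makes every gluing happen at exactly one junction: each half
  diagonal is built from its outermost cell inwards, and the four are then attached one by one to
  the central cell.\<close>

lemma cells_tree_induct [consumes 0, case_names cell glue]:
  assumes cell: "\<And>k j. k < n \<Longrightarrow> j \<in> {1..4} \<Longrightarrow> P (F k j ` K)"
    and glue: "\<And>A B c. closed A \<Longrightarrow> closed B \<Longrightarrow> A \<inter> B = {c} \<Longrightarrow> P A \<Longrightarrow> P B \<Longrightarrow> P (A \<union> B)"
  shows "P K"
proof -
  have arm: "P (outer_cells k j)" if k: "1 \<le> k" "k < n" and j: "j \<in> {1..4}" for k j
    using k(2,1)
  proof (induction k rule: strict_inc_induct)
    case (base k)
    then have "{k..<n} = {k}" by auto
    then have "outer_cells k j = F k j ` K" by (simp add: outer_cells_def)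
    then show ?case using cell base j by simp
  next
    case (step k)
    have "{k..<n} = insert k {Suc k..<n}" using step.hyps by auto
    then have Un: "outer_cells k j = F k j ` K \<union> outer_cells (Suc k) j" by (simp add: outer_cells_def)
    have "Suc k < n \<or> Suc k = n" using step.hyps by auto
    then show ?case
    proof
      assume k: "Suc k < n"
      have "F k j ` K \<subseteq> inner_cells (Suc k) j" using k j by (auto intro!: innerI)
      moreover have "junction (Suc k) j \<in> F k j ` K"
        using map_corner(1)[OF j, of k] corner_in_vicsek[OF j] by (metis imageI)
      moreover have "inner_cells (Suc k) j \<inter> outer_cells (Suc k) j = {junction (Suc k) j}"
        using k j by (intro inner_Int_outer) auto
      ultimately have "F k j ` K \<inter> outer_cells (Suc k) j = {junction (Suc k) j}" by blast
      then show ?thesis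
        unfolding Un using k j step closed_cell closed_outer by (intro glue[of _ _ "junction (Suc k) j"] cell) auto
    next
      assume "Suc k = n"
      then have "{k..<n} = {k}" by auto
      then have "outer_cells k j = F k j ` K" by (simp add: outer_cells_def)
      then show ?thesis using cell step.hyps j by simp
    qed
  qed
  define Y where "Y J = F 0 1 ` K \<union> (\<Union>i\<in>{1..J}. outer_cells 1 i)" for J
  have "closed (Y J) \<and> P (Y J)" if "J \<le> 4" for J
    using that
  proof (induction J)
    case 0
    then show ?case using cell[of 0 1] n2 closed_cell by (simp add: Y_def)
  next
    case (Suc J)
    let ?j = "Suc J"
    have j: "?j \<in> {1..4}" using Suc.prems by simp
    have Un: "Y ?j = Y J \<union> outer_cells 1 ?j" by (auto simp: Y_def atLeastAtMostSuc_conv)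
    have sub: "Y J \<subseteq> inner_cells 1 ?j"
      using n2 Suc.prems by (auto simp: Y_def outer_cells_def intro!: innerI)
    have "junction 1 ?j = F 0 ?j (corner ?j)" using map_corner(1)[OF j, of 0] by simp
    then have "junction 1 ?j \<in> F 0 ?j ` K" using corner_in_vicsek[OF j] by simp
    then have "junction 1 ?j \<in> Y J" unfolding Y_def map_0_image[of 1 ?j] by blast
    moreover have "inner_cells 1 ?j \<inter> outer_cells 1 ?j = {junction 1 ?j}"
      using n2 j by (intro inner_Int_outer) auto
    ultimately have "Y J \<inter> outer_cells 1 ?j = {junction 1 ?j}" using sub by blast
    then show ?case
      unfolding Un using Suc closed_outer arm[of 1 ?j] n2 j by (auto intro!: glue[of _ _ "junction 1 ?j"])
  qed
  moreover have "Y 4 = K"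
  proof
    show "Y 4 \<subseteq> K" using n2 by (auto simp: Y_def outer_cells_def intro!: map_in_vicsek)
    show "K \<subseteq> Y 4"
    proof
      fix x assume "x \<in> K"
      then obtain k j x' where x: "k < n" "j \<in> {1..4}" "x' \<in> K" "x = F k j x'" by (rule vicsekE)
      show "x \<in> Y 4"
      proof (cases "k = 0")
        case True
        then show ?thesis using x map_0_image[of j 1] unfolding Y_def by blast
      next
        case False
        then show ?thesis using x outerI[of 1 k x' j] unfolding Y_def by auto
      qed
    qed
  qed
  ultimately show ?thesis by (metis order_refl)
qed

lemma arcs_close_vicsek: "arcs_close (2 * r ^ m) K"
proof (induction m)
  case 0
  show ?case unfolding arcs_close_def
  proof (intro allI impI ballI)
    fix x y g h p
    assume "simple_path_in K x y g" "simple_path_in K x y h" "p \<in> path_image g"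
    then have "p \<in> K" "x \<in> K" "x \<in> path_image h" using simple_path_inD(3,5,8) by blast+
    then show "\<exists>q\<in>path_image h. dist p q \<le> 2 * r ^ 0" using dist_vicsek by auto
  qed
next
  case (Suc m)
  show ?case
  proof (induction rule: cells_tree_induct)
    case (cell k j)
    show ?case using arcs_close_cell[OF Suc] by (simp add: mult.left_commute)
  next
    case (glue A B c)
    then show ?case by (intro arcs_close_Un)
  qed
qed

lemma unique_path_image_vicsek:
  assumes g: "simple_path_in K x y g" and h: "simple_path_in K x y h"
  shows "path_image g = path_image h"
proof -
  have "path_image g \<subseteq> path_image h" if g: "simple_path_in K x y g" and h: "simple_path_in K x y h" for g h
  proof
    fix p assume p: "p \<in> path_image g"
    have lim: "(\<lambda>m. 2 * r ^ m) \<longlonglongrightarrow> 0"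
      using r by (intro tendsto_mult_right_zero LIMSEQ_realpow_zero) auto
    have "\<exists>q\<in>path_image h. dist q p < e" if e: "e > 0" for e
    proof -
      obtain m where "2 * r ^ m < e"
        using order_tendstoD(2)[OF lim e] by (auto simp: eventually_sequentially)
      moreover obtain q where "q \<in> path_image h" "dist p q \<le> 2 * r ^ m"
        using arcs_closeD[OF arcs_close_vicsek g h p] by blast
      ultimately show ?thesis by (metis dist_commute le_less_trans)
    qed
    then have "p \<in> closure (path_image h)" by (simp add: closure_approachable)
    moreover have "closed (path_image h)"
      using simple_path_inD(4)[OF h] by (intro compact_imp_closed compact_path_image) (simp add: path_def)
    ultimately show "p \<in> path_image h" by simp
  qed
  then show ?thesis using g h by blast
qed

section \<open>Construction of paths by successive approximation\<close>

definition cell_of :: "complex \<Rightarrow> (nat \<times> nat) \<times> complex" where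
  "cell_of x = (SOME ((k, j), x'). k < n \<and> j \<in> {1..4} \<and> x' \<in> K \<and> x = F k j x')"

lemma cell_of:
  assumes "x \<in> K" "cell_of x = ((k, j), x')"
  shows "k < n" "j \<in> {1..4}" "x' \<in> K" "x = F k j x'"
proof -
  obtain k' j' y where *: "k' < n" "j' \<in> {1..4}" "y \<in> K" "x = F k' j' y" using assms(1) by (rule vicsekE)
  let ?P = "\<lambda>((k, j), x'). k < n \<and> j \<in> {1..4} \<and> x' \<in> K \<and> x = F k j x'"
  have "?P ((k', j'), y)" using * by simp
  then have "?P (cell_of x)" unfolding cell_of_def by (rule someI[of ?P])
  then show "k < n" "j \<in> {1..4}" "x' \<in> K" "x = F k j x'" using assms(2) by auto
qed

text \<open>The path runs from 0 straight along a half diagonal to the center of a cell containing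
  \<open>x\<close>, then recursively inside this cell. Level \<open>m\<close> ends at the center of
  an \<open>m\<close>-cell containing \<open>x\<close>.\<close>

fun path_approx :: "nat \<Rightarrow> complex \<Rightarrow> real \<Rightarrow> complex" where
  "path_approx 0 x = (\<lambda>_. 0)"
| "path_approx (Suc m) x = (case cell_of x of ((k, j), x') \<Rightarrow>
     linepath 0 (F k j 0) +++ (F k j \<circ> path_approx m x'))"

lemma path_approx_0: "path_approx m x 0 = 0"
  by (cases m) (auto simp: joinpaths_def linepath_def split: prod.split)

lemma path_approx:
  assumes "x \<in> K"
  shows "path (path_approx m x)" "path_image (path_approx m x) \<subseteq> K"
    "dist (path_approx m x 1) x \<le> 2 * r ^ m"
  using assms
proof (induction m arbitrary: x)
  case 0
  case 1 show ?case by (simp add: path_const)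
  case 2 show ?case using zero_in_vicsek by (auto simp: path_image_def)
  case 3 then show ?case using dist_vicsek[OF zero_in_vicsek] by simp
next
  case (Suc m)
  have step: "path (path_approx (Suc m) x) \<and> path_image (path_approx (Suc m) x) \<subseteq> K \<and>
      dist (path_approx (Suc m) x 1) x \<le> 2 * r ^ Suc m" if "x \<in> K" for x
  proof -
    obtain k j x' where c: "cell_of x = ((k, j), x')" by (metis prod.exhaust)
    note x = cell_of[OF that c]
    have p: "path (F k j \<circ> path_approx m x')"
      using Suc.IH(1)[OF x(3)] by (intro path_continuous_image continuous_map)
    have e: "pathfinish (linepath 0 (F k j 0)) = pathstart (F k j \<circ> path_approx m x')"
      by (simp add: pathstart_def path_approx_0)
    have "path_image (F k j \<circ> path_approx m x') \<subseteq> K"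
      using Suc.IH(2)[OF x(3)] map_in_vicsek x(1,2) by (auto simp: path_image_compose)
    moreover have "closed_segment 0 (F k j 0) \<subseteq> K"
    proof
      fix z assume "z \<in> closed_segment 0 (F k j 0)"
      then obtain u where u: "0 \<le> u" "u \<le> 1" "z = of_real (u * (r * (2 * real k))) * corner j"
        by (auto simp: closed_segment_def map_eq scaleR_conv_of_real mult.assoc)
      have "r * (2 * real k) \<le> r * (2 * real n - 1)"
        using r(1) x(1) by (intro mult_left_mono) auto
      then have "u * (r * (2 * real k)) \<le> 1 * 1"
        using u r(1) r(3)[unfolded mult.commute[of _ r]] by (intro mult_mono) auto
      then show "z \<in> K" unfolding u(3) using u r(1) x(2) by (intro ray_in_vicsek) auto
    qed
    moreover have "dist (path_approx (Suc m) x 1) x \<le> 2 * r ^ Suc m"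
    proof -
      have "dist (path_approx (Suc m) x 1) x = dist (F k j (path_approx m x' 1)) (F k j x')"
        using c x(4) by (simp add: joinpaths_def)
      then show ?thesis using Suc.IH(3)[OF x(3)] r(1) by (simp add: dist_map mult.left_commute)
    qed
    ultimately show ?thesis
      using p e c by (auto simp: path_image_join simp del: pathfinish_linepath)
  qed
  case 1 show ?case by (rule conjunct1[OF step[OF 1]])
  case 2 show ?case by (rule conjunct1[OF conjunct2[OF step[OF 2]]])
  case 3 show ?case by (rule conjunct2[OF conjunct2[OF step[OF 3]]])
qed

text \<open>Consecutive approximations agree on the first half of the time; on the second half both
  are images, under one contraction, of consecutive approximations of the previous level.\<close>

lemma path_approx_Cauchy:
  assumes "x \<in> K" "t \<in> {0..1}"
  shows "dist (path_approx (Suc m) x t) (path_approx m x t) \<le> 2 * r ^ m"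
  using assms
proof (induction m arbitrary: x t)
  case 0
  have "path_approx 1 x t \<in> K" using path_approx(2)[OF 0(1), of 1] 0(2) by (auto simp: path_image_def)
  then show ?case using dist_vicsek[OF _ zero_in_vicsek] by simp
next
  case (Suc m)
  obtain k j x' where c: "cell_of x = ((k, j), x')" by (metis prod.exhaust)
  note x = cell_of[OF Suc.prems(1) c]
  show ?case
  proof (cases "t \<le> 1/2")
    case True
    then show ?thesis using c r(1) by (simp add: joinpaths_def)
  next
    case False
    then have "dist (path_approx (Suc (Suc m)) x t) (path_approx (Suc m) x t) =
        r * dist (path_approx (Suc m) x' (2 * t - 1)) (path_approx m x' (2 * t - 1))"
      using c by (simp add: joinpaths_def dist_map del: path_approx.simps(2)) (simp add: joinpaths_def dist_map)
    also have "\<dots> \<le> r * (2 * r ^ m)"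
      using Suc.IH[OF x(3)] False Suc.prems(2) r(1) by (intro mult_left_mono) auto
    finally show ?thesis by (simp add: mult.left_commute)
  qed
qed

text \<open>The geometric bound makes the approximations converge uniformly, written as a
  telescoping series. The limit need not be injective, so an arc is extracted from it
  afterwards.\<close>

lemma path_from_zero:
  assumes x: "x \<in> K"
  obtains g where "path g" "path_image g \<subseteq> K" "pathstart g = 0" "pathfinish g = x"
proof -
  define f where "f i t = path_approx (Suc i) x t - path_approx i x t" for i t
  have sum: "(\<Sum>i<m. f i t) = path_approx m x t" for m t
    unfolding f_def by (subst sum_lessThan_telescope) simp
  define g where "g t = (\<Sum>i. f i t)" for t
  have "summable (\<lambda>i. 2 * r ^ i)"
    using r by (intro summable_mult summable_geometric) auto
  then have lim: "uniform_limit {0..1} (\<lambda>m t. path_approx m x t) g sequentially"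
    unfolding g_def sum[symmetric]
    by (rule Weierstrass_m_test[rotated]) (use path_approx_Cauchy[OF x] in \<open>simp only: f_def dist_norm\<close>)
  have ptw: "(\<lambda>m. path_approx m x t) \<longlonglongrightarrow> g t" if "t \<in> {0..1}" for t
    using tendsto_uniform_limitI[OF lim that] .
  show ?thesis
  proof
    show "path g" unfolding path_def
      using path_approx(1)[OF x] by (intro uniform_limit_theorem[OF _ lim]) (auto simp: path_def)
    show "path_image g \<subseteq> K"
    proof
      fix z assume "z \<in> path_image g"
      then obtain t where t: "t \<in> {0..1}" "z = g t" by (auto simp: path_image_def)
      have "path_approx m x t \<in> K" for m using path_approx(2)[OF x, of m] t(1) by (auto simp: path_image_def)
      then show "z \<in> K"
        using Lim_in_closed_set[OF closed_vicsek _ _ ptw[OF t(1)]] t(2) by auto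
    qed
    show "pathstart g = 0"
      using LIMSEQ_unique[OF ptw[of 0]] by (simp add: path_approx_0 pathstart_def LIMSEQ_const_iff)
    have "(\<lambda>m. 2 * r ^ m) \<longlonglongrightarrow> 0"
      using r by (intro tendsto_mult_right_zero LIMSEQ_realpow_zero) auto
    then have "(\<lambda>m. dist (path_approx m x 1) x) \<longlonglongrightarrow> 0"
      by (rule Lim_null_comparison[rotated]) (use path_approx(3)[OF x] in auto)
    then have "(\<lambda>m. path_approx m x 1) \<longlonglongrightarrow> x" by (simp add: tendsto_dist_iff[symmetric])
    then show "pathfinish g = x"
      using LIMSEQ_unique[OF ptw[of 1]] by (simp add: pathfinish_def)
  qed
qed

lemma ex_simple_path_vicsek:
  assumes "x \<in> K" "y \<in> K"
  shows "\<exists>g. simple_path_in K x y g"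
proof (cases "x = y")
  case True
  then show ?thesis using assms by (auto simp: simple_path_in_same)
next
  case False
  obtain g where g: "path g" "path_image g \<subseteq> K" "pathstart g = 0" "pathfinish g = x"
    using path_from_zero[OF assms(1)] .
  obtain h where h: "path h" "path_image h \<subseteq> K" "pathstart h = 0" "pathfinish h = y"
    using path_from_zero[OF assms(2)] .
  let ?p = "reversepath g +++ h"
  have p: "path ?p" "path_image ?p \<subseteq> K" "pathstart ?p = x" "pathfinish ?p = y"
    using g h by (auto simp: path_image_join)
  obtain q where "arc q" "path_image q \<subseteq> path_image ?p" "pathstart q = x" "pathfinish q = y"
    using path_contains_arc[OF p(1,3,4) False] by metis
  then show ?thesis using False p(2) by (auto simp: simple_path_in_def)
qed

sublocale uniquely_arcwise_connected K
  by unfold_locales (rule ex_simple_path_vicsek unique_path_image_vicsek; assumption)+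

lemma geodesic_eq: "geodesic n = geod"
  by (intro ext) (simp add: geodesic_def geod_def)

end

section \<open>Lengths in the Vicsek set are finite\<close>

context uniquely_arcwise_connected
begin

lemma len_triangle:
  assumes K: "x \<in> K" "y \<in> K" "z \<in> K"
  shows "len x y \<le> len x z + len z y"
proof -
  define w where "w = geod z y (Sup {t \<in> {0..1}. geod z y t \<in> path_image (geod z x)})"
  have w: "w \<in> seg z x" "w \<in> seg z y" "w \<in> seg x y"
    unfolding w_def by (rule last_common_point[OF K])+
  then have wK: "w \<in> K" using seg_subset K by blast
  have "len x y = len x w + len w y" using seg_split(3)[OF K(1,2) w(3)] .
  also have "\<dots> \<le> (len z w + len w x) + (len z w + len w y)"
    unfolding len_commute[OF K(1) wK] by (intro add_mono) (simp_all add: add_increasing)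
  also have "\<dots> = len z x + len z y"
    unfolding seg_split(3)[OF K(3,1) w(1)] seg_split(3)[OF K(3,2) w(2)] ..
  also have "\<dots> = len x z + len z y" using len_commute K by simp
  finally show ?thesis .
qed

lemma closed_segment_seg:
  assumes "closed_segment x y \<subseteq> K"
  shows "seg x y = closed_segment x y" "len x y = ennreal (dist x y)"
proof -
  have "simple_path_in K x y (linepath x y)"
  proof (cases "x = y")
    case True
    then have "linepath x y = (\<lambda>_. x)" by (simp add: fun_eq_iff linepath_def)
    then show ?thesis using True assms by (auto simp: simple_path_in_same)
  next
    case False
    then show ?thesis using assms by (simp add: simple_path_in_def arc_linepath)
  qed
  from simple_path_seg[OF this] show "seg x y = closed_segment x y" "len x y = ennreal (dist x y)"
    by (simp_all add: variation_linepath)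
qed

end

context vicsek_set
begin

lemma seg_map:
  assumes kj: "k < n" "j \<in> {1..4}" and K: "x \<in> K" "y \<in> K"
  shows "seg (F k j x) (F k j y) = F k j ` seg x y" "len (F k j x) (F k j y) = ennreal r * len x y"
proof -
  note g = geod[OF K]
  note im = simple_path_in_image[OF g continuous_map inj_on_subset[OF inj_map subset_UNIV], of k j]
  have "F k j ` K \<subseteq> K" using map_in_vicsek kj by blast
  then have "simple_path_in K (F k j x) (F k j y) (F k j \<circ> geod x y)"
    using im(1) by (auto simp: simple_path_in_def)
  note s = simple_path_seg[OF this]
  show "seg (F k j x) (F k j y) = F k j ` seg x y" using s(1) im(2) by (simp add: seg_def)
  have "variation (F k j \<circ> geod x y) {0..1} = ennreal r * variation (geod x y) {0..1}"
    using r(1) by (intro variation_similarity dist_map) simp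
  then show "len (F k j x) (F k j y) = ennreal r * len x y" using s(2) by (simp add: len_def)
qed

lemma junction_in_seg:
  assumes "1 \<le> k" "k < n" "j \<in> {1..4}" "x \<in> inner_cells k j" "y \<in> outer_cells k j"
  shows "junction k j \<in> seg x y"
  using seg_glue[OF inner_Un_outer closed_inner closed_outer inner_Int_outer] assms by blast

lemma ray_segment_subset:
  assumes "0 \<le> s" "s \<le> 1" "0 \<le> t" "t \<le> 1" "j \<in> {1..4}"
  shows "closed_segment (of_real s * corner j) (of_real t * corner j) \<subseteq> K"
proof
  fix z assume "z \<in> closed_segment (of_real s * corner j) (of_real t * corner j)"
  then obtain u where u: "0 \<le> u" "u \<le> 1" "z = of_real ((1 - u) * s + u * t) * corner j"
    by (auto simp: closed_segment_def scaleR_conv_of_real algebra_simps)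
  have "(1 - u) * s + u * t \<le> (1 - u) * 1 + u * 1" using u assms by (intro add_mono mult_left_mono) auto
  then show "z \<in> K" unfolding u(3) using u assms by (intro ray_in_vicsek) auto
qed

lemma len_diagonals_le:
  assumes "x \<in> diagonals" "y \<in> diagonals"
  shows "len x y \<le> 2"
proof -
  have *: "len 0 z \<le> 1" if z: "z \<in> diagonals" for z
  proof -
    obtain t j where t: "0 \<le> t" "t \<le> 1" "j \<in> {1..4}" "z = of_real t * corner j"
      using z by (auto simp: diagonals_eq)
    then have "len 0 z = ennreal (dist 0 z)"
      using ray_segment_subset[of 0 t j] by (intro closed_segment_seg) auto
    also have "\<dots> \<le> 1" using t by (simp add: norm_mult)
    finally show ?thesis .
  qed
  have K: "x \<in> K" "y \<in> K" using assms diagonals_subset by auto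
  have "len x y \<le> len x 0 + len 0 y" using len_triangle[OF K zero_in_vicsek] .
  also have "\<dots> \<le> 1 + 1" using *[of x] *[of y] assms len_commute[OF K(1) zero_in_vicsek]
    by (intro add_mono) auto
  finally show ?thesis by simp
qed

lemma map_corner_in_diagonals:
  assumes "k < n" "j \<in> {1..4}" shows "F k j (corner j) \<in> diagonals" "F k j (corner (opp j)) \<in> diagonals"
proof -
  have *: "junction l j \<in> diagonals" if "l \<le> n" for l
  proof (cases "l = 0")
    case True
    then have "junction l j = of_real r * corner (opp j)" using opp[OF assms(2)] by (simp add: junction_def)
    then show ?thesis using opp(1)[OF assms(2)] r unfolding diagonals_eq
      by (intro CollectI exI[of _ r] exI[of _ "opp j"]) auto
  next
    case False
    have "(2 * real l - 1) * r \<le> (2 * real n - 1) * r" using that r by (intro mult_right_mono) auto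
    then show ?thesis using r False assms(2) unfolding diagonals_eq
      by (intro CollectI exI[of _ "(2 * real l - 1) * r"] exI[of _ j]) (auto simp: junction_def)
  qed
  show "F k j (corner j) \<in> diagonals" "F k j (corner (opp j)) \<in> diagonals"
    unfolding map_corner[OF assms(2)] using assms(1) by (intro *; simp)+
qed

lemma corner_eq_map: "j \<in> {1..4} \<Longrightarrow> corner j = F (n - 1) j (corner j)"
  using n2 r(3) map_corner(1)[of j "n - 1"] by (simp add: junction_def)

lemma corner_outer: "k < n \<Longrightarrow> j \<in> {1..4} \<Longrightarrow> corner j \<in> outer_cells k j"
  by (subst corner_eq_map) (auto intro!: outerI corner_in_vicsek)

lemma corner_inner: "i \<in> {1..4} \<Longrightarrow> i \<noteq> j \<Longrightarrow> corner i \<in> inner_cells k j"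
  using n2 by (subst corner_eq_map) (auto intro!: innerI corner_in_vicsek)

text \<open>The exit is the same for all \<open>x\<close>: from the central cell it is the
  \<open>i\<close>-th corner, from a cell on another half diagonal the inner corner, and from a cell
  on the same half diagonal the outer corner.\<close>

lemma exit_corner:
  assumes kj: "k < n" "j \<in> {1..4}" and i: "i \<in> {1..4}" and x: "x \<in> K"
  obtains i' where "i' \<in> {1..4}" "F k j (corner i') \<in> seg (F k j x) (corner i)" "F k j (corner i') \<in> diagonals"
proof -
  have ci: "corner i = F (n - 1) i (corner i)" using i by (rule corner_eq_map)
  consider "k = 0" | "k \<noteq> 0" "i \<noteq> j" | "k \<noteq> 0" "i = j" "k = n - 1" | "k \<noteq> 0" "i = j" "Suc k < n" using kj by linarith
  then show thesis
  proof cases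
    case 1
    have e: "F 0 i (corner i) = F 0 j (corner i)" by (simp add: map_0)
    have "junction 1 i \<in> seg (F k j x) (corner i)"
      using n2 1 kj i x by (intro junction_in_seg innerI corner_outer) auto
    moreover have "junction 1 i = F 0 i (corner i)" using map_corner(1)[OF i, of 0] by simp
    moreover have "F 0 i (corner i) \<in> diagonals" using map_corner_in_diagonals(1)[of 0 i] n2 i by simp
    ultimately show ?thesis using that[OF i] 1 e by metis
  next
    case 2
    have "junction k j \<in> seg (corner i) (F k j x)"
      using 2 kj i x by (intro junction_in_seg corner_inner outerI) auto
    then have "junction k j \<in> seg (F k j x) (corner i)"
      using seg_commute[of "corner i"] map_in_vicsek kj x corner_in_vicsek i by blast
    then show ?thesis using that[of "opp j"] map_corner(2)[OF kj(2), of k] opp(1) kj map_corner_in_diagonals(2) by metis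
  next
    case 3
    then have "F k j (corner j) = corner i" using ci[symmetric] by simp
    moreover have "corner i \<in> seg (F k j x) (corner i)"
      using seg_ends(2) map_in_vicsek kj x corner_in_vicsek i by blast
    ultimately show ?thesis using that[OF kj(2)] map_corner_in_diagonals(1)[OF kj] by simp
  next
    case 4
    then have "junction (Suc k) j \<in> seg (F k j x) (corner i)"
      using kj i x by (auto intro!: junction_in_seg innerI corner_outer)
    then show ?thesis using that[OF kj(2)] map_corner(1)[OF kj(2), of k] map_corner_in_diagonals(1)[OF kj] by simp
  qed
qed

text \<open>A recursive estimate L \<le> r L + 2 gives no bound while L may be infinite. Cutting the
  path at a point \<open>p\<close> near \<open>x\<close> makes the quantity finite at every level.
  The 2 bounds lengths between points of the diagonals, and 3 reproduces itself because 3 r + 2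
  \<le> 3 for r \<le> 1/3.\<close>

lemma near_point_len_le:
  assumes "x \<in> K" "i \<in> {1..4}"
  shows "\<exists>p\<in>seg x (corner i). seg x p \<subseteq> cball x (2 * r ^ m) \<and> len p (corner i) \<le> 3"
  using assms
proof (induction m arbitrary: x i)
  case 0
  have c: "corner i \<in> K" using 0 corner_in_vicsek by blast
  have "seg x (corner i) \<subseteq> cball x 2"
    using seg_subset[OF 0(1) c] dist_vicsek[OF 0(1)] by auto
  then show ?case using seg_ends(2)[OF 0(1) c] len_refl[OF c] by (intro bexI[of _ "corner i"]) auto
next
  case (Suc m)
  obtain k j x' where x: "k < n" "j \<in> {1..4}" "x' \<in> K" "x = F k j x'" using Suc.prems(1) by (rule vicsekE)
  obtain i' where i': "i' \<in> {1..4}" "F k j (corner i') \<in> seg x (corner i)" "F k j (corner i') \<in> diagonals"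
    using exit_corner[OF x(1,2) Suc.prems(2) x(3)] x(4) by blast
  obtain p where p: "p \<in> seg x' (corner i')" "seg x' p \<subseteq> cball x' (2 * r ^ m)" "len p (corner i') \<le> 3"
    using Suc.IH[OF x(3) i'(1)] by blast
  define e where "e = F k j (corner i')"
  have K: "corner i' \<in> K" "corner i \<in> K" using corner_in_vicsek i' Suc.prems by auto
  have pK: "p \<in> K" using p(1) seg_subset x(3) K(1) by blast
  have FK: "F k j p \<in> K" "e \<in> K" unfolding e_def using map_in_vicsek x pK K by auto
  have xe: "seg x e = F k j ` seg x' (corner i')" unfolding x(4) e_def by (rule seg_map(1)[OF x(1,2,3) K(1)])
  have "F k j p \<in> seg x e" unfolding xe using p(1) by blast
  then have "F k j p \<in> seg x (corner i)"
    using seg_split(1)[OF Suc.prems(1) K(2) i'(2)] e_def by blast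
  moreover have "seg x (F k j p) \<subseteq> cball x (2 * r ^ Suc m)"
  proof -
    have "seg x (F k j p) = F k j ` seg x' p" unfolding x(4) by (rule seg_map(1)[OF x(1,2,3) pK])
    moreover have "dist x (F k j z) \<le> 2 * r ^ Suc m" if "z \<in> seg x' p" for z
    proof -
      have "dist x' z \<le> 2 * r ^ m" using p(2) that by auto
      then show ?thesis unfolding x(4) dist_map using r(1) by (simp add: mult.left_commute)
    qed
    ultimately show ?thesis by auto
  qed
  moreover have "len (F k j p) (corner i) \<le> 3"
  proof -
    have "corner i = F (n - 1) i (corner i)" using Suc.prems(2) by (rule corner_eq_map)
    then have "corner i \<in> diagonals" using map_corner_in_diagonals(1)[of "n - 1" i] Suc.prems(2) n2 by simp
    then have "len e (corner i) \<le> 2" using len_diagonals_le i'(3) e_def by blast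
    moreover have "len (F k j p) e \<le> 1"
    proof -
      have "len (F k j p) e = ennreal r * len p (corner i')" unfolding e_def by (rule seg_map(2)[OF x(1,2) pK K(1)])
      also have "\<dots> \<le> ennreal r * ennreal 3" using p(3) by (intro mult_left_mono) auto
      also have "\<dots> = ennreal (r * 3)" using r(1) by (simp add: ennreal_mult)
      also have "\<dots> \<le> ennreal 1" using r by (intro ennreal_leI) auto
      finally show ?thesis by simp
    qed
    ultimately have "len (F k j p) e + len e (corner i) \<le> 1 + 2" by (intro add_mono)
    then show ?thesis using len_triangle[OF FK(1) K(2) FK(2)] by (simp add: order_trans)
  qed
  ultimately show ?case by blast
qed

text \<open>For a fixed partition, the times before \<open>p\<close> can be moved to
  \<open>p\<close> at a cost that vanishes as \<open>m\<close> grows. What is left is a partition of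
  a piece of length at most 3.\<close>

lemma len_corner_le:
  assumes x: "x \<in> K" and i: "i \<in> {1..4}"
  shows "len x (corner i) \<le> 3"
proof -
  define q where "q = corner i"
  have q: "q \<in> K" using i corner_in_vicsek by (simp add: q_def)
  define g where "g = geod x q"
  have g: "simple_path_in K x q g" unfolding g_def using x q by (rule geod)
  note gD = simple_path_inD[OF g]
  have "variation g {0..1} \<le> ennreal 3"
  proof (rule variation_least)
    fix k and t :: "nat \<Rightarrow> real" assume t: "mono t" "range t \<subseteq> {0..1}"
    have t01: "t i \<in> {0..1}" for i using subsetD[OF t(2) rangeI] .
    have bound: "(\<Sum>i<k. dist (g (t i)) (g (t (Suc i)))) \<le> 3 + real k * (8 * r ^ m)" for m
    proof -
      obtain p where p: "p \<in> seg x q" "seg x p \<subseteq> cball x (2 * r ^ m)" "len p q \<le> 3"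
        using near_point_len_le[OF x i] by (auto simp: q_def)
      obtain \<tau> where \<tau>: "\<tau> \<in> {0..1}" "p = g \<tau>" using p(1) by (auto simp: seg_def g_def path_image_def)
      have xp: "seg x p = g ` {0..\<tau>}" and pq: "len p q = variation g {\<tau>..1}"
        using simple_path_seg_sub[OF g, of 0 \<tau>] simple_path_seg_sub[OF g, of \<tau> 1] \<tau> gD(1,2) by auto
      define t' where "t' i = max (t i) \<tau>" for i
      have close: "dist (g (t i)) (g (t' i)) \<le> 4 * r ^ m" for i
      proof (cases "t i \<le> \<tau>")
        case True
        then have "g (t i) \<in> cball x (2 * r ^ m)" "g (t' i) \<in> cball x (2 * r ^ m)"
          using p(2) t01[of i] \<tau>(1) unfolding xp t'_def by (auto simp: max_def image_subset_iff)
        then show ?thesis using dist_triangle3[of "g (t i)" "g (t' i)" x] by auto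
      next
        case False
        then show ?thesis using r(1) by (simp add: t'_def)
      qed
      \<comment> \<open>Each of the two end points moves by at most the diameter 4 r^m of the ball
        around \<open>x\<close>.\<close>
      have "dist (g (t i)) (g (t (Suc i))) \<le> dist (g (t' i)) (g (t' (Suc i))) + 8 * r ^ m" for i
        using close[of i] close[of "Suc i"] dist_triangle[of "g (t i)" "g (t (Suc i))" "g (t' i)"]
          dist_triangle[of "g (t' i)" "g (t (Suc i))" "g (t' (Suc i))"] dist_commute[of "g (t (Suc i))" "g (t' (Suc i))"]
        by linarith
      then have "(\<Sum>i<k. dist (g (t i)) (g (t (Suc i)))) \<le> (\<Sum>i<k. dist (g (t' i)) (g (t' (Suc i))) + 8 * r ^ m)"
        by (intro sum_mono)
      also have "\<dots> = (\<Sum>i<k. dist (g (t' i)) (g (t' (Suc i)))) + real k * (8 * r ^ m)"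
        by (simp add: sum.distrib)
      also have "(\<Sum>i<k. dist (g (t' i)) (g (t' (Suc i)))) \<le> 3"
      proof -
        have "mono t'" unfolding t'_def using t(1) by (intro monoI max.mono) (auto dest: monoD)
        moreover have "range t' \<subseteq> {\<tau>..1}" using t01 \<tau>(1) by (auto simp: t'_def)
        ultimately have "ennreal (\<Sum>i<k. dist (g (t' i)) (g (t' (Suc i)))) \<le> ennreal 3"
          using variation_upper[of t' "{\<tau>..1}" g k] p(3) unfolding pq by (simp add: order_trans)
        then show ?thesis by (subst (asm) ennreal_le_iff) auto
      qed
      finally show ?thesis by simp
    qed
    have "(\<lambda>m. 3 + real k * (8 * r ^ m)) \<longlonglongrightarrow> 3 + real k * (8 * 0)"
      using r by (intro tendsto_intros LIMSEQ_realpow_zero) auto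
    then have "(\<Sum>i<k. dist (g (t i)) (g (t (Suc i)))) \<le> 3"
      using bound by (intro LIMSEQ_le_const[where X = "\<lambda>m. 3 + real k * (8 * r ^ m)"]) auto
    then show "ennreal (\<Sum>i<k. dist (g (t i)) (g (t (Suc i)))) \<le> ennreal 3" by (rule ennreal_leI)
  qed
  then show ?thesis unfolding len_def g_def q_def by simp
qed

lemma len_le: "x \<in> K \<Longrightarrow> y \<in> K \<Longrightarrow> len x y \<le> 6"
  using len_triangle[of x y "corner 1"] add_mono[OF len_corner_le[of x 1] len_corner_le[of y 1]]
    len_commute[of y "corner 1"] corner_in_vicsek[of 1] by (simp add: order_trans)

sublocale arc_metric K
proof
  fix x y assume "x \<in> K" "y \<in> K"
  then show "len x y \<noteq> \<infinity>" using len_le[of x y] by (auto simp: top_unique)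
qed

lemma vdist_eq: "x \<in> K \<Longrightarrow> y \<in> K \<Longrightarrow> vdist n x y = d x y"
  by (simp add: vdist_def geodesic_eq path_length_geod)

lemma d_le: "x \<in> K \<Longrightarrow> y \<in> K \<Longrightarrow> d x y \<le> 6"
  using len_le[of x y] len_eq[of x y] by (simp add: ennreal_le_iff2 flip: ennreal_numeral)

lemma d_map:
  assumes "k < n" "j \<in> {1..4}" "x \<in> K" "y \<in> K"
  shows "d (F k j x) (F k j y) = r * d x y"
  unfolding d_def seg_map(2)[OF assms] using r(1) by (simp add: enn2real_mult)

lemma d_ray:
  assumes "0 \<le> s" "s \<le> 1" "0 \<le> t" "t \<le> 1" "j \<in> {1..4}"
  shows "d (of_real s * corner j) (of_real t * corner j) = \<bar>s - t\<bar>"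
    "seg (of_real s * corner j) (of_real t * corner j) = closed_segment (of_real s * corner j) (of_real t * corner j)"
proof -
  have "of_real s * corner j - of_real t * corner j = of_real (s - t) * corner j" by (simp add: algebra_simps)
  then have "dist (of_real s * corner j) (of_real t * corner j) = \<bar>s - t\<bar>"
    by (simp only: dist_norm norm_mult norm_corner norm_of_real) simp
  then show "d (of_real s * corner j) (of_real t * corner j) = \<bar>s - t\<bar>"
    unfolding d_def closed_segment_seg(2)[OF ray_segment_subset[OF assms]] by simp
  show "seg (of_real s * corner j) (of_real t * corner j) = closed_segment (of_real s * corner j) (of_real t * corner j)"
    by (rule closed_segment_seg(1)[OF ray_segment_subset[OF assms]])
qed

lemma d_cut:
  assumes "1 \<le> k" "k < n" "j \<in> {1..4}" "x \<in> inner_cells k j" "y \<in> outer_cells k j"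
  shows "d x y = d x (junction k j) + d (junction k j) y"
  using seg_d[OF _ _ junction_in_seg[OF assms]] inner_Un_outer[OF assms(3)] assms(4,5) by blast

section \<open>Projection to the diagonals and the Green kernel\<close>

definition common :: "complex \<Rightarrow> complex \<Rightarrow> real" where
  "common = gp 0"

text \<open>The length that the path from 0 to \<open>x\<close> shares with the \<open>i\<close>-th
  half diagonal. It is positive for exactly one \<open>i\<close> unless \<open>x\<close> is 0, so
  the four functions locate the arm and the projection at once.\<close>

definition proj_coord :: "nat \<Rightarrow> complex \<Rightarrow> real" where
  "proj_coord i x = common (corner i) x"

definition foot :: "nat \<Rightarrow> complex \<Rightarrow> complex" where
  "foot i x = of_real (proj_coord i x) * corner i"

lemma d_0_ray: "0 \<le> t \<Longrightarrow> t \<le> 1 \<Longrightarrow> j \<in> {1..4} \<Longrightarrow> d 0 (of_real t * corner j) = t"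
  using d_ray(1)[of 0 t j] by simp

lemma d_0_corner: "j \<in> {1..4} \<Longrightarrow> d 0 (corner j) = 1"
  using d_0_ray[of 1 j] by simp

lemma ray_in_seg:
  assumes "0 \<le> s" "s \<le> t" "t \<le> u" "u \<le> 1" "j \<in> {1..4}"
  shows "of_real t * corner j \<in> seg (of_real s * corner j) (of_real u * corner j)"
  using assms by (subst seg_iff) (auto intro!: ray_in_vicsek simp: d_ray)

context
  fixes i :: nat and x :: complex
  assumes i: "i \<in> {1..4}" and x: "x \<in> K"
begin

lemma proj_coord_bounds: "0 \<le> proj_coord i x" "proj_coord i x \<le> 1"
  using gp_nonneg[OF zero_in_vicsek corner_in_vicsek[OF i] x] gp_le[OF zero_in_vicsek corner_in_vicsek[OF i] x]
    d_0_corner[OF i] by (simp_all add: proj_coord_def common_def)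

lemma foot_in_vicsek: "foot i x \<in> K"
  unfolding foot_def using proj_coord_bounds i by (intro ray_in_vicsek)

text \<open>The branch point of 0, \<open>corner i\<close> and \<open>x\<close> lies on the half
  diagonal at distance \<open>proj_coord i x\<close> from 0, which determines it.\<close>

lemma foot_in_seg: "foot i x \<in> seg 0 x" "foot i x \<in> seg (corner i) x"
proof -
  obtain w where w: "w \<in> K" "w \<in> seg 0 (corner i)" "w \<in> seg 0 x" "w \<in> seg (corner i) x"
    using tripod[OF corner_in_vicsek[OF i] x zero_in_vicsek] .
  have dw: "d 0 w = proj_coord i x"
    unfolding proj_coord_def common_def
    using gp_tripod[OF zero_in_vicsek corner_in_vicsek[OF i] x w(2-4)] by simp
  have f: "foot i x \<in> seg 0 (corner i)"
    using ray_in_seg[of 0 "proj_coord i x" 1 i] proj_coord_bounds i by (simp add: foot_def)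
  have "d 0 (foot i x) = d 0 w"
    using d_0_ray[OF proj_coord_bounds i] dw by (simp add: foot_def)
  then have "foot i x = w" using seg_inj[OF zero_in_vicsek corner_in_vicsek[OF i] f w(2)] by simp
  then show "foot i x \<in> seg 0 x" "foot i x \<in> seg (corner i) x" using w by auto
qed

lemma d_0_foot: "d 0 x = proj_coord i x + d (foot i x) x"
  using seg_d[OF zero_in_vicsek x foot_in_seg(1)] d_0_ray[OF proj_coord_bounds i] by (simp add: foot_def)

text \<open>A point of the half diagonal before the foot lies on the path from 0 to
  \<open>x\<close>, one behind it on the path from \<open>corner i\<close> to
  \<open>x\<close>.\<close>

lemma d_ray_foot:
  assumes t: "0 \<le> t" "t \<le> 1"
  shows "d (of_real t * corner i) x = \<bar>t - proj_coord i x\<bar> + d (foot i x) x"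
proof (cases "t \<le> proj_coord i x")
  case True
  have "of_real t * corner i \<in> seg 0 (foot i x)"
    using ray_in_seg[of 0 t "proj_coord i x" i] True t proj_coord_bounds i by (simp add: foot_def)
  then have "of_real t * corner i \<in> seg 0 x" using seg_trans[OF zero_in_vicsek x foot_in_seg(1)] by blast
  then have "d 0 x = d 0 (of_real t * corner i) + d (of_real t * corner i) x"
    by (rule seg_d[OF zero_in_vicsek x])
  then show ?thesis using d_0_ray[OF t i] d_0_foot True by simp
next
  case False
  have "of_real t * corner i \<in> seg (foot i x) (corner i)"
    using ray_in_seg[of "proj_coord i x" t 1 i] False t proj_coord_bounds i by (simp add: foot_def)
  then have "of_real t * corner i \<in> seg (corner i) (foot i x)"
    using seg_commute[OF foot_in_vicsek corner_in_vicsek[OF i]] by simp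
  then have "of_real t * corner i \<in> seg (corner i) x"
    using seg_trans[OF corner_in_vicsek[OF i] x foot_in_seg(2)] by blast
  then have "d (corner i) x = d (corner i) (of_real t * corner i) + d (of_real t * corner i) x"
    by (rule seg_d[OF corner_in_vicsek[OF i] x])
  moreover have "d (corner i) x = d (corner i) (foot i x) + d (foot i x) x"
    by (rule seg_d[OF corner_in_vicsek[OF i] x foot_in_seg(2)])
  moreover have "d (corner i) (of_real t * corner i) = 1 - t"
    "d (corner i) (foot i x) = 1 - proj_coord i x"
    using d_ray(1)[of 1 t i] d_ray(1)[of 1 "proj_coord i x" i] t i proj_coord_bounds by (auto simp: foot_def)
  ultimately show ?thesis using False by simp
qed

lemma ray_in_seg_0: "0 \<le> t \<Longrightarrow> t \<le> proj_coord i x \<Longrightarrow> of_real t * corner i \<in> seg 0 x"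
  using ray_in_seg[of 0 t "proj_coord i x" i] proj_coord_bounds i
    seg_trans[OF zero_in_vicsek x foot_in_seg(1)] by (simp add: foot_def)

end

text \<open>The path from 0 to \<open>x\<close> has only one point at a given distance from 0; for a
  small distance it would lie on both half diagonals.\<close>

lemma proj_coord_unique:
  assumes ij: "i \<in> {1..4}" "j \<in> {1..4}" and x: "x \<in> K" and pos: "proj_coord i x > 0" "proj_coord j x > 0"
  shows "i = j"
proof -
  define t where "t = min (proj_coord i x) (proj_coord j x)"
  have t: "0 < t" "t \<le> proj_coord i x" "t \<le> proj_coord j x" "t \<le> 1"
    using pos proj_coord_bounds(2)[OF ij(1) x] by (auto simp: t_def)
  have "of_real t * corner i = of_real t * corner j"
    using t ij by (intro seg_inj[OF zero_in_vicsek x] ray_in_seg_0 x) (auto simp: d_0_ray)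
  then have "corner i = corner j" using t(1) by simp
  then show ?thesis using corner_inj ij by blast
qed

lemma proj_coord_ge:
  assumes "i \<in> {1..4}" "x \<in> K" "0 \<le> t" "t \<le> 1" "of_real t * corner i \<in> seg 0 x"
  shows "t \<le> proj_coord i x"
proof -
  have "of_real t * corner i \<in> seg 0 (corner i)"
    using ray_in_seg[of 0 t 1 i] assms by simp
  then show ?thesis
    using gp_ge[OF zero_in_vicsek corner_in_vicsek[OF assms(1)] assms(2) _ assms(5)] d_0_ray[OF assms(3,4,1)]
    by (simp add: proj_coord_def common_def)
qed

text \<open>Inverting the central map repeatedly moves \<open>x\<close> away from 0 until it lies in
  a non-central cell. Then the path from 0 to it runs through the first junction of that half
  diagonal, at distance \<open>r\<close> from 0.\<close>

lemma proj_coord_pos: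
  assumes "x \<in> K" "x \<noteq> 0"
  shows "\<exists>i\<in>{1..4}. proj_coord i x > 0"
proof -
  have "\<exists>i\<in>{1..4}. proj_coord i x > 0" if "x \<in> K" "norm x > r ^ m" for m
    using that
  proof (induction m arbitrary: x)
    case 0
    then show ?case using subsetD[OF vicsek_subset_diamond, of x] norm_le_l1norm[of x] by (simp add: diamond_def)
  next
    case (Suc m)
    obtain k j x' where x: "k < n" "j \<in> {1..4}" "x' \<in> K" "x = F k j x'" using Suc.prems(1) by (rule vicsekE)
    have z: "0 = F 0 j 0" by (simp add: map_0)
    show ?case
    proof (cases "k = 0")
      case True
      then have "norm x = r * norm x'" using x(4) r(1) by (simp add: map_0 norm_mult)
      then have "norm x' > r ^ m" using Suc.prems(2) r(1) by simp
      then obtain i where i: "i \<in> {1..4}" "proj_coord i x' > 0" using Suc.IH[OF x(3)] by blast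
      let ?t = "proj_coord i x'"
      have "of_real ?t * corner i \<in> seg 0 x'" using ray_in_seg_0[OF i(1) x(3)] i(2) by simp
      then have "F 0 j (of_real ?t * corner i) \<in> seg (F 0 j 0) (F 0 j x')"
        using seg_map(1)[OF _ x(2) zero_in_vicsek x(3), of 0] n2 by simp
      then have "of_real (r * ?t) * corner i \<in> seg 0 x"
        using x(4) True by (simp add: map_0 mult.assoc)
      moreover have "0 \<le> r * ?t" "r * ?t \<le> 1"
        using r i(2) proj_coord_bounds(2)[OF i(1) x(3)] by (auto intro: mult_le_one)
      ultimately have "r * ?t \<le> proj_coord i x"
        using Suc.prems i by (intro proj_coord_ge) auto
      moreover have "0 < r * ?t" using r i(2) by simp
      ultimately show ?thesis using i(1) by (intro bexI[of _ i]) linarith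
    next
      case False
      have "0 \<in> inner_cells 1 j" using innerI[of 0 j j 1 0] n2 x(2) zero_in_vicsek z by simp
      moreover have "x \<in> outer_cells 1 j" using outerI[of 1 k x' j] x False by simp
      ultimately have "junction 1 j \<in> seg 0 x" using n2 x(2) by (intro junction_in_seg) auto
      then have "of_real r * corner j \<in> seg 0 x" by (simp add: junction_def)
      then have "r \<le> proj_coord j x" using Suc.prems x(2) r by (intro proj_coord_ge) auto
      then show ?thesis using r(1) x(2) by (intro bexI[of _ j]) linarith
    qed
  qed
  moreover obtain m where "r ^ m < norm x"
    using real_arch_pow_inv[of "norm x" r] assms(2) r by auto
  ultimately show ?thesis using assms(1) by blast
qed

section \<open>Cells and the continuity of the path metric\<close>

lemma cell_maps_props:
  assumes "g \<in> cell_maps n m"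
  shows "g ` K \<subseteq> K" "continuous_on UNIV g" "\<And>x y. x \<in> K \<Longrightarrow> y \<in> K \<Longrightarrow> d (g x) (g y) = r ^ m * d x y"
    "\<And>x y. dist (g x) (g y) = r ^ m * dist x y"
proof -
  have "g ` K \<subseteq> K \<and> continuous_on UNIV g \<and> (\<forall>x\<in>K. \<forall>y\<in>K. d (g x) (g y) = r ^ m * d x y) \<and>
      (\<forall>x y. dist (g x) (g y) = r ^ m * dist x y)"
    using assms
  proof (induction m arbitrary: g)
    case (Suc m)
    then obtain f h where fh: "f \<in> vicsek_maps n" "h \<in> cell_maps n m" "g = f \<circ> h" by auto
    then obtain k j where kj: "k < n" "j \<in> {1..4}" "f = F k j" by (auto elim: mapsE)
    have h: "h ` K \<subseteq> K" "continuous_on UNIV h" "\<And>x y. x \<in> K \<Longrightarrow> y \<in> K \<Longrightarrow> d (h x) (h y) = r ^ m * d x y"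
      "\<And>x y. dist (h x) (h y) = r ^ m * dist x y"
      using Suc.IH[OF fh(2)] by blast+
    have "g ` K \<subseteq> K" using h(1) map_in_vicsek kj unfolding fh(3) by auto
    moreover have "continuous_on UNIV g"
      unfolding fh(3) kj(3) using h(2) by (rule continuous_on_compose) (rule continuous_map)
    moreover have "d (g x) (g y) = r ^ Suc m * d x y" if "x \<in> K" "y \<in> K" for x y
      using h(1,3) that d_map[OF kj(1,2), of "h x" "h y"] unfolding fh(3) kj(3) by (auto simp: image_subset_iff)
    ultimately show ?case using h(4) by (simp add: fh(3) kj(3) dist_map)
  qed simp
  then show "g ` K \<subseteq> K" "continuous_on UNIV g" "\<And>x y. x \<in> K \<Longrightarrow> y \<in> K \<Longrightarrow> d (g x) (g y) = r ^ m * d x y"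
    "\<And>x y. dist (g x) (g y) = r ^ m * dist x y"
    by blast+
qed

lemma finite_cell_maps: "finite (cell_maps n m)"
proof (induction m)
  case (Suc m)
  have "cell_maps n (Suc m) = (\<lambda>(f, g). f \<circ> g) ` (vicsek_maps n \<times> cell_maps n m)" by auto
  then show ?case using Suc finite_maps by simp
qed simp

lemma cell_maps_cover: "x \<in> K \<Longrightarrow> \<exists>g\<in>cell_maps n m. x \<in> g ` K"
proof (induction m arbitrary: x)
  case (Suc m)
  obtain k j x' where x: "k < n" "j \<in> {1..4}" "x' \<in> K" "x = F k j x'" using Suc.prems by (rule vicsekE)
  obtain g y where "g \<in> cell_maps n m" "y \<in> K" "x' = g y" using Suc.IH[OF x(3)] by blast
  then show ?case using mapsI[OF x(1,2)] x(4)
    by (intro bexI[of _ "F k j \<circ> g"]) (auto intro!: image_eqI[of _ _ y])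
qed simp

text \<open>The finitely many \<open>m\<close>-cells that miss \<open>x\<close> keep a positive
  distance from it, so a point close to \<open>x\<close> shares an \<open>m\<close>-cell with it,
  and \<open>m\<close>-cells have \<open>d\<close>-diameter at most 6 r^m.\<close>

lemma d_small:
  assumes x: "x \<in> K" and e: "e > 0"
  shows "\<exists>\<delta>>0. \<forall>y\<in>K. dist y x < \<delta> \<longrightarrow> d y x < e"
proof -
  have "(\<lambda>m. r ^ m * 6) \<longlonglongrightarrow> 0"
    using r by (intro tendsto_mult_left_zero LIMSEQ_realpow_zero) auto
  from order_tendstoD(2)[OF this e] obtain m where m: "r ^ m * 6 < e" by (auto simp: eventually_sequentially)
  define U where "U = (\<Union>g\<in>{g \<in> cell_maps n m. x \<notin> g ` K}. g ` K)"
  have "closed U"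
    unfolding U_def using finite_cell_maps vicsek(1) cell_maps_props(2)
    by (intro closed_UN) (auto intro!: compact_imp_closed compact_continuous_image intro: continuous_on_subset)
  then have "open (- U)" by (rule open_Compl)
  moreover have "x \<in> - U" by (auto simp: U_def)
  ultimately obtain \<delta> where \<delta>: "\<delta> > 0" "\<And>y. dist y x < \<delta> \<Longrightarrow> y \<in> - U"
    unfolding open_dist by blast
  have "d y x < e" if y: "y \<in> K" "dist y x < \<delta>" for y
  proof -
    obtain g where g: "g \<in> cell_maps n m" "y \<in> g ` K" using cell_maps_cover[OF y(1)] by blast
    then have "x \<in> g ` K" using \<delta>(2)[OF y(2)] by (auto simp: U_def)
    then obtain y' x' where "y' \<in> K" "x' \<in> K" "y = g y'" "x = g x'" using g(2) by blast
    then have "d y x \<le> r ^ m * 6"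
      using cell_maps_props(3)[OF g(1)] d_le r(1) by (simp add: mult_left_mono)
    then show ?thesis using m by simp
  qed
  then show ?thesis using \<delta>(1) by blast
qed

lemma continuous_d:
  assumes a: "a \<in> K"
  shows "continuous_on K (\<lambda>x. d a x)"
  unfolding continuous_on_iff
proof (intro ballI allI impI)
  fix x and e :: real assume x: "x \<in> K" and e: "e > 0"
  obtain \<delta> where \<delta>: "\<delta> > 0" "\<And>y. y \<in> K \<Longrightarrow> dist y x < \<delta> \<Longrightarrow> d y x < e"
    using d_small[OF x e] by blast
  have "dist (d a y) (d a x) < e" if "y \<in> K" "dist y x < \<delta>" for y
    using \<delta>(2)[OF that] d_triangle[OF a x that(1)] d_triangle[OF a that(1) x] d_commute[OF x that(1)]
    by (simp add: dist_real_def abs_less_iff)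
  then show "\<exists>\<delta>>0. \<forall>y\<in>K. dist y x < \<delta> \<longrightarrow> dist (d a y) (d a x) < e" using \<delta>(1) by blast
qed

lemma continuous_gp: "b \<in> K \<Longrightarrow> a \<in> K \<Longrightarrow> continuous_on K (\<lambda>x. gp b a x)"
  unfolding gp_def by (intro continuous_intros continuous_d) auto

lemma continuous_proj_coord: "i \<in> {1..4} \<Longrightarrow> continuous_on K (proj_coord i)"
  using continuous_gp[OF zero_in_vicsek corner_in_vicsek] unfolding proj_coord_def[abs_def] common_def .

section \<open>Arms and the projection to the diagonals\<close>

lemma proj_coord_corner: "i \<in> {1..4} \<Longrightarrow> proj_coord i (corner i) = 1"
  using d_0_corner[of i] d_refl[OF corner_in_vicsek[of i]] by (simp add: proj_coord_def common_def gp_def)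

lemma proj_coord_0: "i \<in> {1..4} \<Longrightarrow> proj_coord i 0 = 0"
  using d_refl[OF zero_in_vicsek] d_commute[OF zero_in_vicsek corner_in_vicsek[of i]]
  by (simp add: proj_coord_def common_def gp_def)

text \<open>Without 0, the continuous function \<open>\<phi>\<close> is positive where
  \<open>proj_coord i\<close> is and negative elsewhere, so a connected set containing
  \<open>corner i\<close> cannot leave the part where it is positive.\<close>

lemma armD:
  assumes i: "i \<in> {1..4}" and x: "x \<in> arm n i"
  shows "x \<in> K" "x = 0 \<or> proj_coord i x > 0"
proof -
  define C where "C = connected_component_set (K - {0}) (corner i)"
  have C: "C \<subseteq> K - {0}" "connected C"
    unfolding C_def by (rule connected_component_subset) (rule connected_connected_component)
  have cC: "corner i \<in> C" unfolding C_def
    using corner_in_vicsek[OF i] by (simp add: connected_component_refl)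
  define \<phi> where "\<phi> x = proj_coord i x - (\<Sum>j\<in>{1..4} - {i}. proj_coord j x)" for x
  have cont: "continuous_on C \<phi>"
    unfolding \<phi>_def using C(1) i
    by (intro continuous_intros continuous_on_subset[OF continuous_proj_coord]) auto
  have ic: "connected (\<phi> ` C)" using connected_continuous_image[OF cont C(2)] .
  have pos: "proj_coord i x > 0 \<and> \<phi> x > 0 \<or> \<phi> x < 0" if x: "x \<in> K" "x \<noteq> 0" for x
  proof -
    obtain j where j: "j \<in> {1..4}" "proj_coord j x > 0" using proj_coord_pos[OF x] by blast
    have z: "proj_coord k x = 0" if "k \<in> {1..4}" "k \<noteq> j" for k
      using proj_coord_unique[OF j(1) that(1) x(1) j(2)] that proj_coord_bounds(1)[OF that(1) x(1)] by force
    show ?thesis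
    proof (cases "j = i")
      case True
      then have "(\<Sum>j\<in>{1..4} - {i}. proj_coord j x) = 0" using z by (intro sum.neutral) auto
      then show ?thesis using True j by (simp add: \<phi>_def)
    next
      case False
      have "proj_coord j x \<le> (\<Sum>j\<in>{1..4} - {i}. proj_coord j x)"
        using False j proj_coord_bounds(1)[OF _ x(1)] by (intro member_le_sum) auto
      then show ?thesis using z[OF i] False j(2) by (simp add: \<phi>_def)
    qed
  qed
  have "corner i \<in> K" "corner i \<noteq> 0" using corner_in_vicsek[OF i] by auto
  moreover have "proj_coord j (corner i) = 0" if "j \<in> {1..4}" "j \<noteq> i" for j
    using proj_coord_unique[OF i that(1) \<open>corner i \<in> K\<close>] proj_coord_corner[OF i] that
      proj_coord_bounds(1)[OF that(1) \<open>corner i \<in> K\<close>] by force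
  ultimately have c1: "\<phi> (corner i) = 1" using proj_coord_corner[OF i] by (simp add: \<phi>_def)
  have CD: "proj_coord i x > 0" if "x \<in> C" for x
  proof (rule ccontr)
    assume "\<not> proj_coord i x > 0"
    then have "\<phi> x < 0" using pos[of x] C(1) that by auto
    then have "0 \<in> \<phi> ` C"
      using connectedD_interval[OF ic, of "\<phi> x" "\<phi> (corner i)" 0] that cC c1 by auto
    then show False using pos C(1) by force
  qed
  have "x = 0 \<or> x \<in> C" using x by (auto simp: arm_def C_def q0_def)
  then show "x \<in> K" "x = 0 \<or> proj_coord i x > 0" using C(1) zero_in_vicsek CD by auto
qed

lemma arm_proj_coord:
  assumes i: "i \<in> {1..4}" "j \<in> {1..4}" "i \<noteq> j" and x: "x \<in> arm n i"
  shows "proj_coord j x = 0"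
proof -
  have "x \<in> K" using armD(1)[OF i(1) x] .
  then show ?thesis
    using armD(2)[OF i(1) x] proj_coord_0[OF i(2)] proj_coord_unique[OF i(1,2)] i(3)
      proj_coord_bounds(1)[OF i(2), of x] by force
qed

text \<open>By \<open>d_ray_foot\<close>, every other point of the diagonals is strictly farther
  from \<open>x\<close> than the foot. Strictness matters, since it makes the choice in
  \<open>arg_min_on\<close> unique.\<close>

lemma diag_proj:
  assumes i: "i \<in> {1..4}" and x: "x \<in> arm n i"
  shows "diag_proj n x = foot i x" "diag_dist n x = proj_coord i x"
proof -
  have xK: "x \<in> K" using armD(1)[OF i x] .
  have dz: "vdist n x (of_real t * corner j) = \<bar>t - proj_coord j x\<bar> + d 0 x - proj_coord j x"
    if "0 \<le> t" "t \<le> 1" "j \<in> {1..4}" for t j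
    using vdist_eq[OF xK ray_in_vicsek[OF that]] d_commute[OF xK ray_in_vicsek[OF that]]
      d_ray_foot[OF that(3) xK that(1,2)] d_0_foot[OF that(3) xK] by simp
  have f: "vdist n x (foot i x) = d 0 x - proj_coord i x" "foot i x \<in> diagonals"
    using dz[OF proj_coord_bounds[OF i xK] i] proj_coord_bounds[OF i xK] i
    by (auto simp: foot_def diagonals_eq)
  have less: "vdist n x z > vdist n x (foot i x)" if z: "z \<in> diagonals" "z \<noteq> foot i x" for z
  proof -
    obtain t j where t: "0 \<le> t" "t \<le> 1" "j \<in> {1..4}" "z = of_real t * corner j"
      using z(1) by (auto simp: diagonals_eq)
    show ?thesis
    proof (cases "j = i")
      case True
      then have "t \<noteq> proj_coord i x" using z(2) t(4) by (auto simp: foot_def)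
      then show ?thesis using dz[OF t(1-3)] f(1) t(4) True by simp
    next
      case False
      then have "proj_coord j x = 0" using arm_proj_coord[OF i t(3) _ x] by simp
      moreover have "t \<noteq> 0 \<or> proj_coord i x \<noteq> 0" using z(2) t(4) by (auto simp: foot_def)
      ultimately show ?thesis
        using dz[OF t(1-3)] f(1) t(1,4) proj_coord_bounds(1)[OF i xK] by auto
    qed
  qed
  have "is_arg_min (vdist n x) (\<lambda>z. z \<in> diagonals) = (\<lambda>z. z = foot i x)"
    unfolding is_arg_min_def using less f(2) by (metis (no_types, opaque_lifting) less_asym)
  then show p: "diag_proj n x = foot i x"
    unfolding diag_proj_def arg_min_on_def arg_min_def by simp
  show "diag_dist n x = proj_coord i x"
    unfolding diag_dist_def p q0_def
    using vdist_eq[OF foot_in_vicsek[OF i xK] zero_in_vicsek] d_commute[OF foot_in_vicsek[OF i xK] zero_in_vicsek]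
      d_0_ray[OF proj_coord_bounds[OF i xK] i] by (simp add: foot_def)
qed

text \<open>At most one summand is nonzero, so on an arm this is d'(x, q0). Written as a sum it is a
  combination of functions \<open>common b\<close>, whose pairings in the energy form are
  accessible.\<close>

definition diag_coord :: "complex \<Rightarrow> real" where
  "diag_coord x = (\<Sum>i\<in>{1..4}. proj_coord i x)"

lemma diag_coord_arm:
  assumes "i \<in> {1..4}" "x \<in> arm n i" shows "diag_coord x = proj_coord i x"
proof -
  have "diag_coord x = (\<Sum>j\<in>{1..4}. if j = i then proj_coord i x else 0)"
    unfolding diag_coord_def using arm_proj_coord assms by (intro sum.cong) auto
  then show ?thesis using assms(1) by simp
qed

text \<open>With one argument fixed, this is a linear combination of functions \<open>common b\<close> and a constant,
  since \<open>proj_coord i\<close> is \<open>common (corner i)\<close>.\<close>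

definition green :: "complex \<Rightarrow> complex \<Rightarrow> real" where
  "green x y = (1 - diag_coord x) * (1 - diag_coord y) / 4 + common x y
     - (\<Sum>i\<in>{1..4}. proj_coord i x * proj_coord i y)"

lemma common_ultrametric:
  "x \<in> K \<Longrightarrow> y \<in> K \<Longrightarrow> z \<in> K \<Longrightarrow> min (common x z) (common z y) \<le> common x y"
  unfolding common_def using gp_ultrametric[OF zero_in_vicsek] .

lemma common_commute: "x \<in> K \<Longrightarrow> y \<in> K \<Longrightarrow> common x y = common y x"
  unfolding common_def by (rule gp_commute)

text \<open>The ultrametric inequality through \<open>corner j\<close>: its common part with
  \<open>x\<close> is 0 while that with a nonzero \<open>y\<close> is positive, which forces the
  common part of \<open>x\<close> and \<open>y\<close> to be 0.\<close>

lemma green_different_arms: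
  assumes ij: "i \<in> {1..4}" "j \<in> {1..4}" "i \<noteq> j" and x: "x \<in> arm n i" and y: "y \<in> arm n j"
  shows "green x y = (1 - diag_dist n x) * (1 - diag_dist n y) / 4"
proof -
  have K: "x \<in> K" "y \<in> K" using armD(1) x y ij by auto
  have c: "corner j \<in> K" using corner_in_vicsek ij by blast
  have "common x y = 0"
  proof (cases "y = 0")
    case True
    then show ?thesis using d_commute[OF zero_in_vicsek K(1)] d_refl[OF zero_in_vicsek]
      by (simp add: common_def gp_def)
  next
    case False
    then have "proj_coord j y > 0" using armD(2)[OF ij(2) y] by simp
    moreover have "min (common x y) (common y (corner j)) \<le> common x (corner j)"
      using common_ultrametric[OF K(1) c K(2)] .
    moreover have "common x (corner j) = 0"
      using arm_proj_coord[OF ij x] common_commute[OF K(1) c] by (simp add: proj_coord_def)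
    moreover have "common x y \<ge> 0" unfolding common_def using gp_nonneg[OF zero_in_vicsek K] .
    ultimately show ?thesis using common_commute[OF K(2) c] by (simp add: proj_coord_def min_def split: if_splits)
  qed
  moreover have "(\<Sum>k\<in>{1..4}. proj_coord k x * proj_coord k y) = 0"
  proof (rule sum.neutral[OF ballI])
    fix k assume "k \<in> {1..4::nat}"
    then show "proj_coord k x * proj_coord k y = 0"
    using arm_proj_coord[OF ij(1) _ _ x, of k] arm_proj_coord[OF ij(2) _ _ y, of k] ij(3) by (cases "k = i") auto
  qed
  ultimately show ?thesis
    using diag_coord_arm[OF ij(1) x] diag_coord_arm[OF ij(2) y] diag_proj(2)[OF ij(1) x] diag_proj(2)[OF ij(2) y]
    by (simp add: green_def)
qed

context
  fixes i :: nat and x y :: complex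
  assumes i: "i \<in> {1..4}" and x: "x \<in> arm n i" and y: "y \<in> arm n i"
begin

lemma green_same_arm:
  "green x y = (1 - diag_dist n x) * (1 - diag_dist n y) / 4 + common x y - diag_dist n x * diag_dist n y"
proof -
  have "(\<Sum>k\<in>{1..4}. proj_coord k x * proj_coord k y) =
      (\<Sum>k\<in>{1..4}. if k = i then proj_coord i x * proj_coord i y else 0)"
    using arm_proj_coord[OF i _ _ x] by (intro sum.cong) auto
  then show ?thesis using i diag_coord_arm[OF i] x y diag_proj(2)[OF i] by (simp add: green_def)
qed

text \<open>Among the three pairwise common lengths of \<open>x\<close>, \<open>y\<close> and
  \<open>corner i\<close>, the smallest value occurs twice.\<close>

lemma common_same_arm:
  assumes "diag_dist n x < diag_dist n y"
  shows "common x y = diag_dist n x"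
proof -
  have K: "x \<in> K" "y \<in> K" "corner i \<in> K" using armD(1)[OF i] x y corner_in_vicsek i by auto
  have p: "common x (corner i) = diag_dist n x" "common y (corner i) = diag_dist n y"
    using diag_proj(2)[OF i] x y common_commute K by (auto simp: proj_coord_def)
  have "min (common x y) (common y (corner i)) \<le> common x (corner i)"
    "min (common x (corner i)) (common (corner i) y) \<le> common x y"
    using common_ultrametric K by auto
  then show ?thesis using p common_commute[OF K(2,3)] assms by (auto simp: min_def split: if_splits)
qed

text \<open>With a and b the diagonal distances of \<open>x\<close> and \<open>y\<close>, the last
  two terms are a - a b = a (1 - b), and (1 - a)/4 + a = (3 a + 1)/4.\<close>

lemma green_same_arm_less:
  assumes "diag_dist n x < diag_dist n y"
  shows "green x y = (1 - diag_dist n y) * (3 * diag_dist n x + 1) / 4"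
  unfolding green_same_arm common_same_arm[OF assms] by (simp add: field_simps)

text \<open>The common part measured from 0 consists of the way to \<open>z\<close>, of length
  \<open>diag_dist n y\<close>, and of the common part beyond \<open>z\<close>. The latter is the
  Gromov product at \<open>z\<close>, whose branch point is \<open>w\<close>.\<close>

lemma green_same_projection:
  assumes eq: "diag_dist n x = diag_dist n y"
  shows "green x y = (1 - diag_dist n y) * (3 * diag_dist n y + 1) / 4
    + vdist n (diag_proj n y) (last_common n (diag_proj n y) x y)"
proof -
  have K: "x \<in> K" "y \<in> K" using armD(1)[OF i] x y by auto
  define z where "z = diag_proj n y"
  have z: "z = foot i x" "z = foot i y"
    using diag_proj[OF i x] diag_proj[OF i y] eq by (auto simp: z_def foot_def)
  have zK: "z \<in> K" using foot_in_vicsek[OF i K(1)] z(1) by simp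
  define w where "w = last_common n z x y"
  have w': "w = geod z y (Sup {t \<in> {0..1}. geod z y t \<in> path_image (geod z x)})"
    by (simp add: w_def last_common_def geodesic_eq)
  have w: "w \<in> seg z x" "w \<in> seg z y" "w \<in> seg x y"
    unfolding w' by (rule last_common_point[OF K zK])+
  then have "w \<in> K" using seg_subset K by blast
  then have "vdist n z w = gp z x y"
    using gp_tripod[OF zK K w] vdist_eq[OF zK] by simp
  also have "\<dots> = common x y - diag_dist n y"
    using d_0_foot[OF i K(1)] d_0_foot[OF i K(2)] z diag_proj(2)[OF i x] diag_proj(2)[OF i y] eq
    by (simp add: gp_def common_def field_simps)
  finally show ?thesis
    unfolding green_same_arm eq z_def[symmetric] w_def[symmetric] by (simp add: field_simps)
qed

end

lemma green_commute: "x \<in> K \<Longrightarrow> y \<in> K \<Longrightarrow> green x y = green y x"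
  unfolding green_def using common_commute by (simp add: mult.commute)

section \<open>The discrete energies\<close>

definition edges :: "nat \<Rightarrow> (complex \<times> complex) set" where
  "edges m = {(x, y). x \<in> vertices n m \<and> y \<in> vertices n m \<and> adjacent n m x y}"

text \<open>The 1/8 is the normalization 1/4 times the 1/2 for counting every edge in both
  directions.\<close>

definition bil :: "nat \<Rightarrow> (complex \<Rightarrow> real) \<Rightarrow> (complex \<Rightarrow> real) \<Rightarrow> real" where
  "bil m u v = (2 * real n - 1) ^ m / 8 * (\<Sum>(x, y)\<in>edges m. (u x - u y) * (v x - v y))"

lemma bil_edge_sum: "1 / 4 * (2 * real n - 1) ^ m * edge_sum n m u = bil m u u"
  by (simp add: bil_def edge_sum_def edges_def power2_eq_square)

lemma vertices_subset: "vertices n m \<subseteq> K"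
  by (induction m) (auto simp: corners_def intro: corner_in_vicsek map_in_vicsek elim!: mapsE)

lemma finite_edges: "finite (edges m)"
proof -
  have "finite (vertices n m)" by (induction m) (auto simp: corners_def finite_maps)
  then have "finite (vertices n m \<times> vertices n m)" by simp
  then show ?thesis by (rule finite_subset[rotated]) (auto simp: edges_def)
qed

lemma edges_subset: "(x, y) \<in> edges m \<Longrightarrow> x \<in> K \<and> y \<in> K"
  using vertices_subset by (auto simp: edges_def)

lemma cell_corners: "g \<in> cell_maps n m \<Longrightarrow> g ` corners \<subseteq> vertices n m"
  by (induction m arbitrary: g) (auto, metis image_eqI image_subset_iff)

lemma edges_0: "edges 0 = {(x, y). x \<in> corners \<and> y \<in> corners \<and> x \<noteq> y}"
  by (auto simp: edges_def adjacent_def)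

lemma edges_Suc: "edges (Suc m) = (\<Union>f\<in>vicsek_maps n. map_prod f f ` edges m)"
proof
  show "edges (Suc m) \<subseteq> (\<Union>f\<in>vicsek_maps n. map_prod f f ` edges m)"
  proof
    fix z assume "z \<in> edges (Suc m)"
    then obtain x y where z: "z = (x, y)" "(x, y) \<in> edges (Suc m)" by (cases z) auto

    from z(2) obtain f g c c' where fg: "f \<in> vicsek_maps n" "g \<in> cell_maps n m" "c \<in> corners" "c' \<in> corners"
      "x = f (g c)" "y = f (g c')" "x \<noteq> y"
      by (auto simp: edges_def adjacent_def)
    then have "(g c, g c') \<in> edges m"
      using cell_corners[OF fg(2)] by (auto simp: edges_def adjacent_def)
    then show "z \<in> (\<Union>f\<in>vicsek_maps n. map_prod f f ` edges m)"
      using fg z(1) by (intro UN_I[of f]) (auto intro!: image_eqI[of _ _ "(g c, g c')"])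
  qed
  show "(\<Union>f\<in>vicsek_maps n. map_prod f f ` edges m) \<subseteq> edges (Suc m)"
  proof
    fix z assume "z \<in> (\<Union>f\<in>vicsek_maps n. map_prod f f ` edges m)"
    then obtain f x y where f: "f \<in> vicsek_maps n" and e: "(x, y) \<in> edges m" and z: "z = (f x, f y)"
      by auto
    have "inj f" using f inj_map by (auto elim!: mapsE)
    then have "f x \<noteq> f y" using e by (auto simp: edges_def adjacent_def inj_eq)
    moreover obtain g where "g \<in> cell_maps n m" "x \<in> g ` corners" "y \<in> g ` corners"
      using e by (auto simp: edges_def adjacent_def)
    then have "f \<circ> g \<in> cell_maps n (Suc m) \<and> f x \<in> (f \<circ> g) ` corners \<and> f y \<in> (f \<circ> g) ` corners"
      using f by auto
    moreover have "f x \<in> vertices n (Suc m)" "f y \<in> vertices n (Suc m)"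
      using e f by (auto simp: edges_def)
    ultimately show "z \<in> edges (Suc m)"
      unfolding edges_def adjacent_def z by (simp only: mem_Collect_eq split_conv) blast
  qed
qed

text \<open>Distinct cells share at most one point, so no edge belongs to two of them and the sum
  splits over the cells.\<close>

lemma bil_Suc: "bil (Suc m) u v = (2 * real n - 1) * (\<Sum>f\<in>vicsek_maps n. bil m (u \<circ> f) (v \<circ> f))"
proof -
  let ?\<phi> = "\<lambda>(x, y). (u x - u y) * (v x - v y)"
  have "(\<Sum>p\<in>edges (Suc m). ?\<phi> p) = (\<Sum>f\<in>vicsek_maps n. \<Sum>p\<in>map_prod f f ` edges m. ?\<phi> p)"
    unfolding edges_Suc
  proof (rule sum.UNION_disjoint)
    show "\<forall>f\<in>vicsek_maps n. \<forall>g\<in>vicsek_maps n. f \<noteq> g \<longrightarrow> map_prod f f ` edges m \<inter> map_prod g g ` edges m = {}"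
    proof (intro ballI impI equals0I)
      fix f g z assume fg: "f \<in> vicsek_maps n" "g \<in> vicsek_maps n" "f \<noteq> g"
        and z: "z \<in> map_prod f f ` edges m \<inter> map_prod g g ` edges m"
      obtain x y where z1: "(x, y) \<in> edges m" "z = (f x, f y)" using z by auto
      obtain x' y' where z2: "(x', y') \<in> edges m" "z = (g x', g y')" using z by auto
      obtain p where p: "f ` K \<inter> g ` K \<subseteq> {p}" using cells_Int[OF fg] by blast
      have "f x \<in> f ` K \<inter> g ` K" "f y \<in> f ` K \<inter> g ` K"
        using z1(2) z2(2) edges_subset[OF z1(1)] edges_subset[OF z2(1)] by (metis IntI imageI prod.inject)+
      then have "f x = f y" using p by blast
      moreover have "inj f" using fg(1) inj_map by (auto elim!: mapsE)
      ultimately show False using z1(1) by (auto simp: edges_def adjacent_def inj_eq)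
    qed
  qed (auto simp: finite_maps finite_edges)
  also have "\<dots> = (\<Sum>f\<in>vicsek_maps n. \<Sum>(x, y)\<in>edges m. ((u \<circ> f) x - (u \<circ> f) y) * ((v \<circ> f) x - (v \<circ> f) y))"
  proof (rule sum.cong[OF refl])
    fix f assume "f \<in> vicsek_maps n"
    then have "inj f" using inj_map by (auto elim!: mapsE)
    then have "inj_on (map_prod f f) (edges m)" by (intro inj_on_subset[OF prod.inj_map]) auto
    then show "(\<Sum>p\<in>map_prod f f ` edges m. ?\<phi> p) =
        (\<Sum>(x, y)\<in>edges m. ((u \<circ> f) x - (u \<circ> f) y) * ((v \<circ> f) x - (v \<circ> f) y))"
      by (subst sum.reindex) (auto intro!: sum.cong)
  qed
  finally show ?thesis
    by (simp add: bil_def sum_distrib_left mult.assoc)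
qed

lemma bil_commute: "bil m u v = bil m v u"
  by (simp add: bil_def mult.commute)

lemma bil_nonneg: "bil m u u \<ge> 0"
  unfolding bil_def using n2 by (intro mult_nonneg_nonneg sum_nonneg) auto

lemma bil_cong:
  assumes "\<And>x. x \<in> K \<Longrightarrow> u x = u' x" "\<And>x. x \<in> K \<Longrightarrow> v x = v' x"
  shows "bil m u v = bil m u' v'"
proof -
  have "(\<Sum>(x, y)\<in>edges m. (u x - u y) * (v x - v y)) = (\<Sum>(x, y)\<in>edges m. (u' x - u' y) * (v' x - v' y))"
    using edges_subset assms by (intro sum.cong refl) auto
  then show ?thesis by (simp add: bil_def)
qed

lemma bil_lincomb: "bil m (\<lambda>x. a * u x + b * w x + c) v = a * bil m u v + b * bil m w v"
proof -
  have "(\<Sum>(x, y)\<in>edges m. (a * u x + b * w x + c - (a * u y + b * w y + c)) * (v x - v y)) =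
      (\<Sum>(x, y)\<in>edges m. a * ((u x - u y) * (v x - v y)) + b * ((w x - w y) * (v x - v y)))"
    by (intro sum.cong refl) (auto simp: algebra_simps)
  also have "\<dots> = a * (\<Sum>(x, y)\<in>edges m. (u x - u y) * (v x - v y)) + b * (\<Sum>(x, y)\<in>edges m. (w x - w y) * (v x - v y))"
    by (simp add: sum.distrib sum_distrib_left split_beta)
  finally show ?thesis by (simp add: bil_def algebra_simps)
qed

lemma bil_scale: "bil m (\<lambda>x. a * u x + c) v = a * bil m u v"
  using bil_lincomb[of m a u 0 "\<lambda>_. 0" c v] by simp

lemma bil_const: "bil m (\<lambda>x. c) v = 0"
  using bil_scale[of m 0 "\<lambda>_. 0" c v] by simp

lemma bil_add: "bil m (\<lambda>x. u x + w x) v = bil m u v + bil m w v"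
  and bil_diff: "bil m (\<lambda>x. u x - w x) v = bil m u v - bil m w v"
  using bil_lincomb[of m 1 u 1 w 0 v] bil_lincomb[of m 1 u "-1" w 0 v] by simp_all

lemma bil_sum:
  "finite I \<Longrightarrow> bil m (\<lambda>x. \<Sum>i\<in>I. c i * f i x) v = (\<Sum>i\<in>I. c i * bil m (f i) v)"
proof (induction I rule: finite_induct)
  case empty
  then show ?case by (simp add: bil_const)
next
  case (insert i I)
  then show ?case using bil_add[of m "\<lambda>x. c i * f i x" "\<lambda>x. \<Sum>i\<in>I. c i * f i x" v] bil_scale[of m "c i" "f i" 0 v]
    by simp
qed

lemma bil_eq_0:
  assumes "bil m w w = 0"
  shows "bil m u w = 0"
proof -
  have "(\<Sum>p\<in>edges m. (w (fst p) - w (snd p)) * (w (fst p) - w (snd p))) = 0"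
    using assms n2 by (simp add: bil_def split_beta)
  then have "\<forall>p\<in>edges m. (w (fst p) - w (snd p)) * (w (fst p) - w (snd p)) = 0"
    by (subst (asm) sum_nonneg_eq_0_iff) (auto simp: finite_edges)
  then show ?thesis by (auto simp: bil_def intro!: sum.neutral)
qed

lemma sum_1_4:
  fixes f :: "nat \<Rightarrow> real"
  shows "(\<Sum>i\<in>{1..4}. f i) = f 1 + f 2 + f 3 + f 4" "(\<Sum>i\<in>{Suc 0..4}. f i) = f 1 + f 2 + f 3 + f 4"
proof -
  have "{Suc 0..4} = {1, 2, 3, 4}" by auto
  then show "(\<Sum>i\<in>{1..4}. f i) = f 1 + f 2 + f 3 + f 4" "(\<Sum>i\<in>{Suc 0..4}. f i) = f 1 + f 2 + f 3 + f 4"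
    by simp_all
qed

definition corner_avg :: "(complex \<Rightarrow> real) \<Rightarrow> real" where
  "corner_avg v = (\<Sum>i\<in>{1..4}. v (corner i)) / 4"

text \<open>The sum over ordered pairs of corners is 8 times the right-hand side, which cancels the
  1/8. The result is the form of a star of unit conductances whose center takes the value
  \<open>corner_avg v\<close>.\<close>

lemma bil_0: "bil 0 u v = (\<Sum>i\<in>{1..4}. u (corner i) * (v (corner i) - corner_avg v))"
proof -
  have inj: "inj_on corner {1..4}" using corner_inj by (auto intro!: inj_onI)
  have "(\<Sum>(x, y)\<in>edges 0. (u x - u y) * (v x - v y)) = (\<Sum>(x, y)\<in>corners \<times> corners. (u x - u y) * (v x - v y))"
    unfolding edges_0 by (rule sum.mono_neutral_left) (auto simp: corners_def)
  also have "\<dots> = (\<Sum>x\<in>corners. \<Sum>y\<in>corners. (u x - u y) * (v x - v y))"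
    by (simp add: sum.cartesian_product)
  also have "\<dots> = (\<Sum>i\<in>{1..4}. \<Sum>j\<in>{1..4}. (u (corner i) - u (corner j)) * (v (corner i) - v (corner j)))"
    unfolding corners_def by (simp only: sum.reindex[OF inj] o_def)
  also have "\<dots> = 8 * (\<Sum>i\<in>{1..4}. u (corner i) * (v (corner i) - corner_avg v))"
    unfolding corner_avg_def sum_1_4 by (simp add: field_simps)
  finally show ?thesis by (simp add: bil_def)
qed

text \<open>The derivative of \<open>potential b\<close> is \<open>1\<close> along the path from \<open>0\<close> to \<open>b\<close>, and \<open>0\<close> off this path.\<close>

definition potential :: "complex \<Rightarrow> complex \<Rightarrow> real" where
  "potential b x = (d 0 x - d b x) / 2"

section \<open>Potentials under subdivision and the defect of the energy identity\<close>

lemma d_inner_map: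
  assumes k: "1 \<le> k" "k < n" "j \<in> {1..4}" and x: "x \<in> K"
  shows "a \<in> inner_cells k j \<Longrightarrow> d a (F k j x) = d a (junction k j) + r * d (corner (opp j)) x"
proof -
  assume a: "a \<in> inner_cells k j"
  have "d a (F k j x) = d a (junction k j) + d (junction k j) (F k j x)"
    using k x a by (intro d_cut) (auto intro: outerI)
  also have "d (junction k j) (F k j x) = r * d (corner (opp j)) x"
    unfolding map_corner(2)[OF k(3), symmetric] using k x opp(1) by (intro d_map corner_in_vicsek) auto
  finally show ?thesis .
qed

lemma d_outer_map:
  assumes k: "Suc k < n" "j \<in> {1..4}" and x: "x \<in> K" and b: "b \<in> outer_cells (Suc k) j"
  shows "d b (F k j x) = d b (junction (Suc k) j) + r * d (corner j) x"
proof -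
  have K: "F k j x \<in> K" "b \<in> K" "junction (Suc k) j \<in> K"
    using map_in_vicsek[OF _ k(2), of k] k(1) x inner_Un_outer[OF k(2), of "Suc k"] b
      map_corner(1)[OF k(2), of k, symmetric] corner_in_vicsek[OF k(2)] by auto
  have "d (F k j x) b = d (F k j x) (junction (Suc k) j) + d (junction (Suc k) j) b"
    using k x b by (intro d_cut) (auto intro!: innerI)
  also have "d (F k j x) (junction (Suc k) j) = r * d x (corner j)"
    unfolding map_corner(1)[OF k(2), symmetric] using k x by (intro d_map corner_in_vicsek) auto
  finally show ?thesis using d_commute[OF K(1,2)] d_commute[OF K(3,2)] d_commute[OF x corner_in_vicsek[OF k(2)]]
    by simp
qed

lemma zero_in_inner: "j \<in> {1..4} \<Longrightarrow> 0 \<in> inner_cells k j"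
  using innerI[of 0 j j k 0] n2 zero_in_vicsek by (simp add: map_0)

text \<open>All \<open>F 0 j\<close> are the same map, so the central cell is split off; the other
  maps are told apart by the images of 0, the centers of their subsquares.\<close>

lemma sum_maps:
  "(\<Sum>f\<in>vicsek_maps n. \<phi> f) = \<phi> (F 0 1) + (\<Sum>j\<in>{1..4}. \<Sum>k\<in>{1..<n}. (\<phi> (F k j) :: real))"
proof -
  let ?I = "{1..4} \<times> {1..<n}"
  have inj: "inj_on (\<lambda>(j, k). F k j) ?I"
  proof (rule inj_onI)
    fix p q assume p: "p \<in> ?I" and q: "q \<in> ?I" and eq: "(\<lambda>(j, k). F k j) p = (\<lambda>(j, k). F k j) q"
    obtain j k where jk: "p = (j, k)" "j \<in> {1..4}" "k \<ge> 1" using p by auto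
    obtain i l where il: "q = (i, l)" "i \<in> {1..4}" "l \<ge> 1" using q by auto
    have "F k j 0 = F l i 0" using eq jk il by simp
    then have e: "of_real (real k) * corner j = of_real (real l) * corner i" using r(1) by (simp add: map_eq)
    then have "norm (of_real (real k) * corner j) = norm (of_real (real l) * corner i)" by simp
    then have "k = l" by (simp add: norm_mult)
    then have "corner j = corner i" using e il(3) by simp
    then show "p = q" using corner_inj[OF jk(2) il(2)] jk(1) il(1) \<open>k = l\<close> by simp
  qed
  have eq: "vicsek_maps n = insert (F 0 1) ((\<lambda>(j, k). F k j) ` ?I)"
  proof
    show "vicsek_maps n \<subseteq> insert (F 0 1) ((\<lambda>(j, k). F k j) ` ?I)"
    proof
      fix f assume "f \<in> vicsek_maps n"
      then obtain k j where kj: "k < n" "j \<in> {1..4}" "f = F k j" by (rule mapsE)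
      show "f \<in> insert (F 0 1) ((\<lambda>(j, k). F k j) ` ?I)"
      proof (cases "k = 0")
        case True
        then have "f = F 0 1" using kj(3) by (auto simp: map_0)
        then show ?thesis by simp
      next
        case False
        then have "(j, k) \<in> ?I" using kj by auto
        then have "(\<lambda>(j, k). F k j) (j, k) \<in> (\<lambda>(j, k). F k j) ` ?I" by (rule imageI)
        then show ?thesis using kj(3) by simp
      qed
    qed
    show "insert (F 0 1) ((\<lambda>(j, k). F k j) ` ?I) \<subseteq> vicsek_maps n"
      using n2 by (auto intro!: mapsI)
  qed
  have "F 0 1 \<noteq> F k j" if "k \<ge> 1" for k j
  proof
    assume "F 0 1 = F k j"
    then have "F 0 1 0 = F k j 0" by simp
    then show False using r(1) that by (simp add: map_eq)
  qed
  note ne = this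
  have "F 0 1 \<notin> (\<lambda>(j, k). F k j) ` ?I"
  proof
    assume "F 0 1 \<in> (\<lambda>(j, k). F k j) ` ?I"
    then obtain p where "F 0 1 = (\<lambda>(j, k). F k j) p" "p \<in> ?I" by (rule imageE)
    then show False using ne[of "snd p" "fst p"] by (auto simp: split_beta)
  qed
  moreover have "(\<Sum>f\<in>(\<lambda>(j, k). F k j) ` ?I. \<phi> f) = (\<Sum>j\<in>{1..4}. \<Sum>k\<in>{1..<n}. \<phi> (F k j))"
    unfolding sum.reindex[OF inj] sum.cartesian_product by (intro sum.cong refl) auto
  moreover have "finite ((\<lambda>(j, k). F k j) ` ?I)" by simp
  ultimately show ?thesis
    unfolding eq by simp
qed

text \<open>The mean over the corners of the central \<open>m\<close>-cell, in the role of the value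
  at the center.\<close>

fun center_avg :: "nat \<Rightarrow> (complex \<Rightarrow> real) \<Rightarrow> real" where
  "center_avg 0 v = corner_avg v"
| "center_avg (Suc m) v = center_avg m (v \<circ> F 0 1)"

definition defect :: "nat \<Rightarrow> complex \<Rightarrow> (complex \<Rightarrow> real) \<Rightarrow> real" where
  "defect m b v = bil m (potential b) v - v b + center_avg m v"

lemma bil_map_const:
  assumes "k < n" "j \<in> {1..4}" "\<And>x. x \<in> K \<Longrightarrow> u (F k j x) = c"
  shows "bil m (u \<circ> F k j) w = 0"
  using bil_cong[of "u \<circ> F k j" "\<lambda>_. c" w w m] assms(3) by (simp add: bil_const)

lemma rn: "(2 * real n - 1) * (r * x) = x"
  using r(3) by (simp add: mult.assoc[symmetric])

text \<open>On a cell off the path from 0 to \<open>F l i b\<close> the potential is constant. On a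
  cell that the path crosses it is, up to a constant, \<open>r\<close> times the potential of the
  exit corner minus that of the entry corner, and their pairings are exact by the assumption
  \<open>corner\<close>. The values of \<open>v\<close> at the junctions telescope, the center means
  of all but the central cell cancel, and 2n - 1 absorbs \<open>r\<close>. Only the potential of
  \<open>b\<close> in its own cell leaves an error.\<close>

lemma defect_Suc:
  assumes corner: "\<And>j v. j \<in> {1..4} \<Longrightarrow> defect m (corner j) v = 0"
    and l: "l < n" "i \<in> {1..4}" and b: "b \<in> K"
  shows "defect (Suc m) (F l i b) v = defect m b (v \<circ> F l i)"
proof -
  have bc: "bil m (potential (corner j)) w = w (corner j) - center_avg m w" if "j \<in> {1..4}" for j w
    using corner[OF that, of w] by (simp add: defect_def)
  define B where "B = F l i b"
  have BK: "B \<in> K" unfolding B_def using map_in_vicsek l b by blast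
  let ?u = "potential B"
  have const: "bil m (?u \<circ> F k j) w = 0"
    if k: "1 \<le> k" "k < n" "j \<in> {1..4}" and B: "B \<in> inner_cells k j" for k j w
  proof (rule bil_map_const[OF k(2,3)])
    fix x assume x: "x \<in> K"
    show "?u (F k j x) = (d 0 (junction k j) - d B (junction k j)) / 2"
      unfolding potential_def using d_inner_map[OF k x zero_in_inner[OF k(3)]] d_inner_map[OF k x B] by simp
  qed
  show ?thesis
  proof (cases "l = 0")
    case True
    have F0: "F 0 1 = F l i" "0 = F l i 0" using True by (auto simp: map_0)
    have "bil m (?u \<circ> F k j) w = 0" if "k \<in> {1..<n}" "j \<in> {1..4}" for k j w
      using that const[of k j w] innerI[of l i j k b] True l b unfolding B_def by auto
    then have "bil (Suc m) ?u v = (2 * real n - 1) * bil m (?u \<circ> F l i) (v \<circ> F l i)"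
      unfolding bil_Suc sum_maps F0 by simp
    also have "bil m (?u \<circ> F l i) (v \<circ> F l i) = bil m (\<lambda>x. r * potential b x + 0) (v \<circ> F l i)"
    proof (rule bil_cong)
      fix x assume x: "x \<in> K"
      have "d 0 (F l i x) = r * d 0 x" "d B (F l i x) = r * d b x"
        unfolding B_def using d_map[OF l zero_in_vicsek x] d_map[OF l b x] F0(2) by simp_all
      then show "(?u \<circ> F l i) x = r * potential b x + 0" by (simp add: potential_def right_diff_distrib)
    qed simp
    finally have "bil (Suc m) ?u v = bil m (potential b) (v \<circ> F l i)"
      unfolding bil_scale by (simp only: rn)
    then show ?thesis unfolding defect_def B_def[symmetric] using F0(1) by (simp add: B_def)
  next
    case False
    then have l1: "1 \<le> l" by simp
    have z: "bil m (?u \<circ> F k j) w = 0" if "k \<in> {1..<n}" "j \<in> {1..4}" "j \<noteq> i \<or> l < k" for k j w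
      using that const[of k j w] innerI[of l i j k b] l b unfolding B_def by auto
    have Bout: "B \<in> outer_cells k i" if "k \<le> l" for k
      unfolding B_def using outerI that l b by blast
    \<comment> \<open>The path starts at the center of this cell, so there is an exit corner but no
      entry corner, and the center mean of this cell survives.\<close>
    have s0: "bil m (?u \<circ> F 0 1) w = r * bil m (potential (corner i)) w" for w
    proof -
      have "bil m (?u \<circ> F 0 1) w = bil m (\<lambda>x. r * potential (corner i) x + - d B (junction 1 i) / 2) w"
      proof (rule bil_cong)
        fix x assume x: "x \<in> K"
        have F0: "(?u \<circ> F 0 1) x = ?u (F 0 i x)" "F 0 i 0 = 0" by (simp_all add: map_0)
        have "d 0 (F 0 i x) = r * d 0 x"
          using d_map[OF _ l(2) zero_in_vicsek x, of 0] n2 F0(2) by simp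
        moreover have "d B (F 0 i x) = d B (junction 1 i) + r * d (corner i) x"
          using d_outer_map[of 0 i x B] n2 l(2) x Bout[of 1] l1 by simp
        ultimately show "(?u \<circ> F 0 1) x = r * potential (corner i) x + - d B (junction 1 i) / 2"
          unfolding F0(1) by (simp add: potential_def field_simps)
      qed simp
      then show ?thesis unfolding bil_scale .
    qed
    have s1: "bil m (?u \<circ> F k i) w = r * (bil m (potential (corner i)) w - bil m (potential (corner (opp i))) w)"
      if k: "1 \<le> k" "k < l" for k w
    proof -
      have "bil m (?u \<circ> F k i) w = bil m (\<lambda>x. r * potential (corner i) x + (- r) * potential (corner (opp i)) x
          + (d 0 (junction k i) - d B (junction (Suc k) i)) / 2) w"
      proof (rule bil_cong)
        fix x assume x: "x \<in> K"
        have "d 0 (F k i x) = d 0 (junction k i) + r * d (corner (opp i)) x"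
          using k l x by (intro d_inner_map zero_in_inner) auto
        moreover have "d B (F k i x) = d B (junction (Suc k) i) + r * d (corner i) x"
          using k l x Bout[of "Suc k"] by (intro d_outer_map) auto
        ultimately show "(?u \<circ> F k i) x = r * potential (corner i) x + (- r) * potential (corner (opp i)) x
          + (d 0 (junction k i) - d B (junction (Suc k) i)) / 2"
          by (simp add: potential_def field_simps)
      qed simp
      then show ?thesis unfolding bil_lincomb by (simp add: right_diff_distrib)
    qed
    \<comment> \<open>In the last cell the end point \<open>b\<close> takes the place of the exit
      corner.\<close>
    have s2: "bil m (?u \<circ> F l i) w = r * (bil m (potential b) w - bil m (potential (corner (opp i))) w)" for w
    proof -
      have "bil m (?u \<circ> F l i) w = bil m (\<lambda>x. r * potential b x + (- r) * potential (corner (opp i)) x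
          + d 0 (junction l i) / 2) w"
      proof (rule bil_cong)
        fix x assume x: "x \<in> K"
        have "d 0 (F l i x) = d 0 (junction l i) + r * d (corner (opp i)) x"
          using l1 l x by (intro d_inner_map zero_in_inner) auto
        moreover have "d B (F l i x) = r * d b x" unfolding B_def using d_map[OF l b x] .
        ultimately show "(?u \<circ> F l i) x = r * potential b x + (- r) * potential (corner (opp i)) x
          + d 0 (junction l i) / 2"
          by (simp add: potential_def field_simps)
      qed simp
      then show ?thesis unfolding bil_lincomb by (simp add: right_diff_distrib)
    qed
    let ?\<phi> = "\<lambda>f. bil m (?u \<circ> f) (v \<circ> f)"
    have "(\<Sum>j\<in>{1..4}. \<Sum>k\<in>{1..<n}. ?\<phi> (F k j)) = (\<Sum>j\<in>{1..4}. if j = i then (\<Sum>k\<in>{1..<n}. ?\<phi> (F k i)) else 0)"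
      using z by (intro sum.cong refl) (auto intro!: sum.neutral)
    also have "\<dots> = (\<Sum>k\<in>{1..<n}. ?\<phi> (F k i))" using l(2) by simp
    also have "\<dots> = (\<Sum>k\<in>{1..<Suc l}. ?\<phi> (F k i))"
      using z l by (intro sum.mono_neutral_right) auto
    also have "\<dots> = (\<Sum>k\<in>{1..<l}. ?\<phi> (F k i)) + ?\<phi> (F l i)"
      using l1 by (simp add: sum.atLeastLessThan_Suc)
    also have "(\<Sum>k\<in>{1..<l}. ?\<phi> (F k i)) = (\<Sum>k\<in>{1..<l}. r * (v (junction (Suc k) i) - v (junction k i)))"
      using s1 bc l(2) opp(1) map_corner[OF l(2)] by (intro sum.cong refl) simp
    also have "\<dots> = r * (v (junction l i) - v (junction 1 i))"
      unfolding sum_distrib_left[symmetric] using sum_Suc_diff'[OF l1, of "\<lambda>k. v (junction k i)"] by simp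
    finally have S: "(\<Sum>j\<in>{1..4}. \<Sum>k\<in>{1..<n}. ?\<phi> (F k j)) = r * (v (junction l i) - v (junction 1 i)) +
        r * (bil m (potential b) (v \<circ> F l i) - bil m (potential (corner (opp i))) (v \<circ> F l i))"
      unfolding s2 .
    have "bil (Suc m) ?u v = (2 * real n - 1) * (r * bil m (potential (corner i)) (v \<circ> F 0 1) +
        (r * (v (junction l i) - v (junction 1 i)) + r * (bil m (potential b) (v \<circ> F l i)
        - bil m (potential (corner (opp i))) (v \<circ> F l i))))"
      by (simp only: bil_Suc sum_maps s0 S)
    also have "\<dots> = bil m (potential (corner i)) (v \<circ> F 0 1) + (v (junction l i) - v (junction 1 i)) +
        (bil m (potential b) (v \<circ> F l i) - bil m (potential (corner (opp i))) (v \<circ> F l i))"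
      by (simp only: distrib_left rn)
    also have "bil m (potential (corner i)) (v \<circ> F 0 1) = v (junction 1 i) - center_avg m (v \<circ> F 0 1)"
      using bc[OF l(2), of "v \<circ> F 0 1"] map_corner(1)[OF l(2), of 0] by (simp add: map_0)
    also have "bil m (potential (corner (opp i))) (v \<circ> F l i) = v (junction l i) - center_avg m (v \<circ> F l i)"
      using bc[OF opp(1)[OF l(2)], of "v \<circ> F l i"] map_corner(2)[OF l(2), of l] by simp
    moreover have "(v \<circ> F l i) b = v B" by (simp add: B_def)
    ultimately show ?thesis unfolding defect_def B_def[symmetric] center_avg.simps by linarith
  qed
qed

lemma d_corners:
  assumes ij: "i \<in> {1..4}" "j \<in> {1..4}"
  shows "d (corner i) (corner j) = (if i = j then 0 else 2)"
proof (cases "i = j")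
  case True
  then show ?thesis using ij by (simp add: d_refl corner_in_vicsek)
next
  case False
  have cj: "corner j \<in> K" using corner_in_vicsek[OF ij(2)] .
  have "proj_coord i (corner j) = 0"
    using proj_coord_unique[OF ij cj] proj_coord_corner[OF ij(2)] proj_coord_bounds(1)[OF ij(1) cj] False
    by force
  then show ?thesis
    using d_ray_foot[OF ij(1) cj, of 1] d_0_foot[OF ij(1) cj] d_0_corner[OF ij(2)] False by simp
qed

lemma potential_corners:
  "i \<in> {1..4} \<Longrightarrow> j \<in> {1..4} \<Longrightarrow> potential (corner i) (corner j) = (if i = j then 1 / 2 else - 1 / 2)"
  by (simp add: potential_def d_corners d_0_corner)

text \<open>A corner is fixed by the outermost map of its half diagonal, so
  \<open>defect_Suc\<close> leads to the same corner one level down; the induction hypothesis also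
  supplies the assumption of \<open>defect_Suc\<close>.\<close>

lemma defect_corner: "j \<in> {1..4} \<Longrightarrow> defect m (corner j) v = 0"
proof (induction m arbitrary: j v)
  case 0
  have "bil 0 (potential (corner j)) v = v (corner j) - corner_avg v"
    using 0 unfolding bil_0 corner_avg_def in_1_4 by (elim disjE) (simp_all add: sum_1_4 potential_corners field_simps)
  then show ?case by (simp add: defect_def)
next
  case (Suc m)
  then show ?case
    using defect_Suc[of m "n - 1" j "corner j" v] corner_in_vicsek n2 corner_eq_map[of j] by simp
qed

lemma bil_potential_corner: "j \<in> {1..4} \<Longrightarrow> bil m (potential (corner j)) v = v (corner j) - center_avg m v"
  using defect_corner[of j m v] by (simp add: defect_def)

lemma defect_cell:
  assumes "b \<in> K"
  shows "\<exists>g\<in>cell_maps n m. \<exists>b'\<in>K. defect m b v = defect 0 b' (v \<circ> g)"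
  using assms
proof (induction m arbitrary: b v)
  case 0
  then show ?case by auto
next
  case (Suc m)
  obtain k j b' where b: "k < n" "j \<in> {1..4}" "b' \<in> K" "b = F k j b'" using Suc.prems by (rule vicsekE)
  obtain g b'' where g: "g \<in> cell_maps n m" "b'' \<in> K" "defect m b' (v \<circ> F k j) = defect 0 b'' (v \<circ> F k j \<circ> g)"
    using Suc.IH[OF b(3)] by blast
  have "defect (Suc m) b v = defect 0 b'' (v \<circ> (F k j \<circ> g))"
    unfolding b(4) using defect_Suc[OF defect_corner b(1-3), of m v] g(3) by (simp add: o_assoc)
  moreover have "F k j \<circ> g \<in> cell_maps n (Suc m)" using mapsI[OF b(1,2)] g(1) by auto
  ultimately show ?case using g(2) by blast
qed

lemma potential_bound:
  assumes "b \<in> K" "x \<in> K" shows "\<bar>potential b x\<bar> \<le> 3"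
  using d_le[OF zero_in_vicsek assms(2)] d_le[OF assms] d_nonneg[of 0 x] d_nonneg[of b x]
  unfolding potential_def by argo

text \<open>The 13 is 4 times 3, for four corners at which the potential is at most 3 in absolute
  value, plus 1 for the difference between the value at \<open>b'\<close> and the corner
  mean.\<close>

lemma defect_bound:
  assumes b: "b \<in> K" and osc: "\<And>g x y. g \<in> cell_maps n m \<Longrightarrow> x \<in> K \<Longrightarrow> y \<in> K \<Longrightarrow> \<bar>v (g x) - v (g y)\<bar> \<le> \<delta>"
  shows "\<bar>defect m b v\<bar> \<le> 13 * \<delta>"
proof -
  obtain g b' where g: "g \<in> cell_maps n m" "b' \<in> K" "defect m b v = defect 0 b' (v \<circ> g)"
    using defect_cell[OF b] by blast
  define w where "w = v \<circ> g"
  have w: "\<bar>w x - w y\<bar> \<le> \<delta>" if "x \<in> K" "y \<in> K" for x y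
    using osc[OF g(1) that] by (simp add: w_def)
  have avg: "\<bar>w x - corner_avg w\<bar> \<le> \<delta>" if x: "x \<in> K" for x
  proof -
    have "\<bar>w x - w (corner 1)\<bar> \<le> \<delta>" "\<bar>w x - w (corner 2)\<bar> \<le> \<delta>"
      "\<bar>w x - w (corner 3)\<bar> \<le> \<delta>" "\<bar>w x - w (corner 4)\<bar> \<le> \<delta>"
      by (intro w[OF x corner_in_vicsek]; simp)+
    then show ?thesis
      unfolding corner_avg_def sum_1_4 by argo
  qed
  have t: "\<bar>potential b' (corner i) * (w (corner i) - corner_avg w)\<bar> \<le> 3 * \<delta>" if "i \<in> {1..4}" for i
    unfolding abs_mult using potential_bound[OF g(2)] avg corner_in_vicsek[OF that]
    by (intro mult_mono) auto
  have "\<bar>bil 0 (potential b') w\<bar> \<le> (\<Sum>i\<in>{1..4::nat}. 3 * \<delta>)"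
    unfolding bil_0 by (rule order_trans[OF sum_abs]) (intro sum_mono t)
  then have "\<bar>bil 0 (potential b') w\<bar> \<le> 12 * \<delta>" by simp
  then show ?thesis using avg[OF g(2)] unfolding g(3) w_def[symmetric] by (simp add: defect_def)
qed

lemma defect_tendsto:
  assumes b: "b \<in> K" and v: "continuous_on K v"
  shows "(\<lambda>m. defect m b v) \<longlonglongrightarrow> 0"
proof (rule LIMSEQ_I)
  fix e :: real assume e: "e > 0"
  have "uniformly_continuous_on K v" using compact_uniformly_continuous[OF v vicsek(1)] .
  \<comment> \<open>With 14 the resulting bound 13 e / 14 is strictly below e.\<close>
  moreover have "e / 14 > 0" using e by simp
  ultimately obtain \<delta> where \<delta>: "\<delta> > 0" "\<And>x y. x \<in> K \<Longrightarrow> y \<in> K \<Longrightarrow> dist x y < \<delta> \<Longrightarrow> dist (v x) (v y) < e / 14"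
    unfolding uniformly_continuous_on_def by blast
  have "(\<lambda>m. r ^ m * 2) \<longlonglongrightarrow> 0"
    using r by (intro tendsto_mult_left_zero LIMSEQ_realpow_zero) auto
  from order_tendstoD(2)[OF this \<delta>(1)] obtain m0 where m0: "\<And>m. m \<ge> m0 \<Longrightarrow> r ^ m * 2 < \<delta>"
    by (auto simp: eventually_sequentially)
  have "\<bar>defect m b v\<bar> \<le> 13 * (e / 14)" if m: "m \<ge> m0" for m
  proof (rule defect_bound[OF b])
    fix g x y assume g: "g \<in> cell_maps n m" and xy: "x \<in> K" "y \<in> K"
    have "dist (g x) (g y) \<le> r ^ m * 2"
      unfolding cell_maps_props(4)[OF g] using dist_vicsek[OF xy] r(1) by (intro mult_left_mono) auto
    then have "dist (v (g x)) (v (g y)) < e / 14"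
      using m0[OF m] cell_maps_props(1)[OF g] xy by (intro \<delta>(2)) auto
    then show "\<bar>v (g x) - v (g y)\<bar> \<le> e / 14" by (simp add: dist_real_def)
  qed
  then show "\<exists>m0. \<forall>m\<ge>m0. norm (defect m b v - 0) < e"
    using e by (intro exI[of _ m0]) fastforce
qed

text \<open>Pythagoras at level 1: the pairings of \<open>H\<close> with itself and with
  \<open>u\<close> both equal the level-0 energy of \<open>u\<close>, so the increment of the energy
  is the level-1 energy of \<open>u - H\<close>. Higher levels follow cell by cell.\<close>

lemma bil_le_Suc: "bil m u u \<le> bil (Suc m) u u"
proof (induction m arbitrary: u)
  case 0
  text \<open>\<open>H\<close> is the function with the corner values of \<open>u\<close> (up to a constant) that is affine on the
    diagonals and constant off them; it minimises the energy for these corner values.\<close>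
  define c where "c i = u (corner i) - corner_avg u" for i
  define H where "H x = (\<Sum>i\<in>{1..4}. c i * potential (corner i) x)" for x
  have c0: "(\<Sum>i\<in>{1..4}. c i) = 0" unfolding c_def corner_avg_def sum_1_4 by (simp add: field_simps)
  \<comment> \<open>The coefficients sum to 0, so the center means cancel and only corner values
    remain, at every level.\<close>
  have H: "bil m H w = (\<Sum>i\<in>{1..4}. c i * w (corner i))" for m w
  proof -
    have "bil m H w = (\<Sum>i\<in>{1..4}. c i * (w (corner i) - center_avg m w))"
      unfolding H_def by (subst bil_sum) (auto intro!: sum.cong simp: bil_potential_corner)
    also have "\<dots> = (\<Sum>i\<in>{1..4}. c i * w (corner i)) - (\<Sum>i\<in>{1..4}. c i) * center_avg m w"
      by (simp add: right_diff_distrib sum_subtractf sum_distrib_right)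
    finally show ?thesis using c0 by simp
  qed
  have Hc: "H (corner k) = c k" if "k \<in> {1..4}" for k
    using that c0 unfolding H_def in_1_4
    by (elim disjE) (simp_all add: sum_1_4 potential_corners)
  have cc: "(\<Sum>i\<in>{1..4}. c i * c i) = bil 0 u u"
  proof -
    have "(\<Sum>i\<in>{1..4}. c i * c i) = (\<Sum>i\<in>{1..4}. u (corner i) * c i - corner_avg u * c i)"
      by (rule sum.cong[OF refl]) (simp add: c_def left_diff_distrib)
    also have "\<dots> = (\<Sum>i\<in>{1..4}. u (corner i) * c i) - corner_avg u * (\<Sum>i\<in>{1..4}. c i)"
      by (simp only: sum_subtractf sum_distrib_left)
    also have "\<dots> = bil 0 u u" unfolding c0 by (simp add: bil_0 c_def)
    finally show ?thesis .
  qed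
  have cu: "(\<Sum>i\<in>{1..4}. c i * u (corner i)) = bil 0 u u"
    by (simp add: bil_0 c_def mult.commute)
  have "bil 1 H u = bil 0 u u" "bil 1 H H = bil 0 u u"
    unfolding H using cc cu Hc by simp_all
  moreover have "bil 1 w (\<lambda>x. u x - H x) = bil 1 w u - bil 1 w H" for w
    by (metis bil_commute bil_diff)
  then have "bil 1 (\<lambda>x. u x - H x) (\<lambda>x. u x - H x) = bil 1 u u - 2 * bil 1 H u + bil 1 H H"
    unfolding bil_diff using bil_commute[of 1 u H] by simp
  ultimately show ?case using bil_nonneg[of 1 "\<lambda>x. u x - H x"] by simp
next
  case (Suc m)
  have "(\<Sum>f\<in>vicsek_maps n. bil m (u \<circ> f) (u \<circ> f)) \<le> (\<Sum>f\<in>vicsek_maps n. bil (Suc m) (u \<circ> f) (u \<circ> f))"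
    by (intro sum_mono Suc)
  then show ?case
    unfolding bil_Suc[of m u u] bil_Suc[of "Suc m" u u] using n2 by (intro mult_left_mono) auto
qed

end

section \<open>The Green's function\<close>

text \<open>Truncated distance functions converge to the indicator of a closed set, so the integral
  over closed sets vanishes. These generate the Borel sets and are stable under intersection, so the
  integral over every Borel set vanishes.\<close>

lemma AE_zero_if_continuous_integrals_zero:
  fixes \<phi> :: "'a::metric_space \<Rightarrow> real"
  assumes M: "sets M = sets borel" "finite_measure M" and \<phi>: "integrable M \<phi>"
    and zero: "\<And>f :: 'a \<Rightarrow> real. continuous_on UNIV f \<Longrightarrow> (LINT x|M. \<phi> x * f x) = 0"
  shows "AE x in M. \<phi> x = 0"
proof -
  interpret finite_measure M by fact
  have sp: "space M = UNIV" using sets_eq_imp_space_eq[OF M(1)] by simp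
  have \<phi>m: "\<phi> \<in> borel_measurable M" using \<phi> by simp
  have all: "(LINT x|M. \<phi> x) = 0" using zero[of "\<lambda>_. 1"] by simp
  have closed: "set_lebesgue_integral M C \<phi> = 0" if C: "closed C" for C
  proof (cases "C = {}")
    case True
    then show ?thesis by (simp add: set_lebesgue_integral_def)
  next
    case False
    define f where "f k y = max 0 (1 - real k * infdist y C)" for k y
    have fc: "continuous_on UNIV (f k)" for k
      unfolding f_def by (intro continuous_intros)
    have "(\<lambda>k. LINT x|M. \<phi> x * f k x) \<longlonglongrightarrow> (LINT x|M. indicator C x *\<^sub>R \<phi> x)"
    proof (rule integral_dominated_convergence[where w = "\<lambda>x. norm (\<phi> x)"])
      show "(\<lambda>x. indicator C x *\<^sub>R \<phi> x) \<in> borel_measurable M"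
        using C M(1) \<phi>m by (intro borel_measurable_scaleR borel_measurable_indicator) auto
      show "(\<lambda>x. \<phi> x * f k x) \<in> borel_measurable M" for k
      proof (intro borel_measurable_times \<phi>m)
        show "f k \<in> borel_measurable M"
          using borel_measurable_continuous_onI[OF fc] M(1) by (simp cong: measurable_cong_sets)
      qed
      show "integrable M (\<lambda>x. norm (\<phi> x))" using \<phi> by simp
      show "AE x in M. norm (\<phi> x * f k x) \<le> norm (\<phi> x)" for k
        by (intro AE_I2) (auto simp: f_def abs_mult infdist_nonneg intro!: mult_left_le)
      show "AE x in M. (\<lambda>k. \<phi> x * f k x) \<longlonglongrightarrow> indicator C x *\<^sub>R \<phi> x"
      proof (intro AE_I2)
        fix x
        have "(\<lambda>k. f k x) \<longlonglongrightarrow> indicator C x"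
        proof (cases "x \<in> C")
          case True
          then show ?thesis by (simp add: f_def)
        next
          case False
          then have pos: "infdist x C > 0" using C \<open>C \<noteq> {}\<close> in_closed_iff_infdist_zero[of C x] infdist_nonneg[of x C]
            by (simp add: less_le)
          then obtain k0 where k0: "1 / infdist x C < real k0" using reals_Archimedean2 by blast
          have "f k x = 0" if "k \<ge> k0" for k
          proof -
            have "real k > 1 / infdist x C" using k0 that by simp
            then have "real k * infdist x C > 1" using pos by (simp add: field_simps)
            then show ?thesis by (simp add: f_def)
          qed
          then show ?thesis using False by (intro tendsto_eventually eventually_sequentiallyI[of k0]) simp
        qed
        then have "(\<lambda>k. \<phi> x * f k x) \<longlonglongrightarrow> \<phi> x * indicator C x" by (rule tendsto_mult_left)
        then show "(\<lambda>k. \<phi> x * f k x) \<longlonglongrightarrow> indicator C x *\<^sub>R \<phi> x" by (simp add: mult.commute)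
      qed
    qed
    then show ?thesis using zero[OF fc] by (simp add: set_lebesgue_integral_def LIMSEQ_const_iff)
  qed
  have int: "set_integrable M A \<phi>" if "A \<in> sets M" for A
    unfolding set_integrable_def using that \<phi> by (rule integrable_mult_indicator)
  have "set_lebesgue_integral M A \<phi> = 0" if A: "A \<in> sets M" for A
  proof -
    have eq: "sets M = sigma_sets UNIV (Collect closed)"
      using M(1) by (simp add: borel_eq_closed)
    have "Int_stable (Collect closed :: 'a set set)" by (auto simp: Int_stable_def)
    moreover have "Collect closed \<subseteq> Pow (UNIV :: 'a set)" by simp
    moreover have "A \<in> sigma_sets UNIV (Collect closed)" using A eq by simp
    ultimately show ?thesis
    proof (induction rule: sigma_sets_induct_disjoint)
      case (basic A)
      then show ?case using closed by simp
    next
      case empty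
      then show ?case by (simp add: set_lebesgue_integral_def)
    next
      case (compl A)
      then have A: "A \<in> sets M" "UNIV - A \<in> sets M" using eq sets.compl_sets[of A M] sp by auto
      have "set_lebesgue_integral M (A \<union> (UNIV - A)) \<phi> =
          set_lebesgue_integral M A \<phi> + set_lebesgue_integral M (UNIV - A) \<phi>"
        using A int by (intro set_integral_Un) auto
      moreover have "set_lebesgue_integral M (A \<union> (UNIV - A)) \<phi> = 0"
        using all by (simp add: set_lebesgue_integral_def)
      ultimately show ?case using compl(2) by simp
    next
      case (union A)
      then have A: "A i \<in> sets M" for i using eq by auto
      then have "(\<Union>i. A i) \<in> sets M" by auto
      then have "set_lebesgue_integral M (\<Union>i. A i) \<phi> = (\<Sum>i. set_lebesgue_integral M (A i) \<phi>)"
        using A union(1) int by (intro lebesgue_integral_countable_add) (auto simp: disjoint_family_on_def)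
      then show ?case using union(3) by simp
    qed
  qed
  then show ?thesis using density_zero[OF \<phi>] by blast
qed

context vicsek_set
begin

section \<open>The energy form as the limit of the discrete forms\<close>

lemma bil_mono: "m \<le> m' \<Longrightarrow> bil m u u \<le> bil m' u u"
  by (rule lift_Suc_mono_le[of "\<lambda>m. bil m u u"]) (rule bil_le_Suc)

text \<open>Monotonicity in the level makes the \<open>lim\<close> in the definition of the energy
  an actual limit.\<close>

lemma energy_eq: "energy n u = (SUP m. ennreal (bil m u u))"
proof -
  have "(\<lambda>m. ennreal (bil m u u)) \<longlonglongrightarrow> (SUP m. ennreal (bil m u u))"
    by (intro LIMSEQ_SUP incseq_SucI ennreal_leI bil_le_Suc)
  then show ?thesis unfolding energy_def bil_edge_sum by (rule limI)
qed

lemma energy_finite_iff: "energy n u < \<infinity> \<longleftrightarrow> (\<exists>C. \<forall>m. bil m u u \<le> C)"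
proof
  assume "energy n u < \<infinity>"
  then obtain C where C: "energy n u = ennreal C" "C \<ge> 0" by (cases "energy n u") auto
  have "ennreal (bil m u u) \<le> ennreal C" for m
    unfolding C(1)[symmetric] energy_eq by (rule SUP_upper) simp
  then show "\<exists>C. \<forall>m. bil m u u \<le> C" using C(2) by (auto simp: ennreal_le_iff)
next
  assume "\<exists>C. \<forall>m. bil m u u \<le> C"
  then obtain C where "\<And>m. bil m u u \<le> C" by blast
  then have "energy n u \<le> ennreal C" unfolding energy_eq by (intro SUP_least ennreal_leI)
  then show "energy n u < \<infinity>" by (simp add: le_less_trans ennreal_less_top)
qed

lemma energy_tendsto:
  assumes "energy n u < \<infinity>"
  shows "(\<lambda>m. bil m u u) \<longlonglongrightarrow> enn2real (energy n u)"
proof -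
  have "(\<lambda>m. ennreal (bil m u u)) \<longlonglongrightarrow> energy n u"
    unfolding energy_eq by (intro LIMSEQ_SUP incseq_SucI ennreal_leI bil_le_Suc)
  then have "(\<lambda>m. enn2real (ennreal (bil m u u))) \<longlonglongrightarrow> enn2real (energy n u)"
    using assms by (intro tendsto_enn2real) auto
  then show ?thesis by (simp add: bil_nonneg)
qed

lemma bil_plus_minus:
  "bil m (\<lambda>x. u x + v x) (\<lambda>x. u x + v x) = bil m u u + 2 * bil m u v + bil m v v"
  "bil m (\<lambda>x. u x - v x) (\<lambda>x. u x - v x) = bil m u u - 2 * bil m u v + bil m v v"
  unfolding bil_add bil_diff bil_commute[of m _ "\<lambda>x. u x + v x"] bil_commute[of m _ "\<lambda>x. u x - v x"]
  using bil_commute[of m v u] by simp_all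

lemma dom_energy_plus_minus:
  assumes u: "u \<in> dom_energy n" and v: "v \<in> dom_energy n"
  shows "(\<lambda>x. u x + v x) \<in> dom_energy n" "(\<lambda>x. u x - v x) \<in> dom_energy n"
proof -
  obtain C where C: "\<And>m. bil m u u \<le> C" using u energy_finite_iff[of u] unfolding dom_energy_def by blast
  obtain D where D: "\<And>m. bil m v v \<le> D" using v energy_finite_iff[of v] unfolding dom_energy_def by blast
  \<comment> \<open>By the parallelogram identity the two left-hand sides add up to twice the sum of
    the energies of \<open>u\<close> and \<open>v\<close>.\<close>
  have "bil m (\<lambda>x. u x + v x) (\<lambda>x. u x + v x) \<le> 2 * C + 2 * D"
    "bil m (\<lambda>x. u x - v x) (\<lambda>x. u x - v x) \<le> 2 * C + 2 * D" for m
    using bil_plus_minus[of m u v] bil_nonneg[of m "\<lambda>x. u x + v x"] bil_nonneg[of m "\<lambda>x. u x - v x"] C[of m] D[of m]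
    by linarith+
  then have "energy n (\<lambda>x. u x + v x) < \<infinity>" "energy n (\<lambda>x. u x - v x) < \<infinity>"
    unfolding energy_finite_iff by blast+
  then show "(\<lambda>x. u x + v x) \<in> dom_energy n" "(\<lambda>x. u x - v x) \<in> dom_energy n"
    using u v by (auto simp: dom_energy_def intro!: continuous_intros)
qed

text \<open>Polarization is exact at each level and passes to the limit.\<close>

lemma energy_form_tendsto:
  assumes "u \<in> dom_energy n" "v \<in> dom_energy n"
  shows "(\<lambda>m. bil m u v) \<longlonglongrightarrow> energy_form n u v"
proof -
  have "(\<lambda>m. (bil m (\<lambda>x. u x + v x) (\<lambda>x. u x + v x) - bil m (\<lambda>x. u x - v x) (\<lambda>x. u x - v x)) / 4) \<longlonglongrightarrow>
      energy_form n u v"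
    unfolding energy_form_def using dom_energy_plus_minus[OF assms]
    by (intro tendsto_divide tendsto_diff energy_tendsto tendsto_const) (auto simp: dom_energy_def)
  then show ?thesis by (simp add: bil_plus_minus)
qed

lemma bil_potential: "bil m (potential b) v = v b - center_avg m v + defect m b v"
  by (simp add: defect_def)

text \<open>An increasing sequence of nonnegative energies with limit 0 vanishes at every level.
  Comparing the pairings of \<open>w\<close> with the potentials of \<open>x\<close> and of a corner
  eliminates the center mean and shows that the defect at \<open>x\<close> is the constant
  \<open>- w x\<close>, while it tends to 0.\<close>

lemma eq_0_if_energy_form_0:
  assumes w: "w \<in> dom_energy n" "energy_form n w w = 0" "w (corner 1) = 0" and x: "x \<in> K"
  shows "w x = 0"
proof -
  have lim: "(\<lambda>m. bil m w w) \<longlonglongrightarrow> 0" using energy_form_tendsto[OF w(1,1)] w(2) by simp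
  have "bil m w w \<le> 0" for m
    by (rule LIMSEQ_le_const[OF lim]) (use bil_mono in blast)
  then have "bil m w w = 0" for m using bil_nonneg[of m w] by (simp add: antisym)
  from bil_eq_0[OF this] have "w x + defect m x w = w (corner 1)" for m
    using bil_potential[of m x w] bil_potential_corner[of 1 m w] by simp
  then have "defect m x w = - w x" for m using w(3) by (metis add_eq_0_iff)
  moreover have "(\<lambda>m. defect m x w) \<longlonglongrightarrow> 0"
    using w(1) by (intro defect_tendsto x) (simp add: dom_energy_def)
  ultimately show ?thesis by (simp add: LIMSEQ_const_iff)
qed

section \<open>The kernel as a combination of potentials\<close>

lemma common_potential: "y \<in> K \<Longrightarrow> x \<in> K \<Longrightarrow> common y x = d 0 y / 2 + potential y x"
  by (simp add: common_def gp_def potential_def field_simps)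

lemma proj_coord_potential: "i \<in> {1..4} \<Longrightarrow> x \<in> K \<Longrightarrow> proj_coord i x = 1 / 2 + potential (corner i) x"
  by (simp add: proj_coord_def common_potential corner_in_vicsek d_0_corner)

text \<open>The harmonic measure of \<open>y\<close>: the value at \<open>y\<close> of the function
  that is 1 at \<open>corner i\<close>, 0 at the other corners, 1/4 at the center, affine on each
  half diagonal and constant off the diagonals.\<close>

definition weight :: "complex \<Rightarrow> nat \<Rightarrow> real" where
  "weight y i = (1 - diag_coord y) / 4 + proj_coord i y"

lemma sum_weight: "(\<Sum>i\<in>{1..4}. weight y i) = 1"
  unfolding weight_def sum.distrib diag_coord_def[symmetric] by (simp add: field_simps)

text \<open>The constant may depend on \<open>y\<close>, since the discrete forms only see
  differences in \<open>x\<close>.\<close>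

lemma green_potential:
  assumes y: "y \<in> K"
  shows "\<exists>c. \<forall>x\<in>K. green x y = potential y x - (\<Sum>i\<in>{1..4}. weight y i * potential (corner i) x) + c"
proof (intro exI ballI)
  fix x assume x: "x \<in> K"
  have S: "diag_coord x = 2 + (\<Sum>i\<in>{1..4}. potential (corner i) x)"
    unfolding diag_coord_def using x by (simp add: proj_coord_potential sum.distrib)
  have "(\<Sum>i\<in>{1..4}. proj_coord i x * proj_coord i y) =
      (\<Sum>i\<in>{1..4}. proj_coord i y / 2 + proj_coord i y * potential (corner i) x)"
    using x by (intro sum.cong) (auto simp: proj_coord_potential algebra_simps)
  also have "\<dots> = diag_coord y / 2 + (\<Sum>i\<in>{1..4}. proj_coord i y * potential (corner i) x)"
    by (simp add: sum.distrib diag_coord_def sum_divide_distrib)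
  finally have P: "(\<Sum>i\<in>{1..4}. proj_coord i x * proj_coord i y) =
      diag_coord y / 2 + (\<Sum>i\<in>{1..4}. proj_coord i y * potential (corner i) x)" .
  have W: "(\<Sum>i\<in>{1..4}. weight y i * potential (corner i) x) =
      (1 - diag_coord y) / 4 * (\<Sum>i\<in>{1..4}. potential (corner i) x) + (\<Sum>i\<in>{1..4}. proj_coord i y * potential (corner i) x)"
    unfolding weight_def distrib_right sum.distrib sum_distrib_left ..
  show "green x y = potential y x - (\<Sum>i\<in>{1..4}. weight y i * potential (corner i) x)
      + (d 0 y / 2 - diag_coord y / 2 - (1 - diag_coord y) / 4)"
    unfolding green_def S P W common_commute[OF x y] common_potential[OF y x] by (simp add: field_simps)
qed

text \<open>The weights sum to 1, so the center means from the corner potentials cancel the one from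
  the potential of \<open>y\<close>.\<close>

lemma bil_green:
  assumes y: "y \<in> K"
  shows "bil m (\<lambda>x. green x y) v = v y + defect m y v - (\<Sum>i\<in>{1..4}. weight y i * v (corner i))"
proof -
  obtain c where c: "\<And>x. x \<in> K \<Longrightarrow> green x y = potential y x - (\<Sum>i\<in>{1..4}. weight y i * potential (corner i) x) + c"
    using green_potential[OF y] by blast
  have "bil m (\<lambda>x. green x y) v =
      bil m (\<lambda>x. 1 * potential y x + (- 1) * (\<Sum>i\<in>{1..4}. weight y i * potential (corner i) x) + c) v"
    by (rule bil_cong) (simp_all add: c)
  also have "\<dots> = bil m (potential y) v - (\<Sum>i\<in>{1..4}. weight y i * bil m (potential (corner i)) v)"
    unfolding bil_lincomb by (simp add: bil_sum)
  also have "(\<Sum>i\<in>{1..4}. weight y i * bil m (potential (corner i)) v) =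
      (\<Sum>i\<in>{1..4}. weight y i * v (corner i) - weight y i * center_avg m v)"
    by (intro sum.cong) (auto simp: bil_potential_corner right_diff_distrib)
  also have "\<dots> = (\<Sum>i\<in>{1..4}. weight y i * v (corner i)) - center_avg m v"
    by (simp only: sum_subtractf sum_distrib_right[symmetric] sum_weight mult_1)
  finally show ?thesis unfolding bil_potential by simp
qed

text \<open>At a corner the factor \<open>1 - diag_coord (corner i)\<close> vanishes, and
  \<open>common (corner i) y\<close> is by definition \<open>proj_coord i y\<close>, the only
  surviving term of the sum.\<close>

lemma green_corner:
  assumes i: "i \<in> {1..4}" and y: "y \<in> K"
  shows "green (corner i) y = 0"
proof -
  have c: "corner i \<in> K" using corner_in_vicsek[OF i] .
  have p: "proj_coord j (corner i) = (if j = i then 1 else 0)" if "j \<in> {1..4}" for j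
    using that i by (simp add: proj_coord_potential c potential_corners)
  have "diag_coord (corner i) = (\<Sum>j\<in>{1..4}. if j = i then 1 else 0)"
    unfolding diag_coord_def using p by (intro sum.cong) auto
  then have "diag_coord (corner i) = 1" using i by simp
  moreover have "(\<Sum>j\<in>{1..4}. proj_coord j (corner i) * proj_coord j y) = (\<Sum>j\<in>{1..4}. if j = i then proj_coord i y else 0)"
    using p by (intro sum.cong) auto
  then have "(\<Sum>j\<in>{1..4}. proj_coord j (corner i) * proj_coord j y) = proj_coord i y" using i by simp
  ultimately show ?thesis by (simp add: green_def proj_coord_def)
qed

lemma continuous_green: "y \<in> K \<Longrightarrow> continuous_on K (\<lambda>x. green x y)" "x \<in> K \<Longrightarrow> continuous_on K (\<lambda>y. green x y)"
proof -
  show *: "continuous_on K (\<lambda>x. green x y)" if y: "y \<in> K" for y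
  proof -
    have "continuous_on K (\<lambda>x. common y x)" unfolding common_def by (rule continuous_gp[OF zero_in_vicsek y])
    then have "continuous_on K (\<lambda>x. common x y)" using common_commute[OF _ y] by (simp cong: continuous_on_cong)
    moreover have "continuous_on K diag_coord"
      unfolding diag_coord_def[abs_def] by (intro continuous_intros continuous_proj_coord)
    ultimately show ?thesis
      unfolding green_def by (intro continuous_intros continuous_proj_coord) auto
  qed
  show "continuous_on K (\<lambda>y. green x y)" if x: "x \<in> K" for x
    using *[OF x] green_commute[OF _ x] by (simp cong: continuous_on_cong)
qed

lemma green_bound:
  assumes x: "x \<in> K" and y: "y \<in> K"
  shows "\<bar>green x y\<bar> \<le> 17"
proof -
  have p: "\<bar>proj_coord i z\<bar> \<le> 1" if "i \<in> {1..4}" "z \<in> K" for i z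
    using proj_coord_bounds[OF that] by simp
  have D: "\<bar>1 - diag_coord z\<bar> \<le> 5" if z: "z \<in> K" for z
  proof -
    have "\<bar>diag_coord z\<bar> \<le> (\<Sum>i\<in>{1..4::nat}. 1)"
      unfolding diag_coord_def by (rule order_trans[OF sum_abs]) (intro sum_mono p z)
    then show ?thesis by simp
  qed
  have "\<bar>proj_coord i x * proj_coord i y\<bar> \<le> 1 * 1" if "i \<in> {1..4}" for i
    unfolding abs_mult using p[OF that] x y by (intro mult_mono) auto
  then have "\<bar>\<Sum>i\<in>{1..4}. proj_coord i x * proj_coord i y\<bar> \<le> (\<Sum>i\<in>{1..4::nat}. 1 * 1)"
    by (intro order_trans[OF sum_abs] sum_mono)
  then have 1: "\<bar>\<Sum>i\<in>{1..4}. proj_coord i x * proj_coord i y\<bar> \<le> 4" by simp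
  have "\<bar>(1 - diag_coord x) * (1 - diag_coord y)\<bar> \<le> 5 * 5"
    unfolding abs_mult using D x y by (intro mult_mono) auto
  then have 2: "\<bar>(1 - diag_coord x) * (1 - diag_coord y) / 4\<bar> \<le> 25 / 4" by simp
  have 3: "\<bar>common x y\<bar> \<le> 6"
    using gp_nonneg[OF zero_in_vicsek x y] gp_le[OF zero_in_vicsek x y] d_le[OF zero_in_vicsek x]
    unfolding common_def by simp
  \<comment> \<open>The bounds 25/4, 6 and 4 add up to less than 17.\<close>
  show ?thesis unfolding green_def using 1 2 3 by argo
qed

end

section \<open>The solution operator of the kernel and uniqueness\<close>

locale vicsek_measure_space = vicsek_set +
  fixes \<mu> :: "complex measure"
  assumes \<mu>: "vicsek_measure n \<mu>"
begin

lemma sets_\<mu>: "sets \<mu> = sets borel"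
  using \<mu> by (simp add: vicsek_measure_def)

lemma space_\<mu>: "space \<mu> = UNIV"
  using sets_eq_imp_space_eq[OF sets_\<mu>] by simp

sublocale finite_measure \<mu>
  using \<mu> by (intro finite_measureI) (simp add: vicsek_measure_def)

lemma vicsek_sets: "K \<in> sets \<mu>"
  using closed_vicsek by (simp add: sets_\<mu>)

lemma measure_vicsek: "measure \<mu> K = 1" "measure \<mu> UNIV = 1"
proof -
  have "measure \<mu> (id ` K) = 1 / real (4 * n - 3) ^ 0"
    using \<mu> unfolding vicsek_measure_def by (metis cell_maps.simps(1) insertI1)
  then show "measure \<mu> K = 1" by simp
  show "measure \<mu> UNIV = 1" using \<mu> by (simp add: vicsek_measure_def measure_def space_\<mu>)
qed

lemma AE_vicsek: "AE x in \<mu>. x \<in> K"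
proof (rule AE_I[where N = "UNIV - K"])
  have "measure \<mu> (UNIV - K) = 0"
    using finite_measure_compl[OF vicsek_sets] measure_vicsek by (simp add: space_\<mu>)
  then show "emeasure \<mu> (UNIV - K) = 0" by (simp add: emeasure_eq_measure)
  show "UNIV - K \<in> sets \<mu>" using sets.compl_sets[OF vicsek_sets] by (simp add: space_\<mu>)
qed auto

lemma measurable_vicsek: "continuous_on K g \<Longrightarrow> (\<lambda>y. indicator K y *\<^sub>R (g y :: real)) \<in> borel_measurable \<mu>"
  using borel_measurable_continuous_on_indicator[of K g] closed_vicsek sets_\<mu>
  by (simp cong: measurable_cong_sets)

lemma set_integrable_vicsek:
  fixes g :: "complex \<Rightarrow> real"
  assumes g: "continuous_on K g"
  shows "set_integrable \<mu> K g"
proof -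
  have "bounded (g ` K)" using compact_continuous_image[OF g vicsek(1)] by (rule compact_imp_bounded)
  then obtain B where "\<And>y. y \<in> K \<Longrightarrow> norm (g y) \<le> B" by (auto simp: bounded_iff)
  then have "norm (indicator K y *\<^sub>R g y) \<le> max B 0" for y
    by (cases "y \<in> K") (auto simp: le_max_iff_disj)
  then show ?thesis
    unfolding set_integrable_def using measurable_vicsek[OF g] by (intro integrable_const_bound) auto
qed

definition green_op :: "(complex \<Rightarrow> real) \<Rightarrow> complex \<Rightarrow> real" where
  "green_op f x = (LINT y:K|\<mu>. green x y * f y)"

context
  fixes f :: "complex \<Rightarrow> real"
  assumes f: "continuous_on K f"
begin

lemma set_integrable_green: "x \<in> K \<Longrightarrow> set_integrable \<mu> K (\<lambda>y. green x y * f y)"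
  using continuous_green(2) f by (intro set_integrable_vicsek continuous_intros)

lemma f_bound: "\<exists>A\<ge>0. \<forall>y\<in>K. \<bar>f y\<bar> \<le> A"
proof -
  have "bounded (f ` K)" using compact_continuous_image[OF f vicsek(1)] by (rule compact_imp_bounded)
  then obtain B where "\<And>y. y \<in> K \<Longrightarrow> norm (f y) \<le> B" by (auto simp: bounded_iff)
  then show ?thesis by (intro exI[of _ "max B 0"]) (auto simp: le_max_iff_disj)
qed

text \<open>A form at level \<open>m\<close> is a finite sum over edges, so it can be taken under
  the integral.\<close>

lemma bil_green_op:
  "integrable \<mu> (\<lambda>y. indicator K y *\<^sub>R (bil m (\<lambda>x. green x y) v * f y))"
  "bil m (green_op f) v = (LINT y|\<mu>. indicator K y *\<^sub>R (bil m (\<lambda>x. green x y) v * f y))"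
proof -
  define \<phi> where "\<phi> x y = indicator K y *\<^sub>R (green x y * f y)" for x y
  define c where "c = (2 * real n - 1) ^ m / 8"
  define h where "h p y = (\<phi> (fst p) y - \<phi> (snd p) y) * (v (fst p) - v (snd p))" for p y
  have int: "integrable \<mu> (\<phi> x)" if "x \<in> K" for x
    using set_integrable_green[OF that] unfolding set_integrable_def \<phi>_def .
  have ed: "fst p \<in> K" "snd p \<in> K" if "p \<in> edges m" for p
    using edges_subset[of "fst p" "snd p" m] that by auto
  have inth: "integrable \<mu> (h p)" if "p \<in> edges m" for p
    unfolding h_def using int ed[OF that] by (intro integrable_mult_left Bochner_Integration.integrable_diff)
  have eq: "indicator K y *\<^sub>R (bil m (\<lambda>x. green x y) v * f y) = c * (\<Sum>p\<in>edges m. h p y)" for y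
  proof (cases "y \<in> K")
    case True
    have "(\<Sum>(x, x')\<in>edges m. (green x y - green x' y) * (v x - v x')) * f y = (\<Sum>p\<in>edges m. h p y)"
      unfolding sum_distrib_right using True
      by (intro sum.cong refl) (auto simp: h_def \<phi>_def algebra_simps)
    then show ?thesis using True by (simp add: bil_def c_def mult.assoc)
  next
    case False
    then show ?thesis by (simp add: h_def \<phi>_def)
  qed
  show "integrable \<mu> (\<lambda>y. indicator K y *\<^sub>R (bil m (\<lambda>x. green x y) v * f y))"
    unfolding eq using inth by (intro integrable_mult_right Bochner_Integration.integrable_sum)
  have "(LINT y|\<mu>. h p y) = (green_op f (fst p) - green_op f (snd p)) * (v (fst p) - v (snd p))"
    if "p \<in> edges m" for p
    unfolding h_def green_op_def set_lebesgue_integral_def \<phi>_def[symmetric]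
    using int ed[OF that] by simp
  then show "bil m (green_op f) v = (LINT y|\<mu>. indicator K y *\<^sub>R (bil m (\<lambda>x. green x y) v * f y))"
    unfolding eq using inth by (simp add: integral_sum bil_def c_def split_beta)
qed

lemma green_op_corner: "i \<in> {1..4} \<Longrightarrow> green_op f (corner i) = 0"
  unfolding green_op_def set_lebesgue_integral_def
  by (intro integral_eq_zero_AE AE_I2) (auto simp: green_corner indicator_def)

lemma continuous_green_op: "continuous_on K (green_op f)"
  unfolding continuous_on_sequentially
proof (intro allI ballI impI)
  fix s x assume x: "x \<in> K" and s: "(\<forall>k. s k \<in> K) \<and> s \<longlonglongrightarrow> x"
  obtain A where A: "A \<ge> 0" "\<And>y. y \<in> K \<Longrightarrow> \<bar>f y\<bar> \<le> A" using f_bound by blast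
  have "(\<lambda>k. LINT y|\<mu>. indicator K y *\<^sub>R (green (s k) y * f y)) \<longlonglongrightarrow> (LINT y|\<mu>. indicator K y *\<^sub>R (green x y * f y))"
  proof (rule integral_dominated_convergence[where w = "\<lambda>_. 17 * A"])
    show "(\<lambda>y. indicator K y *\<^sub>R (green x y * f y)) \<in> borel_measurable \<mu>"
      "\<And>k. (\<lambda>y. indicator K y *\<^sub>R (green (s k) y * f y)) \<in> borel_measurable \<mu>"
      using s x continuous_green(2) f by (auto intro!: measurable_vicsek continuous_intros simp del: real_scaleR_def)
    show "AE y in \<mu>. (\<lambda>k. indicator K y *\<^sub>R (green (s k) y * f y)) \<longlonglongrightarrow> indicator K y *\<^sub>R (green x y * f y)"
    proof (intro AE_I2)
      fix y
      show "(\<lambda>k. indicator K y *\<^sub>R (green (s k) y * f y)) \<longlonglongrightarrow> indicator K y *\<^sub>R (green x y * f y)"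
      proof (cases "y \<in> K")
        case True
        then have "((\<lambda>x. green x y) \<circ> s) \<longlonglongrightarrow> green x y"
          using continuous_green(1)[OF True] x s unfolding continuous_on_sequentially by blast
        then show ?thesis by (intro tendsto_intros) (simp add: o_def)
      qed simp
    qed
    show "AE y in \<mu>. norm (indicator K y *\<^sub>R (green (s k) y * f y)) \<le> 17 * A" for k
    proof (intro AE_I2)
      fix y show "norm (indicator K y *\<^sub>R (green (s k) y * f y)) \<le> 17 * A"
      proof (cases "y \<in> K")
        case True
        then show ?thesis using green_bound[of "s k" y] s A by (auto simp: abs_mult intro!: mult_mono)
      qed (use A in simp)
    qed
  qed simp
  then show "(green_op f \<circ> s) \<longlonglongrightarrow> green_op f x"
    by (simp add: o_def green_op_def[abs_def] set_lebesgue_integral_def)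
qed

lemma bil_green_op_vanishing:
  assumes v: "\<And>i. i \<in> {1..4} \<Longrightarrow> v (corner i) = 0" and y: "y \<in> K"
  shows "bil m (\<lambda>x. green x y) v = v y + defect m y v"
  using v by (simp add: bil_green[OF y])

text \<open>The oscillation of \<open>v\<close> is at most 2C, so the defect is at most 26C. The
  bound does not depend on the level, which makes dominated convergence applicable.\<close>

lemma defect_bound_vicsek:
  assumes "\<And>x. x \<in> K \<Longrightarrow> \<bar>v x\<bar> \<le> C" "y \<in> K"
  shows "\<bar>v y + defect m y v\<bar> \<le> 27 * C"
proof -
  have osc: "\<bar>v (g x) - v (g z)\<bar> \<le> 2 * C" if "g \<in> cell_maps n m" "x \<in> K" "z \<in> K" for g x z
    using assms(1)[of "g x"] assms(1)[of "g z"] cell_maps_props(1)[OF that(1)] that by fastforce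
  have "\<bar>defect m y v\<bar> \<le> 13 * (2 * C)" by (rule defect_bound[OF assms(2)]) (rule osc)
  then show ?thesis using assms(1)[OF assms(2)] by simp
qed

lemma integrand_bound:
  assumes v: "\<And>i. i \<in> {1..4} \<Longrightarrow> v (corner i) = 0" and C: "\<And>x. x \<in> K \<Longrightarrow> \<bar>v x\<bar> \<le> C"
    and A: "\<And>x. x \<in> K \<Longrightarrow> \<bar>f x\<bar> \<le> A" "0 \<le> A"
  shows "norm (indicator K y *\<^sub>R (bil m (\<lambda>x. green x y) v * f y)) \<le> 27 * C * A"
proof -
  have "C \<ge> 0" using C[OF zero_in_vicsek] by simp
  show ?thesis
  proof (cases "y \<in> K")
    case True
    then show ?thesis
      using defect_bound_vicsek[of v C y m, OF C True] A \<open>C \<ge> 0\<close> bil_green_op_vanishing[where v = v and m = m, OF v True]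
      by (auto simp: abs_mult intro!: mult_mono)
  qed (use A \<open>C \<ge> 0\<close> in simp)
qed

text \<open>Pairing \<open>u\<close> with itself and moving the form under the integral turns the
  kernel into \<open>u y\<close> plus a defect, because \<open>u\<close> vanishes at the corners.
  Both are controlled by the supremum of \<open>u\<close>, so the discrete energies are bounded
  uniformly in the level.\<close>

lemma green_op_dom: "green_op f \<in> dom_energy n"
proof -
  define u where "u = green_op f"
  have "bounded (u ` K)"
    unfolding u_def using compact_continuous_image[OF continuous_green_op vicsek(1)] by (rule compact_imp_bounded)
  then obtain C where C: "\<And>x. x \<in> K \<Longrightarrow> \<bar>u x\<bar> \<le> C" by (auto simp: bounded_iff)
  obtain A where A: "A \<ge> 0" "\<And>y. y \<in> K \<Longrightarrow> \<bar>f y\<bar> \<le> A" using f_bound by blast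
  have u0: "u (corner i) = 0" if "i \<in> {1..4}" for i unfolding u_def using green_op_corner[OF that] .
  have "bil m u u \<le> 27 * C * A" for m
  proof -
    have "bil m u u = (LINT y|\<mu>. indicator K y *\<^sub>R (bil m (\<lambda>x. green x y) u * f y))"
      unfolding u_def by (rule bil_green_op(2))
    also have "\<dots> \<le> (LINT y|\<mu>. 27 * C * A)"
    proof (rule integral_mono)
      fix y
      show "indicator K y *\<^sub>R (bil m (\<lambda>x. green x y) u * f y) \<le> 27 * C * A"
        using integrand_bound[where v = u and C = C and A = A and y = y and m = m, OF u0 C A(2,1)] by (simp add: abs_le_iff)
    qed (auto intro: bil_green_op(1) simp del: real_scaleR_def)
    also have "\<dots> = 27 * C * A" using measure_vicsek(2) by (simp add: space_\<mu>)
    finally show ?thesis .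
  qed
  then have "energy n u < \<infinity>" unfolding energy_finite_iff by blast
  then show ?thesis using continuous_green_op by (simp add: dom_energy_def u_def)
qed

text \<open>Under the integral, the pairing of the kernel with \<open>v\<close> is
  \<open>v y\<close> plus the defect, which tends to 0 pointwise and boundedly.\<close>

lemma green_op_neg_laplacian: "neg_laplacian n \<mu> (green_op f) f"
  unfolding neg_laplacian_def
proof (intro conjI ballI impI green_op_dom f)
  fix v assume v: "v \<in> dom_energy n" "\<forall>i\<in>{1..4}. v (corner i) = 0"
  have vc: "continuous_on K v" using v(1) by (simp add: dom_energy_def)
  have "bounded (v ` K)" using compact_continuous_image[OF vc vicsek(1)] by (rule compact_imp_bounded)
  then obtain C where C: "\<And>x. x \<in> K \<Longrightarrow> \<bar>v x\<bar> \<le> C" by (auto simp: bounded_iff)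
  obtain A where A: "A \<ge> 0" "\<And>y. y \<in> K \<Longrightarrow> \<bar>f y\<bar> \<le> A" using f_bound by blast
  have v0: "v (corner i) = 0" if "i \<in> {1..4}" for i using v(2) that by blast
  have "(\<lambda>m. LINT y|\<mu>. indicator K y *\<^sub>R (bil m (\<lambda>x. green x y) v * f y)) \<longlonglongrightarrow> (LINT y|\<mu>. indicator K y *\<^sub>R (f y * v y))"
  proof (rule integral_dominated_convergence[where w = "\<lambda>_. 27 * C * A"])
    show "(\<lambda>y. indicator K y *\<^sub>R (f y * v y)) \<in> borel_measurable \<mu>"
      using f vc by (intro measurable_vicsek continuous_intros)
    show "(\<lambda>y. indicator K y *\<^sub>R (bil m (\<lambda>x. green x y) v * f y)) \<in> borel_measurable \<mu>" for m
      using bil_green_op(1) by (rule borel_measurable_integrable)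
    show "AE y in \<mu>. (\<lambda>m. indicator K y *\<^sub>R (bil m (\<lambda>x. green x y) v * f y)) \<longlonglongrightarrow> indicator K y *\<^sub>R (f y * v y)"
    proof (intro AE_I2)
      fix y
      show "(\<lambda>m. indicator K y *\<^sub>R (bil m (\<lambda>x. green x y) v * f y)) \<longlonglongrightarrow> indicator K y *\<^sub>R (f y * v y)"
      proof (cases "y \<in> K")
        case True
        have "(\<lambda>m. (v y + defect m y v) * f y) \<longlonglongrightarrow> (v y + 0) * f y"
          by (intro tendsto_intros defect_tendsto True vc)
        then show ?thesis using True bil_green_op_vanishing[where v = v, OF v0 True] by (simp add: mult.commute)
      qed simp
    qed
    show "AE y in \<mu>. norm (indicator K y *\<^sub>R (bil m (\<lambda>x. green x y) v * f y)) \<le> 27 * C * A" for m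
      by (intro AE_I2 integrand_bound v0 C A)
  qed simp
  then have "(\<lambda>m. bil m (green_op f) v) \<longlonglongrightarrow> (LINT y:K|\<mu>. f y * v y)"
    unfolding bil_green_op(2) set_lebesgue_integral_def .
  then show "energy_form n (green_op f) v = (LINT y:K|\<mu>. f y * v y)"
    using energy_form_tendsto[OF green_op_dom v(1)] LIMSEQ_unique by blast
qed

end

lemma green_function_green: "green_function n \<mu> green"
  unfolding green_function_def Let_def green_op_def[symmetric]
  using set_integrable_green green_op_neg_laplacian green_op_corner by blast

text \<open>The difference of two solutions is itself an admissible test function, so its energy is
  0.\<close>

lemma neg_laplacian_unique:
  assumes u: "neg_laplacian n \<mu> u f" "\<And>i. i \<in> {1..4} \<Longrightarrow> u (corner i) = 0"
    and v: "neg_laplacian n \<mu> v f" "\<And>i. i \<in> {1..4} \<Longrightarrow> v (corner i) = 0"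
    and x: "x \<in> K"
  shows "u x = v x"
proof -
  define w where "w x = u x - v x" for x
  have dom: "u \<in> dom_energy n" "v \<in> dom_energy n" using u(1) v(1) by (auto simp: neg_laplacian_def)
  have w: "w \<in> dom_energy n" unfolding w_def[abs_def] by (rule dom_energy_plus_minus(2)[OF dom])
  have w0: "\<forall>i\<in>{1..4}. w (corner i) = 0" using u(2) v(2) by (simp add: w_def)
  have "energy_form n u w = energy_form n v w"
    using u(1) v(1) w w0 unfolding neg_laplacian_def by metis
  then have "(\<lambda>m. bil m u w - bil m v w) \<longlonglongrightarrow> 0"
    using tendsto_diff[OF energy_form_tendsto[OF dom(1) w] energy_form_tendsto[OF dom(2) w]] by simp
  then have "(\<lambda>m. bil m w w) \<longlonglongrightarrow> 0" unfolding w_def[abs_def] bil_diff .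
  then have "energy_form n w w = 0" using energy_form_tendsto[OF w w] LIMSEQ_unique by blast
  then have "w x = 0" using eq_0_if_energy_form_0[OF w _ _ x] w0 by simp
  then show ?thesis by (simp add: w_def)
qed

text \<open>For each continuous \<open>f\<close> both kernels solve the same boundary value problem,
  so their integrals against \<open>f\<close> agree at every point of \<open>K\<close>. The
  exceptional null set may depend on \<open>x\<close>.\<close>

lemma green_function_unique:
  assumes G: "green_function n \<mu> G" and H: "green_function n \<mu> H" and x: "x \<in> K"
  shows "AE y in \<mu>. H x y = G x y"
proof -
  define \<phi> where "\<phi> y = indicator K y *\<^sub>R (H x y - G x y)" for y
  have int: "integrable \<mu> (\<lambda>y. indicator K y *\<^sub>R (H x y * f y))" "integrable \<mu> (\<lambda>y. indicator K y *\<^sub>R (G x y * f y))"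
    if "continuous_on K f" for f
    using G H x that unfolding green_function_def set_integrable_def by blast+
  have "AE y in \<mu>. \<phi> y = 0"
  proof (rule AE_zero_if_continuous_integrals_zero[OF sets_\<mu>])
    show "finite_measure \<mu>" by unfold_locales
    show "integrable \<mu> \<phi>"
      using Bochner_Integration.integrable_diff[OF int[of "\<lambda>_. 1"]] by (simp add: \<phi>_def[abs_def] right_diff_distrib)
    fix f :: "complex \<Rightarrow> real" assume "continuous_on UNIV f"
    then have f: "continuous_on K f" using continuous_on_subset by blast
    have "(LINT y:K|\<mu>. H x y * f y) = (LINT y:K|\<mu>. G x y * f y)"
      using G H f unfolding green_function_def Let_def
      by (intro neg_laplacian_unique[where u = "\<lambda>x. LINT y:K|\<mu>. H x y * f y" and v = "\<lambda>x. LINT y:K|\<mu>. G x y * f y" and f = f] x) blast+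
    moreover have "(LINT y|\<mu>. \<phi> y * f y) = (LINT y|\<mu>. indicator K y *\<^sub>R (H x y * f y) - indicator K y *\<^sub>R (G x y * f y))"
      by (rule Bochner_Integration.integral_cong) (auto simp: \<phi>_def algebra_simps)
    moreover have "\<dots> = (LINT y:K|\<mu>. H x y * f y) - (LINT y:K|\<mu>. G x y * f y)"
      unfolding set_lebesgue_integral_def by (rule Bochner_Integration.integral_diff[OF int[OF f]])
    ultimately show "(LINT y|\<mu>. \<phi> y * f y) = 0" by simp
  qed
  with AE_vicsek show ?thesis by eventually_elim (simp add: \<phi>_def)
qed

end

theorem mainTheorem7:
  fixes n :: nat and \<mu> :: "complex measure"
  assumes "n \<ge> 2" and "vicsek_measure n \<mu>"
  shows "\<exists>G :: complex \<Rightarrow> complex \<Rightarrow> real.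
    green_function n \<mu> G \<and>
    (\<forall>H. green_function n \<mu> H \<longrightarrow> (\<forall>x\<in>vicsek n. AE y in \<mu>. H x y = G x y)) \<and>
    (\<forall>x\<in>vicsek n. \<forall>y\<in>vicsek n.
      ((\<exists>i\<in>{1..4}. \<exists>j\<in>{1..4}. i \<noteq> j \<and> x \<in> arm n i \<and> y \<in> arm n j) \<longrightarrow>
        G x y = (1 - diag_dist n x) * (1 - diag_dist n y) / 4) \<and>
      ((\<exists>i\<in>{1..4}. x \<in> arm n i \<and> y \<in> arm n i) \<and> diag_dist n x < diag_dist n y \<longrightarrow>
        G x y = (1 - diag_dist n y) * (3 * diag_dist n x + 1) / 4) \<and>
      ((\<exists>i\<in>{1..4}. x \<in> arm n i \<and> y \<in> arm n i) \<and> diag_dist n y < diag_dist n x \<longrightarrow>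
        G x y = (1 - diag_dist n x) * (3 * diag_dist n y + 1) / 4) \<and>
      ((\<exists>i\<in>{1..4}. x \<in> arm n i \<and> y \<in> arm n i) \<and> diag_dist n x = diag_dist n y \<longrightarrow>
        G x y = (1 - diag_dist n y) * (3 * diag_dist n y + 1) / 4
                + vdist n (diag_proj n y) (last_common n (diag_proj n y) x y)))"
proof -
  interpret vicsek_measure_space n \<mu> by unfold_locales fact+
  show ?thesis
  proof (intro exI[of _ green] conjI allI ballI impI)
    show "green_function n \<mu> green" by (rule green_function_green)
    show "AE y in \<mu>. H x y = green x y" if "green_function n \<mu> H" "x \<in> vicsek n" for H x
      using green_function_unique[OF green_function_green that] .
  next
    fix x y assume "x \<in> vicsek n" "y \<in> vicsek n"
      "\<exists>i\<in>{1..4}. \<exists>j\<in>{1..4}. i \<noteq> j \<and> x \<in> arm n i \<and> y \<in> arm n j"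
    then show "green x y = (1 - diag_dist n x) * (1 - diag_dist n y) / 4"
      using green_different_arms by blast
  next
    fix x y assume "x \<in> vicsek n" "y \<in> vicsek n"
      "(\<exists>i\<in>{1..4}. x \<in> arm n i \<and> y \<in> arm n i) \<and> diag_dist n x < diag_dist n y"
    then show "green x y = (1 - diag_dist n y) * (3 * diag_dist n x + 1) / 4"
      using green_same_arm_less by blast
  next
    fix x y assume xy: "x \<in> vicsek n" "y \<in> vicsek n"
      and *: "(\<exists>i\<in>{1..4}. x \<in> arm n i \<and> y \<in> arm n i) \<and> diag_dist n y < diag_dist n x"
    \<comment> \<open>The third case is the second one with the arguments exchanged.\<close>
    from * have "green y x = (1 - diag_dist n x) * (3 * diag_dist n y + 1) / 4"
      using green_same_arm_less by blast
    then show "green x y = (1 - diag_dist n x) * (3 * diag_dist n y + 1) / 4"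
      using green_commute[OF xy] by simp
  next
    fix x y assume "x \<in> vicsek n" "y \<in> vicsek n"
      "(\<exists>i\<in>{1..4}. x \<in> arm n i \<and> y \<in> arm n i) \<and> diag_dist n x = diag_dist n y"
    then show "green x y = (1 - diag_dist n y) * (3 * diag_dist n y + 1) / 4
        + vdist n (diag_proj n y) (last_common n (diag_proj n y) x y)"
      using green_same_projection by blast
  qed
qed

end
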